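(* Let $M$ be a finitely presented persistence module. Then $$|M|=|\mathrm{Gr}_0(M)|-|\mathrm{Gr}_1(M)|,$$ where the left-hand side is the persistent magnitude of $M$ and the right-hand side involves the graded magnitudes of the $\mathbb{R}$-graded modules $\mathrm{Gr}_0(M)$ and $\mathrm{Gr}_1(M)$.
   Context: Fix a field $\Bbbk$. A persistence module is a functor $(\mathbb{R},\le)\to\mathbf{Vect}_\Bbbk$. The interval module $\Bbbk[a,b)$ ($-\infty<a<b\le\infty$) is $\Bbbk$ at points of $[a,b)$ and $0$ elsewhere, with identity structure maps between points of $[a,b)$. A persistence module is finitely presented if and only if it is isomorphic to a finite direct sum of interval modules $\Bbbk[a,b)$. The persistent magnitude of a finitely presented $M\cong\bigoplus_{i=1}^n\Bbbk[a_i,b_i)$ is $|M|=\sum_{i=1}^n(e^{-a_i}-e^{-b_i})$, with $e^{-\infty}=0$. The associated graded functor $\mathrm{Gr}$, from persistence modules to $\mathbb{R}$-graded $\Bbbk$-vector spaces, is $\mathrm{Gr}(M)(s)=M(s)\big/\sum_{s'<s}\mathrm{im}(M(s')\to M(s))$ for $s\in\mathbb{R}$. It is right exact, and $\mathrm{Gr}_i$, $i\ge0$, denote its left derived functors, with $\mathrm{Gr}_0=\mathrm{Gr}$. For $a\in\mathbb{R}$, $\Bbbk_a$ is the $\mathbb{R}$-graded vector space equal to $\Bbbk$ in grading $a$ and $0$ in all other gradings. The graded magnitude of a finitely presented $\mathbb{R}$-graded module $\bigoplus_{i=1}^n\Bbbk_{a_i}$ is $\sum_{i=1}^n e^{-a_i}$.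 *)

theory Defs
  imports
    Complex_Main
    "HOL-Algebra.AbelCoset"
    "HOL-Library.Extended_Real"
    "HOL-Library.FuncSet"
    "Jordan_Normal_Form.Missing_VectorSpace"
begin

section \<open>Vector spaces\<close>

text \<open>A vector space over \<open>K\<close> is a record \<open>V\<close> with \<^const>\<open>vectorspace\<close> \<open>K V\<close>.  The fields
  \<open>mult\<close> and \<open>one\<close> that the module record inherits from rings carry no information.\<close>

definition field_vs :: "('k, 'm) ring_scheme \<Rightarrow> ('k, 'k) module" where
  "field_vs K = \<lparr>carrier = carrier K, mult = mult K, one = \<one>\<^bsub>K\<^esub>, zero = \<zero>\<^bsub>K\<^esub>,
     add = add K, smult = mult K\<rparr>"

definition zero_vs :: "('k, 'm) ring_scheme \<Rightarrow> ('k, 'k) module" where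
  "zero_vs K = (field_vs K)\<lparr>carrier := {\<zero>\<^bsub>K\<^esub>}\<rparr>"

text \<open>The direct sum of a finite family; it is only used for finite \<open>I\<close>, where it coincides with
  the product.\<close>

definition vs_sum :: "'i set \<Rightarrow> ('i \<Rightarrow> ('k, 'v) module) \<Rightarrow> ('k, 'i \<Rightarrow> 'v) module" where
  "vs_sum I V = \<lparr>carrier = (\<Pi>\<^sub>E i\<in>I. carrier (V i)),
     mult = (\<lambda>x y. \<lambda>i\<in>I. \<zero>\<^bsub>V i\<^esub>), one = (\<lambda>i\<in>I. \<zero>\<^bsub>V i\<^esub>),
     zero = (\<lambda>i\<in>I. \<zero>\<^bsub>V i\<^esub>),
     add = (\<lambda>x y. \<lambda>i\<in>I. x i \<oplus>\<^bsub>V i\<^esub> y i),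
     smult = (\<lambda>c x. \<lambda>i\<in>I. c \<odot>\<^bsub>V i\<^esub> x i)\<rparr>"

text \<open>The quotient of \<open>V\<close> by a subspace \<open>W\<close>, with cosets as elements.\<close>

definition vs_quot :: "('k, 'v) module \<Rightarrow> 'v set \<Rightarrow> ('k, 'v set) module" where
  "vs_quot V W = \<lparr>carrier = a_rcosets\<^bsub>V\<^esub> W, mult = (\<lambda>A B. W), one = W, zero = W,
     add = set_add V, smult = (\<lambda>c A. \<Union>x\<in>A. W +>\<^bsub>V\<^esub> (c \<odot>\<^bsub>V\<^esub> x))\<rparr>"


section \<open>Persistence modules\<close>

text \<open>\<open>pm_map M s t\<close> is the structure map \<open>M(s) \<rightarrow> M(t)\<close>; it is only meaningful for \<open>s \<le> t\<close> and
  on the carrier of \<open>M(s)\<close>.\<close>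

record ('k, 'v) pmod =
  pm_space :: "real \<Rightarrow> ('k, 'v) module"
  pm_map :: "real \<Rightarrow> real \<Rightarrow> 'v \<Rightarrow> 'v"

definition persistence_module :: "('k, 'm) ring_scheme \<Rightarrow> ('k, 'v) pmod \<Rightarrow> bool" where
  "persistence_module K M \<longleftrightarrow>
     (\<forall>s. vectorspace K (pm_space M s)) \<and>
     (\<forall>s t. s \<le> t \<longrightarrow> pm_map M s t \<in> module_hom K (pm_space M s) (pm_space M t)) \<and>
     (\<forall>s. \<forall>x\<in>carrier (pm_space M s). pm_map M s s x = x) \<and>
     (\<forall>r s t. r \<le> s \<longrightarrow> s \<le> t \<longrightarrow>
        (\<forall>x\<in>carrier (pm_space M r). pm_map M s t (pm_map M r s x) = pm_map M r t x))"

definition pm_hom ::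
  "('k, 'm) ring_scheme \<Rightarrow> ('k, 'v) pmod \<Rightarrow> ('k, 'w) pmod \<Rightarrow> (real \<Rightarrow> 'v \<Rightarrow> 'w) set" where
  "pm_hom K M N = {f. (\<forall>s. f s \<in> module_hom K (pm_space M s) (pm_space N s)) \<and>
     (\<forall>s t. s \<le> t \<longrightarrow>
        (\<forall>x\<in>carrier (pm_space M s). f t (pm_map M s t x) = pm_map N s t (f s x)))}"

definition pm_epi ::
  "('k, 'm) ring_scheme \<Rightarrow> ('k, 'v) pmod \<Rightarrow> ('k, 'w) pmod \<Rightarrow> (real \<Rightarrow> 'v \<Rightarrow> 'w) set" where
  "pm_epi K M N =
     {f \<in> pm_hom K M N. \<forall>s. f s ` carrier (pm_space M s) = carrier (pm_space N s)}"

definition pm_exact_at ::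
  "('k, 'u) pmod \<Rightarrow> ('k, 'v) pmod \<Rightarrow> ('k, 'w) pmod \<Rightarrow> (real \<Rightarrow> 'u \<Rightarrow> 'v) \<Rightarrow> (real \<Rightarrow> 'v \<Rightarrow> 'w) \<Rightarrow> bool"
where
  "pm_exact_at L M N f g \<longleftrightarrow>
     (\<forall>s. f s ` carrier (pm_space L s) =
          {x \<in> carrier (pm_space M s). g s x = \<zero>\<^bsub>pm_space N s\<^esub>})"

definition pm_iso :: "('k, 'm) ring_scheme \<Rightarrow> ('k, 'v) pmod \<Rightarrow> ('k, 'w) pmod \<Rightarrow> bool" where
  "pm_iso K M N \<longleftrightarrow>
     (\<exists>f\<in>pm_hom K M N. \<forall>s. bij_betw (f s) (carrier (pm_space M s)) (carrier (pm_space N s)))"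

definition pm_sum :: "'i set \<Rightarrow> ('i \<Rightarrow> ('k, 'v) pmod) \<Rightarrow> ('k, 'i \<Rightarrow> 'v) pmod" where
  "pm_sum I M = \<lparr>pm_space = (\<lambda>s. vs_sum I (\<lambda>i. pm_space (M i) s)),
     pm_map = (\<lambda>s t x. \<lambda>i\<in>I. pm_map (M i) s t (x i))\<rparr>"

definition interval_pm :: "('k, 'm) ring_scheme \<Rightarrow> real \<Rightarrow> ereal \<Rightarrow> ('k, 'k) pmod" where
  "interval_pm K a b =
     \<lparr>pm_space = (\<lambda>s. if a \<le> s \<and> ereal s < b then field_vs K else zero_vs K),
      pm_map = (\<lambda>s t x. if a \<le> s \<and> ereal t < b then x else \<zero>\<^bsub>K\<^esub>)\<rparr>"

text \<open>The modules \<open>k[a, \<infinity>)\<close> are the representable functors, i.e. the free persistence modules on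
  one generator in degree \<open>a\<close>.  A finitely presented module is the cokernel of a morphism between
  free modules of finite rank.\<close>

definition free_pm :: "('k, 'm) ring_scheme \<Rightarrow> nat \<Rightarrow> (nat \<Rightarrow> real) \<Rightarrow> ('k, nat \<Rightarrow> 'k) pmod" where
  "free_pm K n a = pm_sum {..<n} (\<lambda>i. interval_pm K (a i) \<infinity>)"

definition finitely_presented_pm :: "('k, 'm) ring_scheme \<Rightarrow> ('k, 'v) pmod \<Rightarrow> bool" where
  "finitely_presented_pm K M \<longleftrightarrow> persistence_module K M \<and>
     (\<exists>m n b a. \<exists>f\<in>pm_hom K (free_pm K m b) (free_pm K n a). \<exists>p\<in>pm_epi K (free_pm K n a) M.
        pm_exact_at (free_pm K m b) (free_pm K n a) M f p)"

definition exp_neg :: "ereal \<Rightarrow> real" where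
  "exp_neg b = (if b = \<infinity> then 0 else exp (- real_of_ereal b))"

definition persistent_magnitude :: "('k, 'm) ring_scheme \<Rightarrow> ('k, 'v) pmod \<Rightarrow> real" where
  "persistent_magnitude K M = (THE r. \<exists>n (a :: nat \<Rightarrow> real) (b :: nat \<Rightarrow> ereal).
     (\<forall>i<n. ereal (a i) < b i) \<and>
     pm_iso K M (pm_sum {..<n} (\<lambda>i. interval_pm K (a i) (b i))) \<and>
     r = (\<Sum>i<n. exp (- a i) - exp_neg (b i)))"


section \<open>Graded vector spaces\<close>

type_synonym ('k, 'v) graded = "real \<Rightarrow> ('k, 'v) module"

definition graded_iso ::
  "('k, 'm) ring_scheme \<Rightarrow> ('k, 'v) graded \<Rightarrow> ('k, 'w) graded \<Rightarrow> bool" where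
  "graded_iso K G H \<longleftrightarrow>
     (\<exists>f. \<forall>s. f s \<in> module_hom K (G s) (H s) \<and> bij_betw (f s) (carrier (G s)) (carrier (H s)))"

definition graded_point :: "('k, 'm) ring_scheme \<Rightarrow> real \<Rightarrow> ('k, 'k) graded" where
  "graded_point K a s = (if s = a then field_vs K else zero_vs K)"

definition graded_sum :: "'i set \<Rightarrow> ('i \<Rightarrow> ('k, 'v) graded) \<Rightarrow> ('k, 'i \<Rightarrow> 'v) graded" where
  "graded_sum I G s = vs_sum I (\<lambda>i. G i s)"

definition finitely_presented_graded :: "('k, 'm) ring_scheme \<Rightarrow> ('k, 'v) graded \<Rightarrow> bool" where
  "finitely_presented_graded K G \<longleftrightarrow> (\<forall>s. vectorspace K (G s)) \<and>
     (\<exists>n a. graded_iso K G (graded_sum {..<n::nat} (\<lambda>i. graded_point K (a i))))"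

definition graded_magnitude :: "('k, 'm) ring_scheme \<Rightarrow> ('k, 'v) graded \<Rightarrow> real" where
  "graded_magnitude K G = (THE r. \<exists>n (a :: nat \<Rightarrow> real).
     graded_iso K G (graded_sum {..<n} (\<lambda>i. graded_point K (a i))) \<and>
     r = (\<Sum>i<n. exp (- a i)))"

text \<open>Homology of a complex \<open>\<dots> \<rightarrow> C 2 \<rightarrow> C 1 \<rightarrow> C 0 \<rightarrow> 0\<close> with differentials
  \<open>d n : C (n + 1) \<rightarrow> C n\<close>.\<close>

definition graded_cycles ::
  "(nat \<Rightarrow> ('k, 'v) graded) \<Rightarrow> (nat \<Rightarrow> real \<Rightarrow> 'v \<Rightarrow> 'v) \<Rightarrow> nat \<Rightarrow> real \<Rightarrow> 'v set" where
  "graded_cycles C d n s = (case n of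
     0 \<Rightarrow> carrier (C 0 s)
   | Suc m \<Rightarrow> {x \<in> carrier (C (Suc m) s). d m s x = \<zero>\<^bsub>C m s\<^esub>})"

definition graded_homology ::
  "(nat \<Rightarrow> ('k, 'v) graded) \<Rightarrow> (nat \<Rightarrow> real \<Rightarrow> 'v \<Rightarrow> 'v) \<Rightarrow> nat \<Rightarrow> ('k, 'v set) graded" where
  "graded_homology C d n s =
     vs_quot ((C n s)\<lparr>carrier := graded_cycles C d n s\<rparr>) (d n s ` carrier (C (Suc n) s))"


section \<open>The associated graded functor\<close>

text \<open>A sum of subspaces is the span of their union.\<close>

definition pm_rad :: "('k, 'm) ring_scheme \<Rightarrow> ('k, 'v) pmod \<Rightarrow> real \<Rightarrow> 'v set" where
  "pm_rad K M s = LinearCombinations.module.span K (pm_space M s)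
     (\<Union>s'\<in>{..<s}. pm_map M s' s ` carrier (pm_space M s'))"

definition Gr :: "('k, 'm) ring_scheme \<Rightarrow> ('k, 'v) pmod \<Rightarrow> ('k, 'v set) graded" where
  "Gr K M s = vs_quot (pm_space M s) (pm_rad K M s)"

text \<open>The map \<open>Gr(M) \<rightarrow> Gr(N)\<close> induced by \<open>f : M \<rightarrow> N\<close>: it sends the coset of \<open>x\<close> to the coset of
  \<open>f x\<close>.\<close>

definition Gr_map ::
  "('k, 'm) ring_scheme \<Rightarrow> ('k, 'w) pmod \<Rightarrow> (real \<Rightarrow> 'v \<Rightarrow> 'w) \<Rightarrow> real \<Rightarrow> 'v set \<Rightarrow> 'w set" where
  "Gr_map K N f s X = (\<Union>x\<in>X. pm_rad K N s +>\<^bsub>pm_space N s\<^esub> f s x)"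


section \<open>Left derived functors of the associated graded functor\<close>

text \<open>Lifting is required against epimorphisms of persistence modules whose elements lie in the
  type \<open>real \<times> 'p \<Rightarrow> 'k\<close>.  This is no restriction: the free module on all elements of \<open>P\<close> (finitely
  supported functions \<open>real \<times> 'p \<Rightarrow> 'k\<close>) and a copy of \<open>P\<close> itself (send \<open>x\<close> to the indicator
  function of \<open>(0, x)\<close>) both live in this type, so lifting the identity of \<open>P\<close> along the canonical
  epimorphism makes \<open>P\<close> a direct summand of a free module, and \<open>P\<close> then lifts against every
  epimorphism of persistence modules over any type.\<close>

definition pm_projective :: "('k, 'm) ring_scheme \<Rightarrow> ('k, 'p) pmod \<Rightarrow> bool" where
  "pm_projective K P \<longleftrightarrow> persistence_module K P \<and>
     (\<forall>(X :: ('k, real \<times> 'p \<Rightarrow> 'k) pmod) (Y :: ('k, real \<times> 'p \<Rightarrow> 'k) pmod).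
        persistence_module K X \<longrightarrow> persistence_module K Y \<longrightarrow>
        (\<forall>g\<in>pm_epi K X Y. \<forall>f\<in>pm_hom K P Y. \<exists>h\<in>pm_hom K P X.
           \<forall>s. \<forall>x\<in>carrier (pm_space P s). g s (h s x) = f s x))"

definition projective_resolution ::
  "('k, 'm) ring_scheme \<Rightarrow> ('k, 'v) pmod \<Rightarrow> (nat \<Rightarrow> ('k, 'p) pmod) \<Rightarrow>
   (nat \<Rightarrow> real \<Rightarrow> 'p \<Rightarrow> 'p) \<Rightarrow> (real \<Rightarrow> 'p \<Rightarrow> 'v) \<Rightarrow> bool" where
  "projective_resolution K M P d e \<longleftrightarrow>
     (\<forall>n. pm_projective K (P n)) \<and>
     (\<forall>n. d n \<in> pm_hom K (P (Suc n)) (P n)) \<and>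
     e \<in> pm_epi K (P 0) M \<and>
     pm_exact_at (P (Suc 0)) (P 0) M (d 0) e \<and>
     (\<forall>n. pm_exact_at (P (Suc (Suc n))) (P (Suc n)) (P n) (d (Suc n)) (d n))"

text \<open>A choice of a projective resolution.  Every \<open>M\<close> over the type \<open>'v\<close> has one over the type
  \<open>real \<times> 'v \<Rightarrow> 'k\<close>: that type contains the free module on all elements of \<open>M\<close>, and by cardinality
  also copies of the free modules on all elements of the successive kernels.\<close>

definition chosen_resolution ::
  "('k, 'm) ring_scheme \<Rightarrow> ('k, 'v) pmod \<Rightarrow>
   (nat \<Rightarrow> ('k, real \<times> 'v \<Rightarrow> 'k) pmod) \<times> (nat \<Rightarrow> real \<Rightarrow> (real \<times> 'v \<Rightarrow> 'k) \<Rightarrow> (real \<times> 'v \<Rightarrow> 'k))"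
where
  "chosen_resolution K M = (SOME (P, d). \<exists>e. projective_resolution K M P d e)"

definition Gr_derived ::
  "('k, 'm) ring_scheme \<Rightarrow> nat \<Rightarrow> ('k, 'v) pmod \<Rightarrow> ('k, (real \<times> 'v \<Rightarrow> 'k) set set) graded" where
  "Gr_derived K i M = (case chosen_resolution K M of
     (P, d) \<Rightarrow> graded_homology (\<lambda>n. Gr K (P n)) (\<lambda>n. Gr_map K (P n) (d n)) i)"

end

theory Submission
  imports Defs
begin

text \<open>A finite presentation is a linear map between two filtered spaces of finite dimension, and the
  persistence algorithm brings it to diagonal form, so \<open>M\<close> is a finite sum of bars
  \<open>k[a\<^sub>i, b\<^sub>i)\<close>.  For any projective resolution \<open>P \<rightarrow> M\<close> one has \<open>Gr\<^sub>0(M)(s) = Gr(M)(s)\<close>, and,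
  because the structure maps of \<open>P\<^sub>0\<close> are injective, \<open>Gr\<^sub>1(M)(s)\<close> is the kernel of the map to \<open>M(s)\<close>
  from the colimit of the \<open>M(t)\<close> with \<open>t < s\<close>.  Hence \<open>Gr\<^sub>0\<close> counts the bars that start at \<open>s\<close> and
  \<open>Gr\<^sub>1\<close> those that end there.  Since graded magnitudes are well defined by invariance of dimension,
  this also shows that \<open>\<Sum>\<^sub>i exp(-a\<^sub>i) - exp(-b\<^sub>i)\<close> does not depend on the decomposition.\<close>

text \<open>The graded module \<open>Gr_derived\<close> is built on a resolution picked by
  \<open>SOME\<close>, of which nothing is known except that it is a projective resolution, and
  resolutions are never compared with each other. The homology is therefore computed for an
  arbitrary projective resolution; the only consequence of projectivity that enters this computation
  is the injectivity of structure maps, extracted from the lifting property. The kernel that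
  describes \<open>Gr_1\<close> arises from a diagram chase. A cycle of \<open>Gr(P_1)\<close> in
  degree \<open>s\<close> is the class of an \<open>x\<close> whose boundary comes from some
  \<open>y\<close> in \<open>P_0(t)\<close> with \<open>t < s\<close>. Injectivity makes
  \<open>y\<close> unique once \<open>t\<close> is moved close enough to \<open>s\<close>, and the
  image of \<open>y\<close> in \<open>M(t)\<close> dies in \<open>M(s)\<close> because the boundary
  of \<open>x\<close> maps to zero there. No colimit has to be constructed: among finitely many bars
  there is a degree \<open>s0 < s\<close> such that no bar begins or ends strictly between
  \<open>s0\<close> and \<open>s\<close>, and every degree from \<open>s0\<close> up to
  \<open>s\<close> (exclusive) serves as the colimit.\<close>

section \<open>Linear maps and transport of vector space structure\<close>

lemma module_hom_zero:
  assumes "module K V" "module K W" "f \<in> module_hom K V W"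
  shows "f \<zero>\<^bsub>V\<^esub> = \<zero>\<^bsub>W\<^esub>"
proof -
  interpret mod_hom K V W f using assms by (simp add: mod_hom_def mod_hom_axioms_def)
  show ?thesis by simp
qed

lemma module_hom_minus:
  assumes "module K V" "module K W" "f \<in> module_hom K V W" "x \<in> carrier V" "y \<in> carrier V"
  shows "f (x \<ominus>\<^bsub>V\<^esub> y) = f x \<ominus>\<^bsub>W\<^esub> f y"
proof -
  interpret mod_hom K V W f using assms by (simp add: mod_hom_def mod_hom_axioms_def)
  show ?thesis using assms by simp
qed

lemma module_hom_mem: "f \<in> module_hom K V W \<Longrightarrow> x \<in> carrier V \<Longrightarrow> f x \<in> carrier W"
  by (auto simp: module_hom_def)

lemma module_hom_comp:
  "f \<in> module_hom K V W \<Longrightarrow> g \<in> module_hom K U V \<Longrightarrow> (\<lambda>x. f (g x)) \<in> module_hom K U W"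
  by (auto simp: module_hom_def Pi_iff)

lemma module_hom_inv:
  assumes f: "f \<in> module_hom K V W" and bij: "bij_betw f (carrier V) (carrier W)"
    and V: "module K V"
  shows "inv_into (carrier V) f \<in> module_hom K W V"
proof -
  interpret module K V by fact
  have eq: "inv_into (carrier V) f y = x" if "x \<in> carrier V" "f x = y" for x y
    using bij that by (auto simp: bij_betw_def inv_into_f_f)
  have mem: "inv_into (carrier V) f y \<in> carrier V" "f (inv_into (carrier V) f y) = y"
    if "y \<in> carrier W" for y
    using bij that by (auto simp: bij_betw_def inv_into_into f_inv_into_f)
  show ?thesis
    unfolding module_hom_def
    using mem by (auto intro!: eq simp: module_hom_add[OF f] module_hom_smult[OF f])
qed

lemma module_hom_injI:
  assumes "module K V" "module K W" "f \<in> module_hom K V W"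
    and "\<And>x. x \<in> carrier V \<Longrightarrow> f x = \<zero>\<^bsub>W\<^esub> \<Longrightarrow> x = \<zero>\<^bsub>V\<^esub>"
  shows "inj_on f (carrier V)"
proof (rule inj_onI)
  fix x y assume xy: "x \<in> carrier V" "y \<in> carrier V" "f x = f y"
  interpret V: module K V by fact
  interpret W: module K W by fact
  have "f (x \<ominus>\<^bsub>V\<^esub> y) = \<zero>\<^bsub>W\<^esub>"
    using xy by (simp add: module_hom_minus[OF assms(1-3)] module_hom_mem[OF assms(3)])
  then show "x = y" using assms(4)[of "x \<ominus>\<^bsub>V\<^esub> y"] xy by simp
qed

lemma vectorspace_module: "vectorspace K V \<Longrightarrow> module K V"
  by (simp add: vectorspace_def)

text \<open>The axioms are identities, hence pass to the image of any \<open>q\<close> compatible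
  with the operations, injective or not. It serves for quotients (\<open>q\<close> the coset map)
  and for relabelled copies of a space.\<close>

lemma vectorspace_image:
  assumes "vectorspace K V"
    and carr: "carrier W = q ` carrier V"
    and zero: "\<zero>\<^bsub>W\<^esub> = q \<zero>\<^bsub>V\<^esub>"
    and add: "\<And>x y. x \<in> carrier V \<Longrightarrow> y \<in> carrier V \<Longrightarrow> q x \<oplus>\<^bsub>W\<^esub> q y = q (x \<oplus>\<^bsub>V\<^esub> y)"
    and smult: "\<And>c x. c \<in> carrier K \<Longrightarrow> x \<in> carrier V \<Longrightarrow> c \<odot>\<^bsub>W\<^esub> q x = q (c \<odot>\<^bsub>V\<^esub> x)"
  shows "vectorspace K W"
proof -
  interpret V: vectorspace K V by fact
  show ?thesis
  proof (rule vs_criteria)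
    show "field K" by unfold_locales
    show "\<forall>v\<in>carrier W. \<exists>w\<in>carrier W. v \<oplus>\<^bsub>W\<^esub> w = \<zero>\<^bsub>W\<^esub>"
    proof
      fix v assume "v \<in> carrier W"
      then obtain x where "x \<in> carrier V" "v = q x" using carr by auto
      then show "\<exists>w\<in>carrier W. v \<oplus>\<^bsub>W\<^esub> w = \<zero>\<^bsub>W\<^esub>"
        by (intro bexI[of _ "q (\<ominus>\<^bsub>V\<^esub> x)"]) (auto simp: carr zero add V.r_neg)
    qed
  qed (auto simp: carr zero add smult V.a_ac V.smult_assoc1 V.smult_l_distr V.smult_r_distr)
qed

section \<open>Coordinate spaces\<close>

text \<open>The index set is the same in every degree of a sum of bars: all degrees lie in the ambient
  space \<open>K\<^sup>I\<close>, and only the support \<open>J\<close> varies.\<close>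

definition coord :: "('k, 'm) ring_scheme \<Rightarrow> 'i set \<Rightarrow> 'i set \<Rightarrow> ('k, 'i \<Rightarrow> 'k) module" where
  "coord K I J = \<lparr>carrier = {z \<in> I \<rightarrow>\<^sub>E carrier K. \<forall>i\<in>I - J. z i = \<zero>\<^bsub>K\<^esub>},
     mult = (\<lambda>x y. \<lambda>i\<in>I. \<zero>\<^bsub>K\<^esub>), one = (\<lambda>i\<in>I. \<zero>\<^bsub>K\<^esub>), zero = (\<lambda>i\<in>I. \<zero>\<^bsub>K\<^esub>),
     add = (\<lambda>x y. \<lambda>i\<in>I. x i \<oplus>\<^bsub>K\<^esub> y i), smult = (\<lambda>c x. \<lambda>i\<in>I. c \<otimes>\<^bsub>K\<^esub> x i)\<rparr>"

lemma coord_simps: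
  "\<zero>\<^bsub>coord K I J\<^esub> = (\<lambda>i\<in>I. \<zero>\<^bsub>K\<^esub>)"
  "x \<oplus>\<^bsub>coord K I J\<^esub> y = (\<lambda>i\<in>I. x i \<oplus>\<^bsub>K\<^esub> y i)"
  "c \<odot>\<^bsub>coord K I J\<^esub> x = (\<lambda>i\<in>I. c \<otimes>\<^bsub>K\<^esub> x i)"
  by (auto simp: coord_def)

lemma coord_mem: "z \<in> carrier (coord K I J) \<longleftrightarrow> z \<in> extensional I \<and>
    (\<forall>i\<in>I. z i \<in> carrier K) \<and> (\<forall>i\<in>I. i \<notin> J \<longrightarrow> z i = \<zero>\<^bsub>K\<^esub>)"
  by (auto simp: coord_def PiE_def)

lemma coord_mono: "J \<subseteq> J' \<Longrightarrow> carrier (coord K I J) \<subseteq> carrier (coord K I J')"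
  by (auto simp: coord_mem subset_iff)

text \<open>An equality of records, not just an isomorphism: \<open>field_vs K\<close> and
  \<open>zero_vs K\<close> have the same operations and differ only in the carrier, so the summands
  only decide which coordinates must vanish.\<close>

lemma vs_sum_eq_coord:
  "vs_sum I (\<lambda>i. if P i then field_vs K else zero_vs K) = coord K I {i. P i}" if "field K"
proof -
  interpret field K by fact
  have "carrier (vs_sum I (\<lambda>i. if P i then field_vs K else zero_vs K)) = carrier (coord K I {i. P i})"
    by (auto simp: vs_sum_def coord_def field_vs_def zero_vs_def PiE_def Pi_iff split: if_splits)
      (metis zero_closed)
  moreover have "zero (if P i then field_vs K else zero_vs K) = \<zero>\<^bsub>K\<^esub>"
    "add (if P i then field_vs K else zero_vs K) = add K"
    "smult (if P i then field_vs K else zero_vs K) = mult K" for i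
    by (auto simp: field_vs_def zero_vs_def)
  ultimately show ?thesis by (auto simp: vs_sum_def coord_def)
qed

lemma vectorspace_coord: "vectorspace K (coord K I J)" if "field K"
proof -
  interpret field K by fact
  show ?thesis
  proof (rule vs_criteria)
    show "field K" by fact
    show "\<forall>v\<in>carrier (coord K I J). \<exists>w\<in>carrier (coord K I J). v \<oplus>\<^bsub>coord K I J\<^esub> w = \<zero>\<^bsub>coord K I J\<^esub>"
    proof
      fix v assume "v \<in> carrier (coord K I J)"
      then show "\<exists>w\<in>carrier (coord K I J). v \<oplus>\<^bsub>coord K I J\<^esub> w = \<zero>\<^bsub>coord K I J\<^esub>"
        by (intro bexI[of _ "\<lambda>i\<in>I. \<ominus>\<^bsub>K\<^esub> v i"])
          (auto simp: coord_mem coord_simps r_neg intro!: restrict_ext)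
    qed
  qed (auto simp: coord_mem coord_simps a_ac m_ac l_distr r_distr fun_eq_iff restrict_def extensional_def)
qed

text \<open>Elements of a coordinate space are extensional, so linearity can be checked one
  coordinate at a time.\<close>

lemma coord_hom:
  assumes "field K" and "\<And>z. z \<in> carrier (coord K I J) \<Longrightarrow> f z \<in> carrier (coord K I' J')"
    and "\<And>x y i. x \<in> carrier (coord K I J) \<Longrightarrow> y \<in> carrier (coord K I J) \<Longrightarrow> i \<in> I' \<Longrightarrow>
      f (x \<oplus>\<^bsub>coord K I J\<^esub> y) i = f x i \<oplus>\<^bsub>K\<^esub> f y i"
    and "\<And>c x i. c \<in> carrier K \<Longrightarrow> x \<in> carrier (coord K I J) \<Longrightarrow> i \<in> I' \<Longrightarrow>
      f (c \<odot>\<^bsub>coord K I J\<^esub> x) i = c \<otimes>\<^bsub>K\<^esub> f x i"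
  shows "f \<in> module_hom K (coord K I J) (coord K I' J')"
proof -
  interpret V: vectorspace K "coord K I J" by (rule vectorspace_coord[OF assms(1)])
  have *: "x = (\<lambda>i\<in>I'. g i)" if "x \<in> carrier (coord K I' J')" "\<And>i. i \<in> I' \<Longrightarrow> x i = g i" for x g
    using that by (auto simp: coord_mem extensional_def fun_eq_iff)
  show ?thesis unfolding module_hom_def
  proof (intro CollectI conjI allI impI)
    show "f (x \<oplus>\<^bsub>coord K I J\<^esub> y) = f x \<oplus>\<^bsub>coord K I' J'\<^esub> f y"
      if "x \<in> carrier (coord K I J) \<and> y \<in> carrier (coord K I J)" for x y
      unfolding coord_simps(2)[where I=I'] by (rule *) (use that assms(2,3) V.add.m_closed in auto)
    show "f (c \<odot>\<^bsub>coord K I J\<^esub> x) = c \<odot>\<^bsub>coord K I' J'\<^esub> f x"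
      if "c \<in> carrier K \<and> x \<in> carrier (coord K I J)" for c x
      unfolding coord_simps(3)[where I=I'] by (rule *) (use that assms(2,4) V.smult_closed in auto)
  qed (use assms(2) in auto)
qed

section \<open>Quotient spaces\<close>

abbreviation (input) "linsub \<equiv> LinearCombinations.submodule"

lemma submoduleI:
  assumes "module K V" "N \<subseteq> carrier V" "\<zero>\<^bsub>V\<^esub> \<in> N"
    "\<And>x y. x \<in> N \<Longrightarrow> y \<in> N \<Longrightarrow> x \<oplus>\<^bsub>V\<^esub> y \<in> N"
    "\<And>c x. c \<in> carrier K \<Longrightarrow> x \<in> N \<Longrightarrow> c \<odot>\<^bsub>V\<^esub> x \<in> N"
  shows "linsub K N V"
  using assms by (auto simp: LinearCombinations.submodule_def)

lemma submodule_abelian_subgroup: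
  assumes "vectorspace K V" "linsub K U V"
  shows "abelian_subgroup U V"
proof -
  interpret vectorspace K V by fact
  interpret U: LinearCombinations.submodule K U V by fact
  have "subgroup U (add_monoid V)"
  proof
    fix x assume x: "x \<in> U"
    then have "\<ominus>\<^bsub>V\<^esub> x = (\<ominus>\<^bsub>K\<^esub> \<one>\<^bsub>K\<^esub>) \<odot>\<^bsub>V\<^esub> x"
      using U.subset by (auto simp: smult_minus_1)
    also have "\<dots> \<in> U" using x by auto
    finally show "inv\<^bsub>add_monoid V\<^esub> x \<in> U" by (simp add: a_inv_def)
  qed (use U.subset in auto)
  then show ?thesis
    by (intro abelian_subgroupI3 additive_subgroup.intro) (assumption, unfold_locales)
qed

lemma vs_quot_simps:
  assumes "vectorspace K V" "linsub K U V"
  shows "carrier (vs_quot V U) = (\<lambda>x. U +>\<^bsub>V\<^esub> x) ` carrier V"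
    and "\<zero>\<^bsub>vs_quot V U\<^esub> = U"
    and "U +>\<^bsub>V\<^esub> \<zero>\<^bsub>V\<^esub> = U"
    and "x \<in> carrier V \<Longrightarrow> y \<in> carrier V \<Longrightarrow>
      (U +>\<^bsub>V\<^esub> x) \<oplus>\<^bsub>vs_quot V U\<^esub> (U +>\<^bsub>V\<^esub> y) = U +>\<^bsub>V\<^esub> (x \<oplus>\<^bsub>V\<^esub> y)"
    and "c \<in> carrier K \<Longrightarrow> x \<in> carrier V \<Longrightarrow>
      c \<odot>\<^bsub>vs_quot V U\<^esub> (U +>\<^bsub>V\<^esub> x) = U +>\<^bsub>V\<^esub> (c \<odot>\<^bsub>V\<^esub> x)"
    and "x \<in> carrier V \<Longrightarrow> y \<in> carrier V \<Longrightarrow>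
      U +>\<^bsub>V\<^esub> x = U +>\<^bsub>V\<^esub> y \<longleftrightarrow> x \<ominus>\<^bsub>V\<^esub> y \<in> U"
    and "x \<in> carrier V \<Longrightarrow> y \<in> U +>\<^bsub>V\<^esub> x \<longleftrightarrow> (\<exists>u\<in>U. y = u \<oplus>\<^bsub>V\<^esub> x)"
    and "x \<in> carrier V \<Longrightarrow> x \<in> U +>\<^bsub>V\<^esub> x"
proof -
  interpret vectorspace K V by fact
  interpret U: LinearCombinations.submodule K U V by fact
  interpret S: abelian_subgroup U V by (rule submodule_abelian_subgroup[OF assms])
  show "carrier (vs_quot V U) = (\<lambda>x. U +>\<^bsub>V\<^esub> x) ` carrier V"
    by (auto simp: vs_quot_def a_r_coset_def A_RCOSETS_def RCOSETS_def)
  show "\<zero>\<^bsub>vs_quot V U\<^esub> = U" by (simp add: vs_quot_def)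
  show z: "U +>\<^bsub>V\<^esub> \<zero>\<^bsub>V\<^esub> = U" by (rule S.a_rcos_const) simp
  show "(U +>\<^bsub>V\<^esub> x) \<oplus>\<^bsub>vs_quot V U\<^esub> (U +>\<^bsub>V\<^esub> y) = U +>\<^bsub>V\<^esub> (x \<oplus>\<^bsub>V\<^esub> y)"
    if "x \<in> carrier V" "y \<in> carrier V"
    using S.a_rcos_sum[OF that] by (simp add: vs_quot_def)
  show eq: "U +>\<^bsub>V\<^esub> x = U +>\<^bsub>V\<^esub> y \<longleftrightarrow> x \<ominus>\<^bsub>V\<^esub> y \<in> U"
    if "x \<in> carrier V" "y \<in> carrier V" for x y
    using S.a_rcos_module[OF that(2,1)] S.a_repr_independence'[OF _ that(2), of x]
      S.a_rcos_self[OF that(1)] by (auto simp: a_minus_def)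
  show self: "x \<in> U +>\<^bsub>V\<^esub> x" if "x \<in> carrier V" for x using S.a_rcos_self[OF that] .
  show mem: "y \<in> U +>\<^bsub>V\<^esub> x \<longleftrightarrow> (\<exists>u\<in>U. y = u \<oplus>\<^bsub>V\<^esub> x)" if "x \<in> carrier V" for x y
    by (auto simp: a_r_coset_def r_coset_def)
  show "c \<odot>\<^bsub>vs_quot V U\<^esub> (U +>\<^bsub>V\<^esub> x) = U +>\<^bsub>V\<^esub> (c \<odot>\<^bsub>V\<^esub> x)"
    if c: "c \<in> carrier K" and x: "x \<in> carrier V"
  proof -
    \<comment> \<open>Scalar multiplication in \<open>vs_quot\<close> is a union over all
      representatives; the members of that union are shown to be one and the same coset.\<close>
    have "U +>\<^bsub>V\<^esub> (c \<odot>\<^bsub>V\<^esub> y) = U +>\<^bsub>V\<^esub> (c \<odot>\<^bsub>V\<^esub> x)" if y: "y \<in> U +>\<^bsub>V\<^esub> x" for y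
    proof -
      obtain u where u: "u \<in> U" "y = u \<oplus>\<^bsub>V\<^esub> x" using y unfolding mem[OF x] by auto
      then have uV: "u \<in> carrier V" using U.subset by auto
      have "c \<odot>\<^bsub>V\<^esub> y \<ominus>\<^bsub>V\<^esub> c \<odot>\<^bsub>V\<^esub> x = c \<odot>\<^bsub>V\<^esub> u"
        using c x uV by (simp add: u smult_r_distr a_minus_def a_assoc r_neg)
      then show ?thesis using eq[of "c \<odot>\<^bsub>V\<^esub> y" "c \<odot>\<^bsub>V\<^esub> x"] u c x uV by auto
    qed
    then have "(\<Union>y\<in>U +>\<^bsub>V\<^esub> x. U +>\<^bsub>V\<^esub> (c \<odot>\<^bsub>V\<^esub> y)) = (\<Union>y\<in>U +>\<^bsub>V\<^esub> x. U +>\<^bsub>V\<^esub> (c \<odot>\<^bsub>V\<^esub> x))"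
      by (intro SUP_cong refl)
    then show ?thesis using self[OF x] by (simp add: vs_quot_def) blast
  qed
qed

lemma vectorspace_vs_quot:
  assumes "vectorspace K V" "linsub K U V"
  shows "vectorspace K (vs_quot V U)"
  by (rule vectorspace_image[OF assms(1), where q="\<lambda>x. U +>\<^bsub>V\<^esub> x"])
    (simp_all add: vs_quot_simps[OF assms])

text \<open>The universal property of the quotient. The map is defined through a chosen
  representative; another one differs from it by an element of \<open>U\<close>, which
  \<open>f\<close> kills.\<close>

lemma vs_quot_lift:
  assumes V: "vectorspace K V" and U: "linsub K U V" and W: "module K W"
    and f: "f \<in> module_hom K V W" and ker: "\<And>u. u \<in> U \<Longrightarrow> f u = \<zero>\<^bsub>W\<^esub>"
  obtains g where "g \<in> module_hom K (vs_quot V U) W"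
    and "\<And>x. x \<in> carrier V \<Longrightarrow> g (U +>\<^bsub>V\<^esub> x) = f x"
proof -
  interpret vectorspace K V by fact
  interpret W: module K W by fact
  note q = vs_quot_simps[OF V U]
  define g where "g A = f (SOME x. x \<in> carrier V \<and> A = U +>\<^bsub>V\<^esub> x)" for A
  have g: "g (U +>\<^bsub>V\<^esub> x) = f x" if x: "x \<in> carrier V" for x
  proof -
    define y where "y = (SOME y. y \<in> carrier V \<and> U +>\<^bsub>V\<^esub> x = U +>\<^bsub>V\<^esub> y)"
    have "y \<in> carrier V \<and> U +>\<^bsub>V\<^esub> x = U +>\<^bsub>V\<^esub> y"
      unfolding y_def by (rule someI[of _ x]) (use x in auto)
    then have y: "y \<in> carrier V" "x \<ominus>\<^bsub>V\<^esub> y \<in> U" using q(6)[OF x] by auto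
    have "f x \<ominus>\<^bsub>W\<^esub> f y = \<zero>\<^bsub>W\<^esub>"
      using ker[OF y(2)] module_hom_minus[OF vectorspace_module[OF V] W f x y(1)] by simp
    then show ?thesis
      using x y(1) f by (simp add: g_def y_def[symmetric] module_hom_mem)
  qed
  show ?thesis
  proof
    show "g \<in> module_hom K (vs_quot V U) W"
      using f by (auto simp: module_hom_def q g)
  qed (fact g)
qed

text \<open>The first isomorphism theorem: the induced map kills only the coset \<open>U\<close>
  itself, so it is injective.\<close>

lemma vs_quot_iso:
  assumes V: "vectorspace K V" and U: "linsub K U V" and W: "module K W"
    and f: "f \<in> module_hom K V W" and surj: "f ` carrier V = carrier W"
    and ker: "\<And>x. x \<in> carrier V \<Longrightarrow> f x = \<zero>\<^bsub>W\<^esub> \<longleftrightarrow> x \<in> U"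
  shows "\<exists>g\<in>module_hom K (vs_quot V U) W. bij_betw g (carrier (vs_quot V U)) (carrier W)"
proof -
  interpret vectorspace K V by fact
  interpret U: LinearCombinations.submodule K U V by fact
  note q = vs_quot_simps[OF V U]
  obtain g where g: "g \<in> module_hom K (vs_quot V U) W"
    and gf: "\<And>x. x \<in> carrier V \<Longrightarrow> g (U +>\<^bsub>V\<^esub> x) = f x"
    using vs_quot_lift[OF V U W f] ker U.subset by blast
  have "inj_on g (carrier (vs_quot V U))"
  proof (rule module_hom_injI[OF vectorspace_module[OF vectorspace_vs_quot[OF V U]] W g])
    fix X assume "X \<in> carrier (vs_quot V U)" "g X = \<zero>\<^bsub>W\<^esub>"
    then obtain x where x: "x \<in> carrier V" "X = U +>\<^bsub>V\<^esub> x" "f x = \<zero>\<^bsub>W\<^esub>"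
      by (auto simp: q(1) gf)
    then show "X = \<zero>\<^bsub>vs_quot V U\<^esub>"
      using abelian_subgroup.a_rcos_const[OF submodule_abelian_subgroup[OF V U], of x] ker q(2) by simp
  qed
  moreover have "g ` carrier (vs_quot V U) = carrier W"
    using surj gf by (auto simp: q image_image)
  ultimately show ?thesis using g by (auto simp: bij_betw_def)
qed

lemma submodule_vectorspace:
  assumes "vectorspace K V" "linsub K Z V"
  shows "vectorspace K (V\<lparr>carrier := Z\<rparr>)"
proof -
  interpret vectorspace K V by fact
  show ?thesis by (rule subspace_is_vs) (use assms in \<open>simp add: VectorSpace.subspace_def\<close>)
qed

lemma submodule_restrict:
  assumes "vectorspace K V" "linsub K Z V" "linsub K U V" "U \<subseteq> Z"
  shows "linsub K U (V\<lparr>carrier := Z\<rparr>)"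
  using assms(3,4) vectorspace_module[OF submodule_vectorspace[OF assms(1,2)]]
  by (auto simp: LinearCombinations.submodule_def)

text \<open>Apart from its carrier, no field of a quotient refers to the carrier of
  \<open>V\<close>. Cycles, which are given as a set of cosets, can thus be treated as the quotient
  of a subspace of \<open>V\<close>.\<close>

lemma vs_quot_restrict:
  "(vs_quot V R)\<lparr>carrier := (\<lambda>x. R +>\<^bsub>V\<^esub> x) ` Z\<rparr> = vs_quot (V\<lparr>carrier := Z\<rparr>) R"
proof -
  have "set_add (V\<lparr>carrier := Z\<rparr>) = set_add V"
    by (intro ext) (simp add: set_add_def set_mult_def)
  moreover have "(+>\<^bsub>V\<lparr>carrier := Z\<rparr>\<^esub>) = (+>\<^bsub>V\<^esub>)"
    by (intro ext) (simp add: a_r_coset_def r_coset_def)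
  moreover have "a_rcosets\<^bsub>V\<lparr>carrier := Z\<rparr>\<^esub> R = (\<lambda>x. R +>\<^bsub>V\<^esub> x) ` Z"
    by (auto simp: A_RCOSETS_def RCOSETS_def a_r_coset_def r_coset_def)
  ultimately show ?thesis by (simp add: vs_quot_def)
qed

text \<open>The shape of the homology of \<open>Gr\<close> of a complex in one degree:
  \<open>R\<close> is the radical, \<open>Z\<close> the elements whose boundary lies in the next
  radical, \<open>D\<close> the boundaries. The iterated quotient is \<open>Z / (R + D)\<close>, so
  a surjection from \<open>Z\<close> with kernel \<open>R + D\<close> identifies it, and later
  proofs can work with elements instead of cosets of cosets.\<close>

lemma vs_quot_quot_iso:
  assumes V: "vectorspace K V" and R: "linsub K R V" and Z: "linsub K Z V" and RZ: "R \<subseteq> Z"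
    and D: "linsub K D V" and DZ: "D \<subseteq> Z" and W: "module K W"
    and f: "f \<in> module_hom K (V\<lparr>carrier := Z\<rparr>) W" and surj: "f ` Z = carrier W"
    and ker: "\<And>x. x \<in> Z \<Longrightarrow> f x = \<zero>\<^bsub>W\<^esub> \<longleftrightarrow> (\<exists>r\<in>R. \<exists>d\<in>D. x = r \<oplus>\<^bsub>V\<^esub> d)"
  defines "H \<equiv> vs_quot ((vs_quot V R)\<lparr>carrier := (\<lambda>x. R +>\<^bsub>V\<^esub> x) ` Z\<rparr>) ((\<lambda>x. R +>\<^bsub>V\<^esub> x) ` D)"
  shows "vectorspace K H" "\<exists>g\<in>module_hom K H W. bij_betw g (carrier H) (carrier W)"
proof -
  interpret V: vectorspace K V by fact
  interpret R: LinearCombinations.submodule K R V by fact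
  interpret D: LinearCombinations.submodule K D V by fact
  interpret W: module K W by fact
  let ?Z = "V\<lparr>carrier := Z\<rparr>"
  let ?Q = "vs_quot ?Z R"
  have VZ: "vectorspace K ?Z" by (rule submodule_vectorspace[OF V Z])
  have RZ': "linsub K R ?Z" by (rule submodule_restrict[OF V Z R RZ])
  have co: "R +>\<^bsub>?Z\<^esub> x = R +>\<^bsub>V\<^esub> x" for x by (simp add: a_r_coset_def r_coset_def)
  note q = vs_quot_simps[OF V R] and q' = vs_quot_simps[OF VZ RZ', unfolded co, simplified]
  have VQ: "vectorspace K ?Q" by (rule vectorspace_vs_quot[OF VZ RZ'])
  have H: "H = vs_quot ?Q ((\<lambda>x. R +>\<^bsub>V\<^esub> x) ` D)" by (simp add: H_def vs_quot_restrict)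
  have DQ: "linsub K ((\<lambda>x. R +>\<^bsub>V\<^esub> x) ` D) ?Q"
  proof (rule submoduleI)
    show "module K ?Q" by (rule vectorspace_module[OF VQ])
    show "(\<lambda>x. R +>\<^bsub>V\<^esub> x) ` D \<subseteq> carrier ?Q" using DZ by (auto simp: q')
    show "\<zero>\<^bsub>?Q\<^esub> \<in> (\<lambda>x. R +>\<^bsub>V\<^esub> x) ` D" by (auto simp: q' intro!: image_eqI[of _ _ "\<zero>\<^bsub>V\<^esub>"])
  qed (use DZ in \<open>auto simp: q' subset_iff\<close>)
  show "vectorspace K H" unfolding H by (rule vectorspace_vs_quot[OF VQ DQ])
  have fR: "f r = \<zero>\<^bsub>W\<^esub>" if "r \<in> R" for r
  proof -
    have "r = r \<oplus>\<^bsub>V\<^esub> \<zero>\<^bsub>V\<^esub>" using that R.subset by auto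
    then have "\<exists>r'\<in>R. \<exists>d\<in>D. r = r' \<oplus>\<^bsub>V\<^esub> d" using that D.zero_closed by metis
    then show ?thesis using ker[of r] that RZ by (simp add: subset_iff)
  qed
  obtain g where g: "g \<in> module_hom K ?Q W"
    and gf: "\<And>x. x \<in> Z \<Longrightarrow> g (R +>\<^bsub>V\<^esub> x) = f x"
    by (rule vs_quot_lift[OF VZ RZ' W f fR, unfolded co]) auto
  have "\<exists>g\<in>module_hom K (vs_quot ?Q ((\<lambda>x. R +>\<^bsub>V\<^esub> x) ` D)) W.
      bij_betw g (carrier (vs_quot ?Q ((\<lambda>x. R +>\<^bsub>V\<^esub> x) ` D))) (carrier W)"
  proof (rule vs_quot_iso[OF VQ DQ W g])
    show "g ` carrier ?Q = carrier W" using surj gf by (auto simp: q' image_image)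
    fix X assume "X \<in> carrier ?Q"
    then obtain x where x: "x \<in> Z" "X = R +>\<^bsub>V\<^esub> x" unfolding q'(1) by blast
    have ZV: "Z \<subseteq> carrier V" using Z by (simp add: LinearCombinations.submodule_def)
    have "(\<exists>r\<in>R. \<exists>d\<in>D. x = r \<oplus>\<^bsub>V\<^esub> d) \<longleftrightarrow> (\<exists>d\<in>D. x \<in> R +>\<^bsub>V\<^esub> d)"
    proof -
      have "(\<exists>r\<in>R. x = r \<oplus>\<^bsub>V\<^esub> d) \<longleftrightarrow> x \<in> R +>\<^bsub>V\<^esub> d" if "d \<in> D" for d
        using q(7)[of d x] that D.subset by (simp add: subset_iff)
      then show ?thesis by blast
    qed
    also have "\<dots> \<longleftrightarrow> (\<exists>d\<in>D. R +>\<^bsub>V\<^esub> x = R +>\<^bsub>V\<^esub> d)"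
    proof -
      interpret S: abelian_subgroup R V by (rule submodule_abelian_subgroup[OF V R])
      have "x \<in> R +>\<^bsub>V\<^esub> d \<longleftrightarrow> R +>\<^bsub>V\<^esub> x = R +>\<^bsub>V\<^esub> d" if "d \<in> D" for d
        using S.a_repr_independence'[of x d] S.a_rcos_self[of x] that D.subset ZV x(1)
        by (metis subsetD)
      then show ?thesis by auto
    qed
    finally show "g X = \<zero>\<^bsub>W\<^esub> \<longleftrightarrow> X \<in> (\<lambda>x. R +>\<^bsub>V\<^esub> x) ` D" using x ker gf by auto
  qed
  then show "\<exists>g\<in>module_hom K H W. bij_betw g (carrier H) (carrier W)" by (simp add: H)
qed

section \<open>Persistence modules\<close>

lemma persistence_moduleD:
  assumes "persistence_module K M"
  shows "vectorspace K (pm_space M s)"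
    and "s \<le> t \<Longrightarrow> pm_map M s t \<in> module_hom K (pm_space M s) (pm_space M t)"
    and "x \<in> carrier (pm_space M s) \<Longrightarrow> pm_map M s s x = x"
    and "r \<le> s \<Longrightarrow> s \<le> t \<Longrightarrow> x \<in> carrier (pm_space M r) \<Longrightarrow>
      pm_map M s t (pm_map M r s x) = pm_map M r t x"
  using assms by (auto simp: persistence_module_def)

lemma pm_map_mem:
  assumes "persistence_module K M" "s \<le> t" "x \<in> carrier (pm_space M s)"
  shows "pm_map M s t x \<in> carrier (pm_space M t)"
  using module_hom_mem[OF persistence_moduleD(2)[OF assms(1,2)]] assms(3) by blast

lemma pm_homD:
  assumes "f \<in> pm_hom K M N"
  shows "f s \<in> module_hom K (pm_space M s) (pm_space N s)"
    and "x \<in> carrier (pm_space M s) \<Longrightarrow> f s x \<in> carrier (pm_space N s)"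
    and "s \<le> t \<Longrightarrow> x \<in> carrier (pm_space M s) \<Longrightarrow> f t (pm_map M s t x) = pm_map N s t (f s x)"
  using assms by (auto simp: pm_hom_def module_hom_def)

lemma pm_hom_comp:
  assumes "f \<in> pm_hom K M N" "g \<in> pm_hom K L M"
  shows "(\<lambda>s x. f s (g s x)) \<in> pm_hom K L N"
  using assms pm_homD(2)[OF assms(2)] unfolding pm_hom_def by (auto intro: module_hom_comp)

section \<open>Isomorphisms of persistence modules and their effect on resolutions\<close>

lemma pm_iso_sym:
  assumes "persistence_module K M" "persistence_module K N" "pm_iso K M N"
  shows "pm_iso K N M"
proof -
  obtain f where f: "f \<in> pm_hom K M N"
    and bij: "\<And>s. bij_betw (f s) (carrier (pm_space M s)) (carrier (pm_space N s))"
    using assms(3) by (auto simp: pm_iso_def)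
  define g where "g s = inv_into (carrier (pm_space M s)) (f s)" for s
  have eq: "g s y = x" if "x \<in> carrier (pm_space M s)" "f s x = y" for s x y
    using bij[of s] that by (auto simp: g_def bij_betw_def inv_into_f_f)
  have mem: "g s y \<in> carrier (pm_space M s)" "f s (g s y) = y" if "y \<in> carrier (pm_space N s)" for s y
    using bij[of s] that by (auto simp: g_def bij_betw_def inv_into_into f_inv_into_f)
  have "g \<in> pm_hom K N M"
    unfolding pm_hom_def
  proof (intro CollectI conjI allI impI ballI)
    show "g s \<in> module_hom K (pm_space N s) (pm_space M s)" for s
      unfolding g_def
      by (intro module_hom_inv pm_homD[OF f] bij vectorspace_module persistence_moduleD[OF assms(1)])
    fix s t :: real and y assume "s \<le> t" "y \<in> carrier (pm_space N s)"
    then show "g t (pm_map N s t y) = pm_map M s t (g s y)"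
      by (intro eq) (auto simp: mem pm_homD(3)[OF f] pm_map_mem[OF assms(1)])
  qed
  moreover have "bij_betw (g s) (carrier (pm_space N s)) (carrier (pm_space M s))" for s
    unfolding g_def by (rule bij_betw_inv_into[OF bij])
  ultimately show ?thesis by (auto simp: pm_iso_def)
qed

text \<open>Both modules are quotients of \<open>F\<close> by the same kernel, so
  \<open>p s x\<close> can be sent to \<open>q s x\<close>. This is how a presented module is
  matched with a sum of bars.\<close>

lemma pm_iso_of_epis:
  assumes F: "persistence_module K F" and M: "persistence_module K M" and N: "persistence_module K N"
    and p: "p \<in> pm_epi K F M" and q: "q \<in> pm_epi K F N"
    and ker: "\<And>s x. x \<in> carrier (pm_space F s) \<Longrightarrow>
      p s x = \<zero>\<^bsub>pm_space M s\<^esub> \<longleftrightarrow> q s x = \<zero>\<^bsub>pm_space N s\<^esub>"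
  shows "pm_iso K M N"
proof -
  have ph: "p \<in> pm_hom K F M" and qh: "q \<in> pm_hom K F N"
    and ps: "\<And>s. p s ` carrier (pm_space F s) = carrier (pm_space M s)"
    and qs: "\<And>s. q s ` carrier (pm_space F s) = carrier (pm_space N s)"
    using p q by (auto simp: pm_epi_def)
  note Fm = vectorspace_module[OF persistence_moduleD(1)[OF F]]
    and Mm = vectorspace_module[OF persistence_moduleD(1)[OF M]]
    and Nm = vectorspace_module[OF persistence_moduleD(1)[OF N]]
  define g where "g s m = q s (SOME x. x \<in> carrier (pm_space F s) \<and> p s x = m)" for s m
  have g: "g s (p s x) = q s x" if x: "x \<in> carrier (pm_space F s)" for s x
  proof -
    interpret F: module K "pm_space F s" by (rule Fm)
    interpret M: module K "pm_space M s" by (rule Mm)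
    interpret N: module K "pm_space N s" by (rule Nm)
    define y where "y = (SOME y. y \<in> carrier (pm_space F s) \<and> p s y = p s x)"
    have "y \<in> carrier (pm_space F s) \<and> p s y = p s x"
      unfolding y_def by (rule someI[of _ x]) (use x in auto)
    then have y: "y \<in> carrier (pm_space F s)" "p s y = p s x" by auto
    then have "p s (y \<ominus>\<^bsub>pm_space F s\<^esub> x) = \<zero>\<^bsub>pm_space M s\<^esub>"
      using x by (simp add: module_hom_minus[OF Fm Mm pm_homD(1)[OF ph]] pm_homD(2)[OF ph])
    then have "q s (y \<ominus>\<^bsub>pm_space F s\<^esub> x) = \<zero>\<^bsub>pm_space N s\<^esub>" using ker x y by simp
    then show ?thesis
      using x y by (simp add: module_hom_minus[OF Fm Nm pm_homD(1)[OF qh]] pm_homD(2)[OF qh]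
          g_def y_def[symmetric])
  qed
  have pE: "\<exists>x\<in>carrier (pm_space F s). m = p s x" if "m \<in> carrier (pm_space M s)" for s m
    using that ps by blast
  have "g \<in> pm_hom K M N"
    unfolding pm_hom_def
  proof (intro CollectI conjI allI impI ballI)
    show "g s \<in> module_hom K (pm_space M s) (pm_space N s)" for s
    proof -
      interpret F: module K "pm_space F s" by (rule Fm)
      show ?thesis unfolding module_hom_def
      proof (intro CollectI conjI allI impI)
        show "g s \<in> carrier (pm_space M s) \<rightarrow> carrier (pm_space N s)"
        proof
          fix m assume "m \<in> carrier (pm_space M s)"
          then obtain x where "x \<in> carrier (pm_space F s)" "m = p s x" using pE by metis
          then show "g s m \<in> carrier (pm_space N s)" by (simp add: g pm_homD(2)[OF qh])
        qed
        show "g s (m \<oplus>\<^bsub>pm_space M s\<^esub> m') = g s m \<oplus>\<^bsub>pm_space N s\<^esub> g s m'"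
          if mm: "m \<in> carrier (pm_space M s) \<and> m' \<in> carrier (pm_space M s)" for m m'
        proof -
          obtain x x' where x: "x \<in> carrier (pm_space F s)" "m = p s x"
            "x' \<in> carrier (pm_space F s)" "m' = p s x'" using pE mm by metis
          then show ?thesis
            using g[of "x \<oplus>\<^bsub>pm_space F s\<^esub> x'" s]
            by (simp add: g module_hom_add[OF pm_homD(1)[OF ph]] module_hom_add[OF pm_homD(1)[OF qh]])
        qed
        show "g s (c \<odot>\<^bsub>pm_space M s\<^esub> m) = c \<odot>\<^bsub>pm_space N s\<^esub> g s m"
          if cm: "c \<in> carrier K \<and> m \<in> carrier (pm_space M s)" for c m
        proof -
          obtain x where x: "x \<in> carrier (pm_space F s)" "m = p s x" using pE cm by metis
          then show ?thesis
            using cm g[of "c \<odot>\<^bsub>pm_space F s\<^esub> x" s]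
            by (simp add: g module_hom_smult[OF pm_homD(1)[OF ph]] module_hom_smult[OF pm_homD(1)[OF qh]])
        qed
      qed
    qed
    fix s t :: real and m assume st: "s \<le> t" and "m \<in> carrier (pm_space M s)"
    then obtain x where x: "x \<in> carrier (pm_space F s)" "m = p s x" using pE by metis
    then show "g t (pm_map M s t m) = pm_map N s t (g s m)"
      using g[of "pm_map F s t x" t]
      by (simp add: g pm_homD(3)[OF ph st] pm_homD(3)[OF qh st] pm_map_mem[OF F st])
  qed
  moreover have "bij_betw (g s) (carrier (pm_space M s)) (carrier (pm_space N s))" for s
    unfolding bij_betw_def
  proof
    show "inj_on (g s) (carrier (pm_space M s))"
    proof (rule module_hom_injI[OF Mm Nm pm_homD(1)[OF \<open>g \<in> pm_hom K M N\<close>]])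
      fix m assume "m \<in> carrier (pm_space M s)" and 0: "g s m = \<zero>\<^bsub>pm_space N s\<^esub>"
      then obtain x where "x \<in> carrier (pm_space F s)" "m = p s x" using pE by metis
      then show "m = \<zero>\<^bsub>pm_space M s\<^esub>" using 0 g ker by simp
    qed
    show "g s ` carrier (pm_space M s) = carrier (pm_space N s)"
      unfolding ps[symmetric] qs[symmetric] image_image using g by auto
  qed
  ultimately show ?thesis by (auto simp: pm_iso_def)
qed

text \<open>Only the augmentation changes; \<open>P\<close> and \<open>d\<close> stay literally the
  same. This is used in both directions: to carry a resolution of the bars to \<open>M\<close>, and
  to view the chosen resolution of \<open>M\<close> as one of the bars.\<close>

lemma projective_resolution_iso:
  assumes M: "persistence_module K M" and N: "persistence_module K N"
    and res: "projective_resolution K M P d e"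
    and f: "f \<in> pm_hom K M N"
    and bij: "\<And>s. bij_betw (f s) (carrier (pm_space M s)) (carrier (pm_space N s))"
  shows "projective_resolution K N P d (\<lambda>s x. f s (e s x))"
proof -
  note Mm = vectorspace_module[OF persistence_moduleD(1)[OF M]]
    and Nm = vectorspace_module[OF persistence_moduleD(1)[OF N]]
  have e: "e \<in> pm_hom K (P 0) M" "\<And>s. e s ` carrier (pm_space (P 0) s) = carrier (pm_space M s)"
    using res by (auto simp: projective_resolution_def pm_epi_def)
  have "(\<lambda>s x. f s (e s x)) \<in> pm_epi K (P 0) N"
    using pm_hom_comp[OF f e(1)] bij e(2)
    by (auto simp: pm_epi_def bij_betw_def image_image[symmetric] simp del: image_image)
  moreover have "f s (e s x) = \<zero>\<^bsub>pm_space N s\<^esub> \<longleftrightarrow> e s x = \<zero>\<^bsub>pm_space M s\<^esub>"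
    if "x \<in> carrier (pm_space (P 0) s)" for s x
  proof -
    interpret M: module K "pm_space M s" by (rule Mm)
    have "f s \<zero>\<^bsub>pm_space M s\<^esub> = \<zero>\<^bsub>pm_space N s\<^esub>"
      by (rule module_hom_zero[OF Mm Nm pm_homD(1)[OF f]])
    then show ?thesis
      using bij[of s] pm_homD(2)[OF e(1) that] by (metis M.zero_closed bij_betw_def inj_onD)
  qed
  ultimately show ?thesis
    using res by (auto simp: projective_resolution_def pm_exact_at_def cong: conj_cong)
qed

section \<open>The radical and the associated graded\<close>

text \<open>The images grow with \<open>r\<close>, so two elements of the union already come from a
  common degree, the maximum of theirs, and can be added there.\<close>

lemma submodule_rad_union:
  assumes M: "persistence_module K M"
  shows "linsub K (\<Union>r\<in>{..<s}. pm_map M r s ` carrier (pm_space M r)) (pm_space M s)"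
    (is "linsub K ?U _")
proof -
  interpret Ms: vectorspace K "pm_space M s" by (rule persistence_moduleD(1)[OF M])
  show ?thesis
  proof (rule submoduleI)
    show "module K (pm_space M s)" by (rule vectorspace_module[OF persistence_moduleD(1)[OF M]])
    show "?U \<subseteq> carrier (pm_space M s)" using pm_map_mem[OF M] by auto
    \<comment> \<open>Any degree below \<open>s\<close> would do: the zero vector has to come from
      somewhere.\<close>
    have "s - 1 < s" by simp
    interpret V: vectorspace K "pm_space M (s - 1)" by (rule persistence_moduleD(1)[OF M])
    have "pm_map M (s - 1) s \<zero>\<^bsub>pm_space M (s - 1)\<^esub> = \<zero>\<^bsub>pm_space M s\<^esub>"
      by (rule module_hom_zero[OF V.module_axioms Ms.module_axioms persistence_moduleD(2)[OF M]]) simp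
    then show "\<zero>\<^bsub>pm_space M s\<^esub> \<in> ?U"
      by (intro UN_I[of "s - 1"] image_eqI[of _ _ "\<zero>\<^bsub>pm_space M (s - 1)\<^esub>"]) auto
  next
    fix x y assume "x \<in> ?U" "y \<in> ?U"
    then obtain r x' t y' where x: "r < s" "x' \<in> carrier (pm_space M r)" "x = pm_map M r s x'"
      and y: "t < s" "y' \<in> carrier (pm_space M t)" "y = pm_map M t s y'" by auto
    define u where "u = max r t"
    interpret V: vectorspace K "pm_space M u" by (rule persistence_moduleD(1)[OF M])
    have u: "u < s" "r \<le> u" "t \<le> u" using x y by (auto simp: u_def)
    let ?z = "pm_map M r u x' \<oplus>\<^bsub>pm_space M u\<^esub> pm_map M t u y'"
    have "x \<oplus>\<^bsub>pm_space M s\<^esub> y = pm_map M u s ?z"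
      using x y u by (simp add: module_hom_add[OF persistence_moduleD(2)[OF M]] pm_map_mem[OF M]
          persistence_moduleD(4)[OF M])
    moreover have "?z \<in> carrier (pm_space M u)" using x y u by (simp add: pm_map_mem[OF M])
    ultimately show "x \<oplus>\<^bsub>pm_space M s\<^esub> y \<in> ?U" using u(1) by blast
  next
    fix c x assume c: "c \<in> carrier K" and "x \<in> ?U"
    then obtain r x' where x: "r < s" "x' \<in> carrier (pm_space M r)" "x = pm_map M r s x'" by auto
    interpret V: vectorspace K "pm_space M r" by (rule persistence_moduleD(1)[OF M])
    have "c \<odot>\<^bsub>pm_space M s\<^esub> x = pm_map M r s (c \<odot>\<^bsub>pm_space M r\<^esub> x')"
      using x c by (simp add: module_hom_smult[OF persistence_moduleD(2)[OF M]])
    then show "c \<odot>\<^bsub>pm_space M s\<^esub> x \<in> ?U" 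
      using x c by (intro UN_I[of r] image_eqI[of _ _ "c \<odot>\<^bsub>pm_space M r\<^esub> x'"]) auto
  qed
qed

lemma pm_rad_eq:
  assumes M: "persistence_module K M"
  shows "pm_rad K M s = (\<Union>r\<in>{..<s}. pm_map M r s ` carrier (pm_space M r))" (is "_ = ?U")
proof -
  interpret V: vectorspace K "pm_space M s" by (rule persistence_moduleD(1)[OF M])
  have "?U \<subseteq> carrier (pm_space M s)"
    using submodule_rad_union[OF M] by (simp add: LinearCombinations.submodule_def)
  then show ?thesis
    unfolding pm_rad_def
    by (intro equalityI V.in_own_span V.span_is_subset[OF order.refl submodule_rad_union[OF M]])
qed

lemma submodule_pm_rad:
  "persistence_module K M \<Longrightarrow> linsub K (pm_rad K M s) (pm_space M s)"
  by (simp add: pm_rad_eq submodule_rad_union)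

lemma pm_rad_iff:
  assumes "persistence_module K M"
  shows "x \<in> pm_rad K M s \<longleftrightarrow> (\<exists>r<s. \<exists>y\<in>carrier (pm_space M r). x = pm_map M r s y)"
  unfolding pm_rad_eq[OF assms] by auto

text \<open>A preimage may be pushed forward inside the degrees below \<open>s\<close>, so it can be
  taken beyond every endpoint that lies before \<open>s\<close>.\<close>

lemma pm_rad_later:
  assumes M: "persistence_module K M" and x: "x \<in> pm_rad K M s" and "r < s"
  obtains t y where "r \<le> t" "t < s" "y \<in> carrier (pm_space M t)" "x = pm_map M t s y"
proof -
  obtain u y where u: "u < s" "y \<in> carrier (pm_space M u)" "x = pm_map M u s y"
    using x pm_rad_iff[OF M] by auto
  show ?thesis
    by (rule that[of "max r u" "pm_map M u (max r u) y"])
      (use u assms(3) in \<open>auto simp: pm_map_mem[OF M] persistence_moduleD(4)[OF M]\<close>)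
qed

lemma pm_hom_rad:
  assumes M: "persistence_module K M" and N: "persistence_module K N" and f: "f \<in> pm_hom K M N"
    and x: "x \<in> pm_rad K M s"
  shows "f s x \<in> pm_rad K N s"
proof -
  obtain r y where "r < s" "y \<in> carrier (pm_space M r)" "x = pm_map M r s y"
    using x pm_rad_iff[OF M] by auto
  then show ?thesis
    using pm_homD(3)[OF f, of r s y] pm_homD(2)[OF f, of y r]
    by (auto simp: pm_rad_iff[OF N])
qed

text \<open>The union in \<open>Gr_map\<close> runs over all representatives; since \<open>f\<close>
  maps the radical into the radical, they all yield the same coset.\<close>

lemma Gr_map_coset:
  assumes M: "persistence_module K M" and N: "persistence_module K N" and f: "f \<in> pm_hom K M N"
    and x: "x \<in> carrier (pm_space M s)"
  shows "Gr_map K N f s (pm_rad K M s +>\<^bsub>pm_space M s\<^esub> x) = pm_rad K N s +>\<^bsub>pm_space N s\<^esub> f s x"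
proof -
  let ?R = "pm_rad K M s" and ?S = "pm_rad K N s"
  interpret V: vectorspace K "pm_space M s" by (rule persistence_moduleD(1)[OF M])
  interpret W: vectorspace K "pm_space N s" by (rule persistence_moduleD(1)[OF N])
  interpret R: LinearCombinations.submodule K ?R "pm_space M s" by (rule submodule_pm_rad[OF M])
  interpret S: abelian_subgroup ?S "pm_space N s"
    by (rule submodule_abelian_subgroup[OF W.vectorspace_axioms submodule_pm_rad[OF N]])
  note q = vs_quot_simps[OF V.vectorspace_axioms submodule_pm_rad[OF M]]
    and q' = vs_quot_simps[OF W.vectorspace_axioms submodule_pm_rad[OF N]]
  have "?S +>\<^bsub>pm_space N s\<^esub> f s y = ?S +>\<^bsub>pm_space N s\<^esub> f s x"
    if y: "y \<in> ?R +>\<^bsub>pm_space M s\<^esub> x" for y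
  proof -
    obtain u where u: "u \<in> ?R" "y = u \<oplus>\<^bsub>pm_space M s\<^esub> x" using y q(7)[OF x] by auto
    have "f s y = f s u \<oplus>\<^bsub>pm_space N s\<^esub> f s x"
      using u x R.subset by (auto simp: module_hom_add[OF pm_homD(1)[OF f]])
    then have "f s y \<in> ?S +>\<^bsub>pm_space N s\<^esub> f s x"
      using q'(7)[OF pm_homD(2)[OF f x]] pm_hom_rad[OF M N f u(1)] by auto
    then show ?thesis using S.a_repr_independence'[OF _ pm_homD(2)[OF f x]] by simp
  qed
  then have "(\<Union>y\<in>?R +>\<^bsub>pm_space M s\<^esub> x. ?S +>\<^bsub>pm_space N s\<^esub> f s y) =
      (\<Union>y\<in>?R +>\<^bsub>pm_space M s\<^esub> x. ?S +>\<^bsub>pm_space N s\<^esub> f s x)"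
    by (intro SUP_cong refl)
  then show ?thesis using q(8)[OF x] by (simp add: Gr_map_def) blast
qed

section \<open>Projective modules have injective structure maps\<close>

text \<open>Lift \<open>P \<rightarrow> Y\<close> along \<open>X \<rightarrow> Y\<close>, where \<open>X\<close> is constant with value \<open>P(s)\<close> and \<open>Y\<close> is its
  truncation to degrees up to \<open>s\<close>: an element of \<open>P(s)\<close> that dies later would also die in \<open>X\<close>.\<close>

lemma projective_map_inj:
  fixes P :: "('k, 'p) pmod"
  assumes K: "field K" and proj: "pm_projective K P" and st: "s \<le> t"
  shows "inj_on (pm_map P s t) (carrier (pm_space P s))"
proof -
  interpret field K by fact
  have P: "persistence_module K P" using proj by (simp add: pm_projective_def)
  note Pm = vectorspace_module[OF persistence_moduleD(1)[OF P]]
  interpret V: vectorspace K "pm_space P s" by (rule persistence_moduleD(1)[OF P])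
  \<comment> \<open>Lifting is only available over the type
    \<open>real \<times> 'p \<Rightarrow> 'k\<close>, so \<open>P(s)\<close> is first copied into it
    by indicator functions, which are distinct because one differs from zero in a field.\<close>
  define \<iota> :: "'p \<Rightarrow> real \<times> 'p \<Rightarrow> 'k" where
    "\<iota> v = (\<lambda>q. if q = (0, v) then \<one>\<^bsub>K\<^esub> else \<zero>\<^bsub>K\<^esub>)" for v
  have "inj \<iota>"
    by (rule injI) (metis \<iota>_def one_not_zero prod.inject)
  define j where "j = inv_into UNIV \<iota>"
  have j: "j (\<iota> v) = v" for v using \<open>inj \<iota>\<close> by (simp add: j_def)
  define W :: "('k, real \<times> 'p \<Rightarrow> 'k) module" where
    "W = \<lparr>carrier = \<iota> ` carrier (pm_space P s), mult = (\<lambda>x y. x), one = \<iota> \<zero>\<^bsub>pm_space P s\<^esub>,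
      zero = \<iota> \<zero>\<^bsub>pm_space P s\<^esub>, add = (\<lambda>x y. \<iota> (j x \<oplus>\<^bsub>pm_space P s\<^esub> j y)),
      smult = (\<lambda>c x. \<iota> (c \<odot>\<^bsub>pm_space P s\<^esub> j x))\<rparr>"
  have W: "vectorspace K W"
    by (rule vectorspace_image[OF V.vectorspace_axioms, of _ \<iota>]) (auto simp: W_def j)
  interpret W: vectorspace K W by (rule W)
  define Z where "Z = W\<lparr>carrier := {\<zero>\<^bsub>W\<^esub>}\<rparr>"
  have Z: "vectorspace K Z"
    unfolding Z_def
    by (rule submodule_vectorspace[OF W], rule submoduleI) (auto intro: W.module_axioms)
  define X where "X = \<lparr>pm_space = (\<lambda>r. W), pm_map = (\<lambda>r t x. x)\<rparr>"
  define Y where "Y = \<lparr>pm_space = (\<lambda>r. if r \<le> s then W else Z),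
    pm_map = (\<lambda>r t x. if t \<le> s then x else \<zero>\<^bsub>W\<^esub>)\<rparr>"
  have X: "persistence_module K X"
    unfolding persistence_module_def X_def using W by (auto simp: module_hom_def)
  have Y: "persistence_module K Y"
    unfolding persistence_module_def Y_def using W Z by (auto simp: module_hom_def Z_def)
  define g where "g r x = (if r \<le> s then x else \<zero>\<^bsub>W\<^esub>)" for r :: real and x
  have g: "g \<in> pm_epi K X Y"
    unfolding pm_epi_def pm_hom_def g_def X_def Y_def by (auto simp: module_hom_def Z_def)
  \<comment> \<open>Push everything up to degree \<open>s\<close>, and kill it afterwards; this is a
    morphism because \<open>Y\<close> vanishes beyond \<open>s\<close>.\<close>
  define f where "f r x = (if r \<le> s then \<iota> (pm_map P r s x) else \<zero>\<^bsub>W\<^esub>)" for r x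
  have "f r \<in> module_hom K (pm_space P r) (pm_space Y r)" for r
  proof (cases "r \<le> s")
    case True
    have "\<iota> \<in> module_hom K (pm_space P s) W"
      by (auto simp: module_hom_def W_def j)
    from module_hom_comp[OF this persistence_moduleD(2)[OF P True]] show ?thesis
      using True by (simp add: f_def[abs_def] Y_def)
  qed (auto simp: f_def[abs_def] Y_def module_hom_def Z_def)
  moreover have "f v (pm_map P r v x) = pm_map Y r v (f r x)"
    if "r \<le> v" "x \<in> carrier (pm_space P r)" for r v x
    using that by (auto simp: f_def Y_def persistence_moduleD(4)[OF P])
  ultimately have f: "f \<in> pm_hom K P Y" by (auto simp: pm_hom_def)
  obtain h where h: "h \<in> pm_hom K P X"
    and gh: "\<And>r x. x \<in> carrier (pm_space P r) \<Longrightarrow> g r (h r x) = f r x"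
    using proj X Y g f unfolding pm_projective_def by blast
  show ?thesis
  proof (rule module_hom_injI[OF Pm Pm persistence_moduleD(2)[OF P st]])
    fix x assume x: "x \<in> carrier (pm_space P s)" and 0: "pm_map P s t x = \<zero>\<^bsub>pm_space P t\<^esub>"
    \<comment> \<open>The lift does not change \<open>x\<close> in degree \<open>s\<close>, and the
      structure maps of \<open>X\<close> are identities, so \<open>h\<close> sees the same vector in
      degrees \<open>s\<close> and \<open>t\<close>.\<close>
    have "\<iota> x = h s x"
      using gh[OF x] x by (simp add: g_def f_def persistence_moduleD(3)[OF P])
    also have "\<dots> = h t (pm_map P s t x)"
      using pm_homD(3)[OF h st x] by (simp add: X_def)
    also have "\<dots> = \<zero>\<^bsub>W\<^esub>"
      using module_hom_zero[OF Pm _ pm_homD(1)[OF h, of t]] by (simp add: 0 X_def W.module_axioms)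
    also have "\<dots> = \<iota> \<zero>\<^bsub>pm_space P s\<^esub>" by (simp add: W_def)
    finally show "x = \<zero>\<^bsub>pm_space P s\<^esub>" using \<open>inj \<iota>\<close> by (simp add: inj_eq)
  qed
qed

section \<open>Direct sums of interval modules\<close>

text \<open>With all right ends equal to \<open>\<infinity>\<close> these are the free modules, so
  the same lemmas serve for both.\<close>

definition bars ::
  "('k, 'm) ring_scheme \<Rightarrow> 'i set \<Rightarrow> ('i \<Rightarrow> real) \<Rightarrow> ('i \<Rightarrow> ereal) \<Rightarrow> ('k, 'i \<Rightarrow> 'k) pmod" where
  "bars K I a b = pm_sum I (\<lambda>i. interval_pm K (a i) (b i))"

lemma bars_space:
  "field K \<Longrightarrow> pm_space (bars K I a b) s = coord K I {i. a i \<le> s \<and> ereal s < b i}"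
  by (simp add: bars_def pm_sum_def interval_pm_def vs_sum_eq_coord)

lemma bars_map:
  "pm_map (bars K I a b) s t x = (\<lambda>i\<in>I. if a i \<le> s \<and> ereal t < b i then x i else \<zero>\<^bsub>K\<^esub>)"
  by (simp add: bars_def pm_sum_def interval_pm_def)

lemma ereal_le_less: "s \<le> t \<Longrightarrow> ereal t < b \<Longrightarrow> ereal s < b"
  by (meson ereal_less_eq(3) le_less_trans)

lemma persistence_module_bars:
  assumes K: "field K"
  shows "persistence_module K (bars K I a b)"
proof -
  interpret field K by fact
  show ?thesis
    unfolding persistence_module_def bars_space[OF K] bars_map
  proof (intro conjI allI impI ballI)
    fix s t :: real assume "s \<le> t"
    then show "(\<lambda>x. \<lambda>i\<in>I. if a i \<le> s \<and> ereal t < b i then x i else \<zero>\<^bsub>K\<^esub>)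
      \<in> module_hom K (coord K I {i. a i \<le> s \<and> ereal s < b i})
          (coord K I {i. a i \<le> t \<and> ereal t < b i})"
      by (intro coord_hom[OF K]) (auto simp: coord_mem coord_simps)
  next
    fix s :: real and x assume "x \<in> carrier (coord K I {i. a i \<le> s \<and> ereal s < b i})"
    then show "(\<lambda>i\<in>I. if a i \<le> s \<and> ereal s < b i then x i else \<zero>\<^bsub>K\<^esub>) = x"
      by (auto simp: coord_mem extensional_def fun_eq_iff)
  next
    fix r s t :: real and x assume "r \<le> s" "s \<le> t"
    then show "(\<lambda>i\<in>I. if a i \<le> s \<and> ereal t < b i
        then (\<lambda>i\<in>I. if a i \<le> r \<and> ereal s < b i then x i else \<zero>\<^bsub>K\<^esub>) i else \<zero>\<^bsub>K\<^esub>)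
      = (\<lambda>i\<in>I. if a i \<le> r \<and> ereal t < b i then x i else \<zero>\<^bsub>K\<^esub>)"
      by (auto simp: fun_eq_iff intro: ereal_le_less)
  qed (rule vectorspace_coord[OF K])
qed

text \<open>Gives a degree \<open>r < s\<close> with no point of \<open>T\<close> strictly between
  \<open>r\<close> and \<open>s\<close>. The extra point \<open>s - 1\<close> keeps the maximum
  defined when nothing in \<open>T\<close> lies below \<open>s\<close>.\<close>

lemma exists_below:
  fixes s :: real
  assumes "finite T"
  shows "\<exists>r<s. \<forall>t\<in>T. t < s \<longrightarrow> t \<le> r"
proof -
  let ?T = "insert (s - 1) {t \<in> T. t < s}"
  have "finite ?T" using assms by simp
  then have "Max ?T < s" "\<forall>t\<in>T. t < s \<longrightarrow> t \<le> Max ?T" by auto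
  then show ?thesis by blast
qed

section \<open>Homology of the associated graded of a projective resolution\<close>

lemma Gr_image:
  assumes M: "persistence_module K M" and N: "persistence_module K N" and f: "f \<in> pm_hom K M N"
  shows "Gr_map K N f s ` carrier (Gr K M s) =
    (\<lambda>x. pm_rad K N s +>\<^bsub>pm_space N s\<^esub> x) ` f s ` carrier (pm_space M s)"
  unfolding Gr_def vs_quot_simps(1)[OF persistence_moduleD(1)[OF M] submodule_pm_rad[OF M]] image_image
  using Gr_map_coset[OF M N f] by (intro image_cong refl)

lemma submodule_image:
  assumes V: "module K V" and W: "module K W" and f: "f \<in> module_hom K V W"
  shows "linsub K (f ` carrier V) W"
proof -
  interpret mod_hom K V W f using assms by (simp add: mod_hom_def mod_hom_axioms_def)
  show ?thesis using im_is_submodule by (simp add: im_def)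
qed

lemma coord_eqI:
  assumes "x \<in> carrier (coord K I J)" "y \<in> carrier (coord K I J')" "\<And>i. i \<in> I \<Longrightarrow> x i = y i"
  shows "x = y"
  by (rule extensionalityI[of _ I]) (use assms in \<open>auto simp: coord_mem\<close>)

text \<open>The resolution and the type of its elements are arbitrary, as only a choice is known
  later. An empty bar would be counted by its endpoints without being visible in \<open>S\<close>,
  hence the assumption \<open>nonempty\<close>.\<close>

locale bars_resolution = field K for K :: "('k, 'm) ring_scheme" (structure) +
  fixes I :: "'i set" and a b and P :: "nat \<Rightarrow> ('k, 'p) pmod" and d e S
  defines "S \<equiv> bars K I a b"
  assumes fin: "finite I" and nonempty: "\<And>i. i \<in> I \<Longrightarrow> ereal (a i) < b i"
    and res: "projective_resolution K S P d e"
begin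

lemma K: "field K" ..

lemma S: "persistence_module K S" unfolding S_def by (rule persistence_module_bars[OF K])

lemma P: "persistence_module K (P n)"
  using res by (simp add: projective_resolution_def pm_projective_def)

lemma P_inj: "s \<le> t \<Longrightarrow> inj_on (pm_map (P n) s t) (carrier (pm_space (P n) s))"
  using res by (intro projective_map_inj[OF K]) (auto simp: projective_resolution_def)

lemma d: "d n \<in> pm_hom K (P (Suc n)) (P n)"
  using res by (simp add: projective_resolution_def)

lemma e: "e \<in> pm_hom K (P 0) S"
  using res by (simp add: projective_resolution_def pm_epi_def)

lemma e_surj: "y \<in> carrier (pm_space S s) \<Longrightarrow> \<exists>x\<in>carrier (pm_space (P 0) s). e s x = y"
proof -
  assume "y \<in> carrier (pm_space S s)"
  also have "carrier (pm_space S s) = e s ` carrier (pm_space (P 0) s)"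
    using res by (simp add: projective_resolution_def pm_epi_def)
  finally show ?thesis by auto
qed

lemma exact0: "x \<in> carrier (pm_space (P 0) s) \<Longrightarrow>
    e s x = \<zero>\<^bsub>pm_space S s\<^esub> \<longleftrightarrow> x \<in> d 0 s ` carrier (pm_space (P (Suc 0)) s)"
  using res unfolding projective_resolution_def pm_exact_at_def by auto

lemma exact1: "x \<in> carrier (pm_space (P (Suc 0)) s) \<Longrightarrow>
    d 0 s x = \<zero>\<^bsub>pm_space (P 0) s\<^esub> \<longleftrightarrow> x \<in> d (Suc 0) s ` carrier (pm_space (P (Suc (Suc 0))) s)"
  using res unfolding projective_resolution_def pm_exact_at_def by auto

lemmas space_S = bars_space[OF K, of I a b, folded S_def]
lemmas map_S = bars_map[of K I a b, folded S_def]

lemma PV: "vectorspace K (pm_space (P n) s)" by (rule persistence_moduleD(1)[OF P])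
lemma PM: "module K (pm_space (P n) s)" by (rule vectorspace_module[OF PV])
lemma SM: "module K (pm_space S s)" by (rule vectorspace_module[OF persistence_moduleD(1)[OF S]])

text \<open>The map \<open>f\<close> reads off the components of \<open>e x\<close> in the bars that
  begin at \<open>s\<close>. If they vanish, \<open>e x\<close> comes from an earlier degree;
  lifting that preimage through \<open>e\<close> yields the radical part of \<open>x\<close>, and
  the rest lies in the kernel of \<open>e\<close>, that is, among the boundaries.\<close>

lemma homology0:
  defines "H \<equiv> graded_homology (\<lambda>n. Gr K (P n)) (\<lambda>n. Gr_map K (P n) (d n)) 0"
  shows "vectorspace K (H s)"
    and "\<exists>g\<in>module_hom K (H s) (coord K I {i. a i = s}).
      bij_betw g (carrier (H s)) (carrier (coord K I {i. a i = s}))"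
proof -
  let ?V = "pm_space (P 0) s" and ?R = "pm_rad K (P 0) s"
  let ?D = "d 0 s ` carrier (pm_space (P (Suc 0)) s)"
  let ?W = "coord K I {i. a i = s}"
  interpret V: vectorspace K ?V by (rule PV)
  interpret R: LinearCombinations.submodule K ?R ?V by (rule submodule_pm_rad[OF P])
  interpret W: vectorspace K ?W by (rule vectorspace_coord[OF K])
  have H: "H s = vs_quot ((vs_quot ?V ?R)\<lparr>carrier := (\<lambda>x. ?R +>\<^bsub>?V\<^esub> x) ` carrier ?V\<rparr>)
      ((\<lambda>x. ?R +>\<^bsub>?V\<^esub> x) ` ?D)"
    unfolding H_def graded_homology_def graded_cycles_def nat.case Gr_image[OF P P d]
    by (simp add: Gr_def vs_quot_simps(1)[OF PV submodule_pm_rad[OF P]])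
  have D: "linsub K ?D ?V" by (rule submodule_image[OF PM PM pm_homD(1)[OF d]])
  define f where "f x = (\<lambda>i\<in>I. if a i = s then e s x i else \<zero>)" for x
  have eS: "e s x \<in> carrier (coord K I {i. a i \<le> s \<and> ereal s < b i})" if "x \<in> carrier ?V" for x
    using pm_homD(2)[OF e that] by (simp add: space_S)
  have e_add: "e s (x \<oplus>\<^bsub>?V\<^esub> y) = (\<lambda>i\<in>I. e s x i \<oplus> e s y i)" if "x \<in> carrier ?V" "y \<in> carrier ?V" for x y
    using module_hom_add[OF pm_homD(1)[OF e] that] by (simp add: space_S coord_simps)
  have e_smult: "e s (c \<odot>\<^bsub>?V\<^esub> x) = (\<lambda>i\<in>I. c \<otimes> e s x i)" if "c \<in> carrier K" "x \<in> carrier ?V" for c x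
    using module_hom_smult[OF pm_homD(1)[OF e] that] by (simp add: space_S coord_simps)
  have f: "f \<in> module_hom K (?V\<lparr>carrier := carrier ?V\<rparr>) ?W"
    unfolding module_hom_def using eS
    by (auto simp: f_def coord_mem coord_simps e_add e_smult intro!: restrict_ext)
  have surj: "f ` carrier ?V = carrier ?W"
  proof (intro equalityI subsetI)
    fix w assume w: "w \<in> carrier ?W"
    \<comment> \<open>A bar that begins at \<open>s\<close> contains \<open>s\<close>, being
      non-empty.\<close>
    then have "w \<in> carrier (pm_space S s)"
      using nonempty by (force simp: space_S coord_mem)
    then obtain x where "x \<in> carrier ?V" "e s x = w" using e_surj by metis
    then show "w \<in> f ` carrier ?V"
      using w by (intro image_eqI[of _ _ x]) (auto simp: f_def coord_mem extensional_def fun_eq_iff)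
  qed (use module_hom_mem[OF f] in auto)
  obtain r where r: "r < s" and ra: "\<And>i. i \<in> I \<Longrightarrow> a i < s \<Longrightarrow> a i \<le> r"
    using exists_below[OF finite_imageI[OF fin, of a], of s] by auto
  have ker: "f x = \<zero>\<^bsub>?W\<^esub> \<longleftrightarrow> (\<exists>r\<in>?R. \<exists>y\<in>?D. x = r \<oplus>\<^bsub>?V\<^esub> y)" if x: "x \<in> carrier ?V" for x
  proof
    assume f0: "f x = \<zero>\<^bsub>?W\<^esub>"
    have 0: "e s x i = \<zero>" if "i \<in> I" "a i = s" for i
      using fun_cong[OF f0, of i] that by (simp add: f_def coord_simps)
    \<comment> \<open>The same vector, placed in degree \<open>r\<close>. Nothing is lost: a bar
      alive at \<open>s\<close> that does not begin at \<open>s\<close> begins by \<open>r\<close>,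
      hence is alive at \<open>r\<close>, and the components in bars beginning at \<open>s\<close>
      vanish.\<close>
    define y where "y = (\<lambda>i\<in>I. if a i \<le> r \<and> ereal r < b i then e s x i else \<zero>)"
    have "y \<in> carrier (pm_space S r)"
      using eS[OF x] by (auto simp: y_def space_S coord_mem)
    then obtain u where u: "u \<in> carrier (pm_space (P 0) r)" "e r u = y" using e_surj by metis
    let ?u = "pm_map (P 0) r s u"
    have uV: "?u \<in> carrier ?V" using pm_map_mem[OF P _ u(1)] r by simp
    have "e s ?u = pm_map S r s y" using pm_homD(3)[OF e _ u(1), of s] r u(2) by simp
    also have "\<dots> = e s x"
    proof (rule ext)
      fix i
      show "pm_map S r s y i = e s x i"
      proof (cases "i \<in> I")
        case True
        then have "e s x i = \<zero>" if "\<not> (a i \<le> r \<and> ereal s < b i)"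
          using that eS[OF x] ra[OF True] 0[OF True] by (force simp: coord_mem)
        then show ?thesis
          using True r ereal_le_less[of r s "b i"] by (auto simp: map_S y_def)
      qed (use eS[OF x] in \<open>auto simp: map_S coord_mem extensional_def\<close>)
    qed
    finally have "e s (x \<ominus>\<^bsub>?V\<^esub> ?u) = \<zero>\<^bsub>pm_space S s\<^esub>"
    proof -
      interpret S: module K "pm_space S s" by (rule SM)
      assume "e s ?u = e s x"
      then show ?thesis
        using x uV pm_homD(2)[OF e x] by (simp add: module_hom_minus[OF PM SM pm_homD(1)[OF e]])
    qed
    then have "x \<ominus>\<^bsub>?V\<^esub> ?u \<in> ?D" using exact0[of "x \<ominus>\<^bsub>?V\<^esub> ?u" s] x uV by simp
    moreover have "?u \<in> ?R" using u(1) r pm_rad_iff[OF P] by blast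
    moreover have "x = ?u \<oplus>\<^bsub>?V\<^esub> (x \<ominus>\<^bsub>?V\<^esub> ?u)"
      using x uV by (simp add: a_minus_def V.a_ac V.r_neg V.r_neg1)
    ultimately show "\<exists>r\<in>?R. \<exists>y\<in>?D. x = r \<oplus>\<^bsub>?V\<^esub> y" by blast
  next
    assume "\<exists>r\<in>?R. \<exists>y\<in>?D. x = r \<oplus>\<^bsub>?V\<^esub> y"
    then obtain u y where u: "u \<in> ?R" and y: "y \<in> ?D" and xuy: "x = u \<oplus>\<^bsub>?V\<^esub> y" by blast
    have uV: "u \<in> carrier ?V" using u R.subset by auto
    have yV: "y \<in> carrier ?V" using y pm_homD(2)[OF d] by auto
    have "e s y = \<zero>\<^bsub>pm_space S s\<^esub>" using exact0[OF yV] y by simp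
    then have y0: "e s y i = \<zero>" if "i \<in> I" for i using that by (simp add: space_S coord_simps)
    obtain t v where tv: "t < s" "e s u = pm_map S t s v"
      using pm_hom_rad[OF P S e u] pm_rad_iff[OF S] by auto
    \<comment> \<open>What arrives from a degree \<open>t < s\<close> has no component in a bar that
      begins only at \<open>s\<close>.\<close>
    then have u0: "e s u i = \<zero>" if "i \<in> I" "a i = s" for i using that by (simp add: map_S)
    show "f x = \<zero>\<^bsub>?W\<^esub>"
      using e_add[OF uV yV] by (auto simp: f_def xuy coord_simps u0 y0 fun_eq_iff restrict_def)
  qed
  have cV: "linsub K (carrier ?V) ?V" by (rule submoduleI) (auto intro: PM)
  note quot = vs_quot_quot_iso[OF PV submodule_pm_rad[OF P] cV R.subset D _ W.module_axioms f surj ker]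
  have DV: "?D \<subseteq> carrier ?V" using pm_homD(2)[OF d] by auto
  show "vectorspace K (H s)" unfolding H by (rule quot(1)[OF DV])
  show "\<exists>g\<in>module_hom K (H s) ?W. bij_betw g (carrier (H s)) (carrier ?W)"
    unfolding H by (rule quot(2)[OF DV])
qed

text \<open>A connecting map: the boundary of a cycle \<open>x\<close> is traced back to an earlier
  degree and read in \<open>S\<close>, where it lives in bars that die at \<open>s\<close>. The
  bijection \<open>h\<close> renumbers the bars with finite end, so that the target can take the
  index set \<open>{..<l}\<close> required by the graded magnitude.\<close>

lemma homology1:
  fixes h :: "'j \<Rightarrow> 'i"
  assumes h: "bij_betw h L {i \<in> I. b i \<noteq> \<infinity>}"
  defines "H \<equiv> graded_homology (\<lambda>n. Gr K (P n)) (\<lambda>n. Gr_map K (P n) (d n)) 1"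
  defines "\<beta> \<equiv> \<lambda>j. real_of_ereal (b (h j))"
  shows "vectorspace K (H s)"
    and "\<exists>g\<in>module_hom K (H s) (coord K L {j. \<beta> j = s}).
      bij_betw g (carrier (H s)) (carrier (coord K L {j. \<beta> j = s}))"
proof -
  let ?V = "pm_space (P (Suc 0)) s" and ?R = "pm_rad K (P (Suc 0)) s"
  let ?U = "pm_space (P 0) s" and ?RU = "pm_rad K (P 0) s"
  let ?D = "d (Suc 0) s ` carrier (pm_space (P (Suc (Suc 0))) s)"
  let ?W = "coord K L {j. \<beta> j = s}"
  let ?Z = "{x \<in> carrier ?V. d 0 s x \<in> ?RU}"
  interpret V: vectorspace K ?V by (rule PV)
  interpret U: vectorspace K ?U by (rule PV)
  interpret W: vectorspace K ?W by (rule vectorspace_coord[OF K])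
  interpret R: LinearCombinations.submodule K ?R ?V by (rule submodule_pm_rad[OF P])
  interpret R0: LinearCombinations.submodule K ?RU ?U by (rule submodule_pm_rad[OF P])
  have hI: "h j \<in> I" and hb: "b (h j) = ereal (\<beta> j)" and a\<beta>: "a (h j) < \<beta> j" if "j \<in> L" for j
  proof -
    have *: "h j \<in> I" "b (h j) \<noteq> \<infinity>" using h that by (auto simp: bij_betw_def)
    then have "ereal (a (h j)) < b (h j)" using nonempty by blast
    with * show "h j \<in> I" "b (h j) = ereal (\<beta> j)" "a (h j) < \<beta> j"
      by (cases "b (h j)"; simp add: \<beta>_def)+
  qed
  note d0 = d[of 0]
  have cyc: "{X \<in> carrier (Gr K (P (Suc 0)) s). Gr_map K (P 0) (d 0) s X = \<zero>\<^bsub>Gr K (P 0) s\<^esub>}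
      = (\<lambda>x. ?R +>\<^bsub>?V\<^esub> x) ` ?Z"
  proof -
    interpret S: abelian_subgroup ?RU ?U by (rule submodule_abelian_subgroup[OF PV submodule_pm_rad[OF P]])
    have "?RU +>\<^bsub>?U\<^esub> y = ?RU \<longleftrightarrow> y \<in> ?RU" if "y \<in> carrier ?U" for y
      using S.a_rcos_const[of y] S.a_rcos_self[OF that] by auto
    then have "Gr_map K (P 0) (d 0) s (?R +>\<^bsub>?V\<^esub> x) = \<zero>\<^bsub>Gr K (P 0) s\<^esub> \<longleftrightarrow> d 0 s x \<in> ?RU"
      if "x \<in> carrier ?V" for x
      unfolding Gr_map_coset[OF P P d0 that] using pm_homD(2)[OF d0 that]
      by (simp add: Gr_def vs_quot_simps(2)[OF PV submodule_pm_rad[OF P]])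
    moreover have "carrier (Gr K (P (Suc 0)) s) = (\<lambda>x. ?R +>\<^bsub>?V\<^esub> x) ` carrier ?V"
      unfolding Gr_def by (rule vs_quot_simps(1)[OF PV submodule_pm_rad[OF P]])
    ultimately show ?thesis by auto
  qed
  have H: "H s = vs_quot ((vs_quot ?V ?R)\<lparr>carrier := (\<lambda>x. ?R +>\<^bsub>?V\<^esub> x) ` ?Z\<rparr>)
      ((\<lambda>x. ?R +>\<^bsub>?V\<^esub> x) ` ?D)"
    unfolding H_def graded_homology_def graded_cycles_def One_nat_def nat.case Gr_image[OF P P d]
    using cyc by (simp add: Gr_def)
  have D: "linsub K ?D ?V" by (rule submodule_image[OF PM PM pm_homD(1)[OF d]])
  have D_iff: "x \<in> ?D \<longleftrightarrow> d 0 s x = \<zero>\<^bsub>?U\<^esub>" if "x \<in> carrier ?V" for x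
    using exact1[OF that] by simp
  have DV: "?D \<subseteq> carrier ?V" using pm_homD(2)[OF d[of "Suc 0"]] by auto
  have DZ: "?D \<subseteq> ?Z" 
  proof
    fix x assume "x \<in> ?D"
    then show "x \<in> ?Z" using D_iff[of x] DV by (auto simp del: image_iff)
  qed
  have RZ: "?R \<subseteq> ?Z" using R.subset pm_hom_rad[OF P P d0] by auto
  have Z: "linsub K ?Z ?V"
    by (rule submoduleI[OF PM])
      (auto simp: module_hom_add[OF pm_homD(1)[OF d0]] module_hom_smult[OF pm_homD(1)[OF d0]]
        module_hom_zero[OF PM PM pm_homD(1)[OF d0]])

  \<comment> \<open>No bar begins or ends strictly between \<open>s0\<close> and
    \<open>s\<close>.\<close>
  obtain s0 where s0: "s0 < s" and s0a: "\<And>i. i \<in> I \<Longrightarrow> a i < s \<Longrightarrow> a i \<le> s0"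
    and s0b: "\<And>i. i \<in> I \<Longrightarrow> b i \<noteq> \<infinity> \<Longrightarrow> real_of_ereal (b i) < s \<Longrightarrow> real_of_ereal (b i) \<le> s0"
    using exists_below[of "a ` I \<union> (\<lambda>i. real_of_ereal (b i)) ` I" s] fin by auto
  text \<open>For \<open>x \<in> Z\<close> choose \<open>t < s\<close> and \<open>y \<in> P\<^sub>0(t)\<close> that represents \<open>d x\<close>; then \<open>e y \<in> S(t)\<close>
    dies in \<open>S(s)\<close>, and \<open>G t y\<close> collects its components in the bars that end at \<open>s\<close>.\<close>
  define G where "G t y = (\<lambda>j\<in>L. if \<beta> j = s then e t y (h j) else \<zero>)" for t y
  define rep where "rep x t y \<longleftrightarrow> s0 \<le> t \<and> t < s \<and> y \<in> carrier (pm_space (P 0) t) \<and>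
      pm_map (P 0) t s y = d 0 s x" for x t y
  \<comment> \<open>A bar that ends at \<open>s\<close> is non-empty, so it begins before
    \<open>s\<close>, hence by \<open>s0\<close>. It is therefore alive throughout the degrees from
    \<open>t\<close> to \<open>u\<close>, and its component is transported unchanged.\<close>
  have G_shift: "G u (pm_map (P 0) t u y) = G t y"
    if "s0 \<le> t" "t \<le> u" "u < s" "y \<in> carrier (pm_space (P 0) t)" for t u y
  proof -
    have "pm_map S t u (e t y) (h j) = e t y (h j)" if j: "j \<in> L" "\<beta> j = s" for j
      using hI[OF j(1)] hb[OF j(1)] a\<beta>[OF j(1)] s0a[OF hI[OF j(1)]] j \<open>s0 \<le> t\<close> \<open>u < s\<close>
      by (auto simp: map_S)
    then show ?thesis
      using pm_homD(3)[OF e that(2,4)] by (auto simp: G_def intro!: restrict_ext)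
  qed
  have rep_shift: "rep x u (pm_map (P 0) t u y)" if "rep x t y" "t \<le> u" "u < s" for x t u y
    using that by (auto simp: rep_def pm_map_mem[OF P] persistence_moduleD(4)[OF P])
  \<comment> \<open>This is where injectivity enters: moved to a common degree \<open>v\<close>, two
    representatives have the same image in degree \<open>s\<close>, so they coincide in
    \<open>v\<close>.\<close>
  have rep_unique: "G t y = G u z" if t: "rep x t y" and u: "rep x u z" for x t y u z
  proof -
    define v where "v = max t u"
    have v: "t \<le> v" "u \<le> v" "v < s" using t u by (auto simp: v_def rep_def)
    have "rep x v (pm_map (P 0) t v y)" "rep x v (pm_map (P 0) u v z)"
      using rep_shift t u v by auto
    then have "pm_map (P 0) t v y = pm_map (P 0) u v z"
      using inj_onD[OF P_inj[of v s 0]] v(3) by (auto simp: rep_def)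
    then show ?thesis
      using G_shift[of t v y] G_shift[of u v z] t u v by (auto simp: rep_def)
  qed
  have rep_ex: "\<exists>t y. rep x t y" if "x \<in> ?Z" for x
    using pm_rad_later[OF P _ s0, of "d 0 s x" 0] that unfolding rep_def by (metis (no_types, lifting) mem_Collect_eq)
  define f where "f x = (THE w. \<exists>t y. rep x t y \<and> w = G t y)" for x
  have f: "f x = G t y" if "rep x t y" for x t y
    unfolding f_def by (rule the_equality) (use that rep_unique in blast)+
  have eS: "e t y \<in> carrier (coord K I {i. a i \<le> t \<and> ereal t < b i})"
    if "y \<in> carrier (pm_space (P 0) t)" for t y
    using pm_homD(2)[OF e that] by (simp add: space_S)
  have GW: "G t y \<in> carrier ?W" if "y \<in> carrier (pm_space (P 0) t)" for t y
    using eS[OF that] hI by (auto simp: G_def coord_mem)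
  have f_hom: "f \<in> module_hom K (?V\<lparr>carrier := ?Z\<rparr>) ?W"
    unfolding module_hom_def
  proof (intro CollectI conjI allI impI)
    show "f \<in> carrier (?V\<lparr>carrier := ?Z\<rparr>) \<rightarrow> carrier ?W"
    proof
      fix x assume "x \<in> carrier (?V\<lparr>carrier := ?Z\<rparr>)"
      then have "x \<in> ?Z" by simp
      then obtain t y where "rep x t y" using rep_ex by blast
      then show "f x \<in> carrier ?W" using f GW by (simp add: rep_def)
    qed
    fix x x' assume "x \<in> carrier (?V\<lparr>carrier := ?Z\<rparr>) \<and> x' \<in> carrier (?V\<lparr>carrier := ?Z\<rparr>)"
    then have x: "x \<in> ?Z" "x' \<in> ?Z" by auto
    then obtain t y t' y' where r: "rep x t y" "rep x' t' y'" using rep_ex by metis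
    define v where "v = max t t'"
    have v: "t \<le> v" "t' \<le> v" "v < s" using r by (auto simp: v_def rep_def)
    define z where "z = pm_map (P 0) t v y"
    define z' where "z' = pm_map (P 0) t' v y'"
    have z: "rep x v z" "rep x' v z'" using rep_shift r v by (auto simp: z_def z'_def)
    interpret Q: vectorspace K "pm_space (P 0) v" by (rule PV)
    have zc: "z \<in> carrier (pm_space (P 0) v)" "z' \<in> carrier (pm_space (P 0) v)"
      using z by (auto simp: rep_def)
    have "rep (x \<oplus>\<^bsub>?V\<^esub> x') v (z \<oplus>\<^bsub>pm_space (P 0) v\<^esub> z')"
      using z x by (auto simp: rep_def module_hom_add[OF pm_homD(1)[OF d0]]
          module_hom_add[OF persistence_moduleD(2)[OF P]])
    then have "f (x \<oplus>\<^bsub>?V\<^esub> x') = G v (z \<oplus>\<^bsub>pm_space (P 0) v\<^esub> z')" by (rule f)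
    also have "\<dots> = G v z \<oplus>\<^bsub>?W\<^esub> G v z'"
      using hI by (auto simp: G_def coord_simps module_hom_add[OF pm_homD(1)[OF e] zc] space_S
          intro!: restrict_ext)
    finally show "f (x \<oplus>\<^bsub>?V\<lparr>carrier := ?Z\<rparr>\<^esub> x') = f x \<oplus>\<^bsub>?W\<^esub> f x'"
      using f z by simp
  next
    fix c x assume "c \<in> carrier K \<and> x \<in> carrier (?V\<lparr>carrier := ?Z\<rparr>)"
    then have x: "c \<in> carrier K" "x \<in> ?Z" by auto
    then obtain t y where r: "rep x t y" using rep_ex by metis
    interpret Q: vectorspace K "pm_space (P 0) t" by (rule PV)
    have yc: "y \<in> carrier (pm_space (P 0) t)" using r by (auto simp: rep_def)
    have "rep (c \<odot>\<^bsub>?V\<^esub> x) t (c \<odot>\<^bsub>pm_space (P 0) t\<^esub> y)"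
      using r x by (auto simp: rep_def module_hom_smult[OF pm_homD(1)[OF d0]]
          module_hom_smult[OF persistence_moduleD(2)[OF P]])
    then have "f (c \<odot>\<^bsub>?V\<^esub> x) = G t (c \<odot>\<^bsub>pm_space (P 0) t\<^esub> y)" by (rule f)
    also have "\<dots> = c \<odot>\<^bsub>?W\<^esub> G t y"
      using hI x by (auto simp: G_def coord_simps module_hom_smult[OF pm_homD(1)[OF e] _ yc] space_S
          intro!: restrict_ext)
    finally show "f (c \<odot>\<^bsub>?V\<lparr>carrier := ?Z\<rparr>\<^esub> x) = c \<odot>\<^bsub>?W\<^esub> f x"
      using f r by simp
  qed
  have surj: "f ` ?Z = carrier ?W"
  proof (intro equalityI subsetI)
    fix w assume w: "w \<in> carrier ?W"
    \<comment> \<open>The prescribed components are put in the bars that end at \<open>s\<close>, in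
      degree \<open>s0\<close> where these bars are alive. They vanish in \<open>S(s)\<close>, so a
      lift to \<open>P 0\<close> becomes a boundary in degree \<open>s\<close>.\<close>
    define y where "y = (\<lambda>i\<in>I. if b i = ereal s then w (inv_into L h i) else \<zero>)"
    have inv: "inv_into L h i \<in> L" "h (inv_into L h i) = i" if "i \<in> I" "b i = ereal s" for i
      using h that by (auto simp: bij_betw_def inv_into_into f_inv_into_f)
    have inv': "inv_into L h (h j) = j" if "j \<in> L" for j
      using h that by (auto simp: bij_betw_def inv_into_f_f)
    have "a i \<le> s0" if "i \<in> I" "b i = ereal s" for i
      using s0a[OF that(1)] nonempty[OF that(1)] that(2) by auto
    then have "y \<in> carrier (pm_space S s0)"
      using w inv s0 by (auto simp: y_def space_S coord_mem)
    then obtain u where u: "u \<in> carrier (pm_space (P 0) s0)" "e s0 u = y" using e_surj by metis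
    let ?u = "pm_map (P 0) s0 s u"
    have uU: "?u \<in> carrier ?U" using s0 u by (intro pm_map_mem[OF P]) auto
    have "e s ?u = pm_map S s0 s y" using pm_homD(3)[OF e _ u(1), of s] s0 u(2) by simp
    also have "\<dots> = \<zero>\<^bsub>pm_space S s\<^esub>"
      by (auto simp: map_S y_def space_S coord_simps intro!: restrict_ext)
    finally have "?u \<in> d 0 s ` carrier ?V" using exact0[OF uU] by simp
    then obtain x where x: "x \<in> carrier ?V" "d 0 s x = ?u" by auto
    have rep: "rep x s0 u" using x u s0 by (auto simp: rep_def)
    have "x \<in> ?Z" using x u(1) s0 pm_rad_iff[OF P] by auto
    moreover have "f x = w"
      unfolding f[OF rep]
    proof (rule coord_eqI[OF GW[OF u(1)] w])
      fix j assume j: "j \<in> L"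
      then show "G s0 u j = w j"
        using hI hb inv' w by (auto simp: G_def u(2) y_def coord_mem)
    qed
    ultimately show "w \<in> f ` ?Z" by auto
  qed (use module_hom_mem[OF f_hom] in auto)
  have ker: "f x = \<zero>\<^bsub>?W\<^esub> \<longleftrightarrow> (\<exists>r\<in>?R. \<exists>y\<in>?D. x = r \<oplus>\<^bsub>?V\<^esub> y)" if x: "x \<in> ?Z" for x
  proof
    assume f0: "f x = \<zero>\<^bsub>?W\<^esub>"
    obtain t y where r: "rep x t y" using rep_ex[OF x] by blast
    then have t: "s0 \<le> t" "t < s" and y: "y \<in> carrier (pm_space (P 0) t)"
      "pm_map (P 0) t s y = d 0 s x" by (auto simp: rep_def)
    have dx: "d 0 s x \<in> carrier ?U" using x pm_homD(2)[OF d0] by auto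
    have xV: "x \<in> carrier ?V" using x by simp
    have "e s (d 0 s x) = \<zero>\<^bsub>pm_space S s\<^esub>" using exact0[OF dx] xV by simp
    then have es0: "pm_map S t s (e t y) = \<zero>\<^bsub>pm_space S s\<^esub>"
      using pm_homD(3)[OF e _ y(1), of s] t y(2) by simp
    \<comment> \<open>A bar alive at \<open>t\<close> either survives to \<open>s\<close>, where its
      component is zero by \<open>es0\<close>, or ends after \<open>t\<close> and by
      \<open>s\<close>. In the second case it ends exactly at \<open>s\<close> by the choice of
      \<open>s0\<close>, and its component is one of those recorded by \<open>f x\<close>.\<close>
    have "e t y = \<zero>\<^bsub>pm_space S t\<^esub>"
      unfolding space_S
    proof (rule coord_eqI[OF eS[OF y(1)]])
      show "\<zero>\<^bsub>coord K I {i. a i \<le> t \<and> ereal t < b i}\<^esub> \<in> carrier (coord K I {i. a i \<le> t \<and> ereal t < b i})"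
        by (auto simp: coord_mem coord_simps)
      fix i assume i: "i \<in> I"
      have "e t y i = \<zero>"
      proof (cases "a i \<le> t \<and> ereal t < b i")
        case True
        show ?thesis
        proof (cases "ereal s < b i")
          case True
          then show ?thesis
            using fun_cong[OF es0, of i] i \<open>a i \<le> t \<and> ereal t < b i\<close>
            by (simp add: map_S space_S coord_simps)
        next
          case False
          then obtain c where c: "b i = ereal c" "c \<le> s" "t < c"
            using True by (cases "b i") auto
          then have "c = s" using s0b[OF i] t(1) by force
          obtain j where j: "j \<in> L" "h j = i" using h c(1) i by (force simp: bij_betw_def)
          then have "\<beta> j = s" using c \<open>c = s\<close> by (simp add: \<beta>_def)
          then show ?thesis
            using fun_cong[OF f0, of j] j by (simp add: f[OF r] G_def coord_simps)
        qed
      qed (use eS[OF y(1)] i in \<open>auto simp: coord_mem\<close>)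
      then show "e t y i = \<zero>\<^bsub>coord K I {i. a i \<le> t \<and> ereal t < b i}\<^esub> i"
        using i by (simp add: coord_simps)
    qed
    \<comment> \<open>Exactness is applied in degree \<open>t\<close>, not \<open>s\<close>: the
      resulting \<open>z\<close>, pushed forward to \<open>s\<close>, is the radical part of
      \<open>x\<close>, and the difference is a cycle of the resolution.\<close>
    then obtain z where z: "z \<in> carrier (pm_space (P (Suc 0)) t)" "d 0 t z = y"
      using exact0[OF y(1)] by auto
    let ?z = "pm_map (P (Suc 0)) t s z"
    have zV: "?z \<in> carrier ?V" using t z by (intro pm_map_mem[OF P]) auto
    have "d 0 s ?z = d 0 s x" using pm_homD(3)[OF d0 _ z(1), of s] t z(2) y(2) by simp
    then have "d 0 s (x \<ominus>\<^bsub>?V\<^esub> ?z) = \<zero>\<^bsub>?U\<^esub>"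
      using xV zV dx by (simp add: module_hom_minus[OF PM PM pm_homD(1)[OF d0]])
    then have "x \<ominus>\<^bsub>?V\<^esub> ?z \<in> ?D" using D_iff xV zV by simp
    moreover have "?z \<in> ?R" using z(1) t pm_rad_iff[OF P] by blast
    moreover have "x = ?z \<oplus>\<^bsub>?V\<^esub> (x \<ominus>\<^bsub>?V\<^esub> ?z)"
      using xV zV by (simp add: a_minus_def V.a_ac V.r_neg V.r_neg1)
    ultimately show "\<exists>r\<in>?R. \<exists>y\<in>?D. x = r \<oplus>\<^bsub>?V\<^esub> y" by blast
  next
    assume "\<exists>r\<in>?R. \<exists>y\<in>?D. x = r \<oplus>\<^bsub>?V\<^esub> y"
    then obtain u v where u: "u \<in> ?R" and v: "v \<in> ?D" and x_eq: "x = u \<oplus>\<^bsub>?V\<^esub> v" by blast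
    have uV: "u \<in> carrier ?V" using u R.subset by auto
    have vV: "v \<in> carrier ?V" using v DV by auto
    have "d 0 s x = d 0 s u"
      using D_iff[OF vV] v pm_homD(2)[OF d0 uV]
      by (simp add: x_eq module_hom_add[OF pm_homD(1)[OF d0] uV vV])
    obtain t z where z: "s0 \<le> t" "t < s" "z \<in> carrier (pm_space (P (Suc 0)) t)" "u = pm_map (P (Suc 0)) t s z"
      using pm_rad_later[OF P u s0] by metis
    have dz: "d 0 t z \<in> carrier (pm_space (P 0) t)" using pm_homD(2)[OF d0 z(3)] .
    \<comment> \<open>The radical part itself supplies the representative, and \<open>e\<close>
      kills its boundary already in degree \<open>t\<close>.\<close>
    have "rep x t (d 0 t z)"
      using z dz pm_homD(3)[OF d0 _ z(3), of s] \<open>d 0 s x = d 0 s u\<close> by (simp add: rep_def)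
    then have "f x = G t (d 0 t z)" by (rule f)
    also have "e t (d 0 t z) = \<zero>\<^bsub>pm_space S t\<^esub>" using exact0[OF dz] z(3) by simp
    then have "G t (d 0 t z) = \<zero>\<^bsub>?W\<^esub>"
      using hI by (auto simp: G_def space_S coord_simps intro!: restrict_ext)
    finally show "f x = \<zero>\<^bsub>?W\<^esub>" .
  qed
  note quot = vs_quot_quot_iso[OF PV submodule_pm_rad[OF P] Z RZ D DZ W.module_axioms f_hom surj ker]
  show "vectorspace K (H s)" unfolding H by (rule quot(1))
  show "\<exists>g\<in>module_hom K (H s) ?W. bij_betw g (carrier (H s)) (carrier ?W)"
    unfolding H by (rule quot(2))
qed

end

section \<open>Free modules of finite rank are projective\<close>

lemma module_hom_finsum:
  assumes V: "module K V" and W: "module K W" and f: "f \<in> module_hom K V W"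
    and A: "finite A" and g: "\<And>i. i \<in> A \<Longrightarrow> g i \<in> carrier V"
  shows "f (\<Oplus>\<^bsub>V\<^esub>i\<in>A. g i) = (\<Oplus>\<^bsub>W\<^esub>i\<in>A. f (g i))"
proof -
  interpret V: module K V by fact
  interpret W: module K W by fact
  show ?thesis using A g
  proof (induction A)
    case (insert i A)
    then show ?case
      using f by (simp add: Pi_iff module_hom_add[OF f] module_hom_mem[OF f])
  qed (use module_hom_zero[OF V W f] in simp)
qed

definition unit_coord :: "('k, 'm) ring_scheme \<Rightarrow> 'i set \<Rightarrow> 'i \<Rightarrow> 'i \<Rightarrow> 'k" where
  "unit_coord K I j = (\<lambda>i\<in>I. if i = j then \<one>\<^bsub>K\<^esub> else \<zero>\<^bsub>K\<^esub>)"

lemma unit_coord_mem: "field K \<Longrightarrow> j \<in> J \<Longrightarrow> unit_coord K I j \<in> carrier (coord K I J)"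
proof -
  assume "field K" "j \<in> J"
  interpret field K by fact
  show ?thesis using \<open>j \<in> J\<close> by (auto simp: unit_coord_def coord_mem)
qed

text \<open>Induction over finite sets \<open>A\<close> of allowed indices: \<open>f\<close> is
  expanded on \<open>z\<close> cut off to \<open>A\<close>, and one unit vector is split off at a
  time.\<close>

lemma coord_hom_expand:
  assumes K: "field K" and W: "module K W" and f: "f \<in> module_hom K (coord K I J) W"
    and fin: "finite I" and z: "z \<in> carrier (coord K I J)"
  shows "f z = (\<Oplus>\<^bsub>W\<^esub>j\<in>I \<inter> J. z j \<odot>\<^bsub>W\<^esub> f (unit_coord K I j))"
proof -
  interpret field K by fact
  interpret W: module K W by fact
  let ?V = "coord K I J"
  interpret V: vectorspace K ?V by (rule vectorspace_coord[OF K])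
  have zK: "z i \<in> carrier K" if "i \<in> I" for i using z that by (simp add: coord_mem)
  have "f (\<lambda>i\<in>I. if i \<in> A then z i else \<zero>\<^bsub>K\<^esub>) = (\<Oplus>\<^bsub>W\<^esub>j\<in>A. z j \<odot>\<^bsub>W\<^esub> f (unit_coord K I j))"
    if "A \<subseteq> I \<inter> J" for A
    using finite_subset[OF that finite_Int[OF disjI1[OF fin]]] that
  proof (induction A)
    case empty
    have "(\<lambda>i\<in>I. \<zero>\<^bsub>K\<^esub>) = \<zero>\<^bsub>?V\<^esub>" by (simp add: coord_simps)
    then show ?case using module_hom_zero[OF V.module_axioms W f] by simp
  next
    case (insert j A)
    let ?r = "\<lambda>i\<in>I. if i \<in> A then z i else \<zero>\<^bsub>K\<^esub>"
    have j: "j \<in> I" "j \<in> J" using insert.prems by auto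
    have r: "?r \<in> carrier ?V" using zK insert.prems by (auto simp: coord_mem)
    have u: "unit_coord K I j \<in> carrier ?V" by (rule unit_coord_mem[OF K j(2)])
    have "(\<lambda>i\<in>I. if i \<in> insert j A then z i else \<zero>\<^bsub>K\<^esub>) = z j \<odot>\<^bsub>?V\<^esub> unit_coord K I j \<oplus>\<^bsub>?V\<^esub> ?r"
      using zK j insert.hyps(2) by (auto simp: coord_simps unit_coord_def intro!: restrict_ext)
    then have "f (\<lambda>i\<in>I. if i \<in> insert j A then z i else \<zero>\<^bsub>K\<^esub>)
        = z j \<odot>\<^bsub>W\<^esub> f (unit_coord K I j) \<oplus>\<^bsub>W\<^esub> f ?r"
      using zK[OF j(1)] u r by (simp add: module_hom_add[OF f] module_hom_smult[OF f])
    moreover have "z i \<odot>\<^bsub>W\<^esub> f (unit_coord K I i) \<in> carrier W" if "i \<in> insert j A" for i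
      using that insert.prems zK unit_coord_mem[OF K, of i J I] module_hom_mem[OF f]
      by (intro W.smult_closed) auto
    moreover have "f ?r = (\<Oplus>\<^bsub>W\<^esub>j\<in>A. z j \<odot>\<^bsub>W\<^esub> f (unit_coord K I j))"
      using insert.IH insert.prems by blast
    moreover have "(\<Oplus>\<^bsub>W\<^esub>i\<in>insert j A. z i \<odot>\<^bsub>W\<^esub> f (unit_coord K I i)) =
        z j \<odot>\<^bsub>W\<^esub> f (unit_coord K I j) \<oplus>\<^bsub>W\<^esub> (\<Oplus>\<^bsub>W\<^esub>j\<in>A. z j \<odot>\<^bsub>W\<^esub> f (unit_coord K I j))"
      if "\<And>i. i \<in> insert j A \<Longrightarrow> z i \<odot>\<^bsub>W\<^esub> f (unit_coord K I i) \<in> carrier W"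
      using insert.hyps that by (intro W.finsum_insert) auto
    ultimately show ?case by (simp add: restrict_def)
  qed
  moreover have "(\<lambda>i\<in>I. if i \<in> I \<inter> J then z i else \<zero>\<^bsub>K\<^esub>) = z"
    using z by (auto simp: coord_mem extensional_def fun_eq_iff)
  ultimately show ?thesis by (metis order.refl)
qed

text \<open>By the Yoneda lemma a morphism out of the free module is a choice of one element in
  degree \<open>\<alpha> j\<close> for each generator \<open>j\<close>, and such elements can be
  lifted along an epimorphism independently.\<close>

lemma projective_free:
  assumes K: "field K" and fin: "finite (I :: 'i set)"
  shows "pm_projective K (bars K I \<alpha> (\<lambda>_. \<infinity>))" (is "pm_projective K ?P")
proof -
  interpret field K by fact
  have P: "persistence_module K ?P" by (rule persistence_module_bars[OF K])
  have space: "pm_space ?P s = coord K I {i. \<alpha> i \<le> s}" for s by (simp add: bars_space[OF K])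
  have map: "pm_map ?P s t z = z" if "z \<in> carrier (pm_space ?P s)" for s t z
    using that by (auto simp: bars_map space coord_mem extensional_def fun_eq_iff)
  let ?\<delta> = "unit_coord K I"
  show ?thesis
    unfolding pm_projective_def
  proof (intro conjI allI impI ballI P)
    fix X Y :: "('a, real \<times> ('i \<Rightarrow> 'a) \<Rightarrow> 'a) pmod" and g f
    assume X: "persistence_module K X" and Y: "persistence_module K Y"
      and g: "g \<in> pm_epi K X Y" and f: "f \<in> pm_hom K ?P Y"
    have gh: "g \<in> pm_hom K X Y"
      and gs: "\<And>s. g s ` carrier (pm_space X s) = carrier (pm_space Y s)"
      using g by (auto simp: pm_epi_def)
    note XM = vectorspace_module[OF persistence_moduleD(1)[OF X]]
      and YM = vectorspace_module[OF persistence_moduleD(1)[OF Y]]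
    have \<delta>: "?\<delta> j \<in> carrier (pm_space ?P s)" if "\<alpha> j \<le> s" for j s
      unfolding space by (rule unit_coord_mem[OF K]) (use that in simp)
    have "\<exists>x\<in>carrier (pm_space X (\<alpha> j)). g (\<alpha> j) x = f (\<alpha> j) (?\<delta> j)" for j
      using gs[of "\<alpha> j"] pm_homD(2)[OF f \<delta>[of j "\<alpha> j"]] by (metis imageE order.refl)
    then obtain x where x: "\<And>j. x j \<in> carrier (pm_space X (\<alpha> j))"
      and gx: "\<And>j. g (\<alpha> j) (x j) = f (\<alpha> j) (?\<delta> j)" by metis
    define A where "A s = I \<inter> {i. \<alpha> i \<le> s}" for s
    have A: "finite (A s)" "j \<in> A s \<Longrightarrow> j \<in> I" "j \<in> A s \<Longrightarrow> \<alpha> j \<le> s" for j s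
      using fin by (auto simp: A_def)
    define \<xi> where "\<xi> s j = pm_map X (\<alpha> j) s (x j)" for s j
    have \<xi>: "\<xi> s j \<in> carrier (pm_space X s)" if "j \<in> A s" for s j
      unfolding \<xi>_def by (rule pm_map_mem[OF X A(3)[OF that] x])
    define h where "h s z = (\<Oplus>\<^bsub>pm_space X s\<^esub>j\<in>A s. z j \<odot>\<^bsub>pm_space X s\<^esub> \<xi> s j)" for s z
    have zK: "z j \<in> carrier K" if "z \<in> carrier (pm_space ?P s)" "j \<in> A t" for z s t j
      using that A(2) by (auto simp: space coord_mem)
    have summand: "z j \<odot>\<^bsub>pm_space X s\<^esub> \<xi> s j \<in> carrier (pm_space X s)"
      if "z \<in> carrier (pm_space ?P s)" "j \<in> A s" for s z j
    proof -
      interpret X: module K "pm_space X s" by (rule XM)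
      show ?thesis using zK that \<xi> by blast
    qed
    have "h \<in> pm_hom K ?P X"
      unfolding pm_hom_def
    proof (intro CollectI conjI allI impI ballI)
      fix s
      interpret X: module K "pm_space X s" by (rule XM)
      interpret P: vectorspace K "pm_space ?P s" by (rule persistence_moduleD(1)[OF P])
      show "h s \<in> module_hom K (pm_space ?P s) (pm_space X s)"
        unfolding module_hom_def
      proof (intro CollectI conjI allI impI)
        show "h s \<in> carrier (pm_space ?P s) \<rightarrow> carrier (pm_space X s)"
          using summand by (auto simp: h_def intro!: X.finsum_closed)
        fix z w assume zw: "z \<in> carrier (pm_space ?P s) \<and> w \<in> carrier (pm_space ?P s)"
        have "(z \<oplus>\<^bsub>pm_space ?P s\<^esub> w) j \<odot>\<^bsub>pm_space X s\<^esub> \<xi> s j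
            = z j \<odot>\<^bsub>pm_space X s\<^esub> \<xi> s j \<oplus>\<^bsub>pm_space X s\<^esub> w j \<odot>\<^bsub>pm_space X s\<^esub> \<xi> s j"
          if "j \<in> A s" for j
          using zw that A(2) zK[of z s j s] zK[of w s j s] \<xi>[of j s]
          by (simp add: space coord_simps X.smult_l_distr)
        then have "h s (z \<oplus>\<^bsub>pm_space ?P s\<^esub> w) = (\<Oplus>\<^bsub>pm_space X s\<^esub>j\<in>A s.
            z j \<odot>\<^bsub>pm_space X s\<^esub> \<xi> s j \<oplus>\<^bsub>pm_space X s\<^esub> w j \<odot>\<^bsub>pm_space X s\<^esub> \<xi> s j)"
          unfolding h_def using zw summand by (intro X.finsum_cong') auto
        then show "h s (z \<oplus>\<^bsub>pm_space ?P s\<^esub> w) = h s z \<oplus>\<^bsub>pm_space X s\<^esub> h s w"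
          unfolding h_def using zw summand by (subst X.finsum_addf[symmetric]) auto
      next
        fix c z assume cz: "c \<in> carrier K \<and> z \<in> carrier (pm_space ?P s)"
        have "(c \<odot>\<^bsub>pm_space ?P s\<^esub> z) j \<odot>\<^bsub>pm_space X s\<^esub> \<xi> s j
            = c \<odot>\<^bsub>pm_space X s\<^esub> (z j \<odot>\<^bsub>pm_space X s\<^esub> \<xi> s j)" if "j \<in> A s" for j
          using cz that A(2) zK[of z s j s] \<xi>[of j s]
          by (simp add: space coord_simps X.smult_assoc1)
        then have "h s (c \<odot>\<^bsub>pm_space ?P s\<^esub> z) = (\<Oplus>\<^bsub>pm_space X s\<^esub>j\<in>A s.
            c \<odot>\<^bsub>pm_space X s\<^esub> (z j \<odot>\<^bsub>pm_space X s\<^esub> \<xi> s j))"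
          unfolding h_def using cz summand by (intro X.finsum_cong') auto
        then show "h s (c \<odot>\<^bsub>pm_space ?P s\<^esub> z) = c \<odot>\<^bsub>pm_space X s\<^esub> h s z"
          unfolding h_def using cz summand A(1) by (subst X.finsum_smult_ldistr) auto
      qed
    next
      fix s t :: real and z assume st: "s \<le> t" and z: "z \<in> carrier (pm_space ?P s)"
      interpret Xt: module K "pm_space X t" by (rule XM)
      interpret Xs: module K "pm_space X s" by (rule XM)
      have zt: "z \<in> carrier (pm_space ?P t)" using pm_map_mem[OF P st z] map[OF z] by simp
      have "pm_map X s t (h s z) = (\<Oplus>\<^bsub>pm_space X t\<^esub>j\<in>A s. pm_map X s t (z j \<odot>\<^bsub>pm_space X s\<^esub> \<xi> s j))"
        unfolding h_def
        by (rule module_hom_finsum[OF XM XM persistence_moduleD(2)[OF X st] A(1) summand[OF z]])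
      \<comment> \<open>Generators that appear only after degree \<open>s\<close> have coefficient
        zero in \<open>z\<close>, so the sum may be extended to all of \<open>A t\<close>.\<close>
      also have "\<dots> = (\<Oplus>\<^bsub>pm_space X t\<^esub>j\<in>A t. z j \<odot>\<^bsub>pm_space X t\<^esub> \<xi> t j)"
      proof (rule Xt.add.finprod_mono_neutral_cong_left[OF A(1)])
        show "A s \<subseteq> A t" using st by (auto simp: A_def)
        show "z j \<odot>\<^bsub>pm_space X t\<^esub> \<xi> t j = \<zero>\<^bsub>pm_space X t\<^esub>" if "j \<in> A t - A s" for j
        proof -
          have "z j = \<zero>\<^bsub>K\<^esub>" using that z by (auto simp: A_def space coord_mem)
          then show ?thesis using \<xi>[of j t] that by simp
        qed
        show "pm_map X s t (z j \<odot>\<^bsub>pm_space X s\<^esub> \<xi> s j) = z j \<odot>\<^bsub>pm_space X t\<^esub> \<xi> t j" if "j \<in> A s" for j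
          using that z zK \<xi> A(3) st x
          by (simp add: module_hom_smult[OF persistence_moduleD(2)[OF X st]] \<xi>_def
              persistence_moduleD(4)[OF X])
        show "(\<lambda>j. z j \<odot>\<^bsub>pm_space X t\<^esub> \<xi> t j) \<in> A t \<rightarrow> carrier (pm_space X t)"
          using summand[OF zt] by auto
      qed
      finally show "h t (pm_map ?P s t z) = pm_map X s t (h s z)"
        by (simp add: map[OF z] h_def)
    qed
    moreover have "g s (h s z) = f s z" if z: "z \<in> carrier (pm_space ?P s)" for s z
    proof -
      interpret Ys: module K "pm_space Y s" by (rule YM)
      have "g s (h s z) = (\<Oplus>\<^bsub>pm_space Y s\<^esub>j\<in>A s. g s (z j \<odot>\<^bsub>pm_space X s\<^esub> \<xi> s j))"
        unfolding h_def
        by (rule module_hom_finsum[OF XM YM pm_homD(1)[OF gh] A(1) summand[OF z]])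
      also have "\<dots> = (\<Oplus>\<^bsub>pm_space Y s\<^esub>j\<in>A s. z j \<odot>\<^bsub>pm_space Y s\<^esub> f s (?\<delta> j))"
      proof (rule Ys.finsum_cong'[OF refl])
        show "(\<lambda>j. z j \<odot>\<^bsub>pm_space Y s\<^esub> f s (?\<delta> j)) \<in> A s \<rightarrow> carrier (pm_space Y s)"
          using zK[OF z] A(3) pm_homD(2)[OF f \<delta>] by auto
        fix j assume j: "j \<in> A s"
        have "g s (\<xi> s j) = pm_map Y (\<alpha> j) s (f (\<alpha> j) (?\<delta> j))"
          using pm_homD(3)[OF gh A(3)[OF j] x] by (simp add: \<xi>_def gx)
        also have "\<dots> = f s (?\<delta> j)"
          using pm_homD(3)[OF f A(3)[OF j] \<delta>[of j "\<alpha> j"]] map[OF \<delta>[of j "\<alpha> j"]] by simp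
        finally show "g s (z j \<odot>\<^bsub>pm_space X s\<^esub> \<xi> s j) = z j \<odot>\<^bsub>pm_space Y s\<^esub> f s (?\<delta> j)"
          using zK[OF z j] \<xi>[OF j] by (simp add: module_hom_smult[OF pm_homD(1)[OF gh]])
      qed
      also have "\<dots> = f s z"
        unfolding A_def
        by (rule coord_hom_expand[OF K YM _ fin, symmetric])
          (use pm_homD(1)[OF f, of s] z in \<open>simp_all add: space\<close>)
      finally show ?thesis .
    qed
    ultimately show "\<exists>h\<in>pm_hom K ?P X. \<forall>s. \<forall>z\<in>carrier (pm_space ?P s). g s (h s z) = f s z"
      by blast
  qed
qed

text \<open>The resolution \<open>0 \<rightarrow> \<Oplus>\<^sub>i k[b\<^sub>i, \<infinity>) \<rightarrow> \<Oplus>\<^sub>i k[a\<^sub>i, \<infinity>)\<close> of \<open>\<Oplus>\<^sub>i k[a\<^sub>i, b\<^sub>i)\<close>, with summands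
  indexed by the image of an injection \<open>\<iota>\<close> so that it lives in a prescribed type.\<close>

lemma bars_resolution_exists:
  fixes I :: "'i set" and \<iota> :: "'i \<Rightarrow> 'j"
  assumes K: "field K" and fin: "finite I" and inj: "inj_on \<iota> I"
    and nonempty: "\<And>i. i \<in> I \<Longrightarrow> ereal (a i) < b i"
  shows "\<exists>(P :: nat \<Rightarrow> ('k, 'j \<Rightarrow> 'k) pmod) d e. projective_resolution (K :: ('k, 'm) ring_scheme) (bars K I a b) P d e"
proof -
  interpret field K by fact
  \<comment> \<open>The relation that ends a bar carries the same label as its generator. The index
    sets decrease, so every differential is restriction to common labels and extension by zero; from
    degree 2 on the modules vanish.\<close>
  define J where "J n = (case n of 0 \<Rightarrow> \<iota> ` I | Suc 0 \<Rightarrow> \<iota> ` {i \<in> I. b i \<noteq> \<infinity>} | _ \<Rightarrow> {})" for n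
  have J: "J 0 = \<iota> ` I" "J (Suc 0) = \<iota> ` {i \<in> I. b i \<noteq> \<infinity>}" "J (Suc (Suc n)) = {}" for n
    by (auto simp: J_def)
  have Jsub: "J (Suc n) \<subseteq> J n" for n by (cases n) (auto simp: J)
  have Jfin: "finite (J n)" for n by (auto simp: J_def fin split: nat.split)
  define \<kappa> where "\<kappa> = inv_into I \<iota>"
  have \<kappa>: "\<kappa> (\<iota> i) = i" if "i \<in> I" for i using inj that by (simp add: \<kappa>_def)
  define \<alpha> where "\<alpha> n j = (if n = 0 then a (\<kappa> j) else real_of_ereal (b (\<kappa> j)))" for n :: nat and j
  define P where "P n = bars K (J n) (\<alpha> n) (\<lambda>_. \<infinity>)" for n
  have \<alpha>: "\<alpha> n j \<le> \<alpha> (Suc n) j" if j: "j \<in> J (Suc n)" for n j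
  proof (cases n)
    case 0
    then obtain i where "i \<in> I" "b i \<noteq> \<infinity>" "j = \<iota> i" using j J by auto
    then show ?thesis using nonempty[of i] 0 by (cases "b i") (auto simp: \<alpha>_def \<kappa>)
  qed (use j J in auto)
  define d where "d n s z = (\<lambda>j\<in>J n. if j \<in> J (Suc n) then z j else \<zero>\<^bsub>K\<^esub>)" for n and s :: real and z
  define e where "e s z = (\<lambda>i\<in>I. if a i \<le> s \<and> ereal s < b i then z (\<iota> i) else \<zero>\<^bsub>K\<^esub>)" for s z
  have space: "pm_space (P n) s = coord K (J n) {j. \<alpha> n j \<le> s}" for n s
    by (simp add: P_def bars_space[OF K])
  have map: "pm_map (P n) s t z = z" if "z \<in> carrier (coord K (J n) {j. \<alpha> n j \<le> s})" for n s t z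
    using that by (auto simp: P_def bars_map coord_mem extensional_def fun_eq_iff)
  have d_mem: "d n s z \<in> carrier (pm_space (P n) s)" if "z \<in> carrier (pm_space (P (Suc n)) s)" for n s z
    using that \<alpha>[of _ n] by (force simp: space coord_mem d_def)
  have d: "d n \<in> pm_hom K (P (Suc n)) (P n)" for n
    unfolding pm_hom_def
  proof (intro CollectI conjI allI impI ballI)
    show "d n s \<in> module_hom K (pm_space (P (Suc n)) s) (pm_space (P n) s)" for s
      unfolding space using d_mem[of _ n s]
      by (intro coord_hom[OF K]) (auto simp: space d_def coord_simps)
    fix s t z assume "z \<in> carrier (pm_space (P (Suc n)) s)"
    then show "d n t (pm_map (P (Suc n)) s t z) = pm_map (P n) s t (d n s z)"
      using d_mem[of z n s] by (simp add: space map) (simp add: d_def)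
  qed
  have e: "e \<in> pm_hom K (P 0) (bars K I a b)"
    unfolding pm_hom_def
  proof (intro CollectI conjI allI impI ballI)
    show "e s \<in> module_hom K (pm_space (P 0) s) (pm_space (bars K I a b) s)" for s
      unfolding space bars_space[OF K]
      by (intro coord_hom[OF K]) (auto simp: coord_mem J e_def coord_simps)
    fix s t :: real and z assume "s \<le> t" and z: "z \<in> carrier (pm_space (P 0) s)"
    have "z (\<iota> i) = \<zero>\<^bsub>K\<^esub>" if "i \<in> I" "\<not> a i \<le> s" for i
      using z that by (auto simp: space coord_mem J \<alpha>_def \<kappa>)
    then show "e t (pm_map (P 0) s t z) = pm_map (bars K I a b) s t (e s z)"
      using z \<open>s \<le> t\<close> by (auto simp: space map bars_map e_def intro!: restrict_ext intro: ereal_le_less)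
  qed
  have e_surj: "e s ` carrier (pm_space (P 0) s) = carrier (pm_space (bars K I a b) s)" for s
  proof (intro equalityI subsetI)
    fix w assume w: "w \<in> carrier (pm_space (bars K I a b) s)"
    define z where "z = (\<lambda>j\<in>J 0. w (\<kappa> j))"
    have "z \<in> carrier (pm_space (P 0) s)"
      using w by (auto simp: z_def space bars_space[OF K] coord_mem J \<alpha>_def \<kappa>)
    moreover have "e s z = w"
      using w by (auto simp: e_def z_def bars_space[OF K] coord_mem J \<kappa> extensional_def fun_eq_iff)
    ultimately show "w \<in> e s ` carrier (pm_space (P 0) s)" by blast
  qed (use pm_homD(2)[OF e] in blast)
  \<comment> \<open>An element is killed by \<open>e\<close> when its coordinates in bars alive at
    \<open>s\<close> vanish. The remaining coordinates belong to bars that have ended by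
    \<open>s\<close>, which are exactly the labels whose relation is present in degree
    \<open>s\<close>.\<close>
  have exact0: "d 0 s ` carrier (pm_space (P (Suc 0)) s) =
      {z \<in> carrier (pm_space (P 0) s). e s z = \<zero>\<^bsub>pm_space (bars K I a b) s\<^esub>}" for s
  proof (intro equalityI subsetI)
    fix x assume "x \<in> d 0 s ` carrier (pm_space (P (Suc 0)) s)"
    then obtain z where z: "z \<in> carrier (pm_space (P (Suc 0)) s)" "x = d 0 s z" by blast
    have "x (\<iota> i) = \<zero>\<^bsub>K\<^esub>" if i: "i \<in> I" "ereal s < b i" for i
    proof (cases "b i = \<infinity>")
      case True
      then have "\<iota> i \<notin> J (Suc 0)" using i inj by (auto simp: J inj_on_def)
      then show ?thesis using i by (simp add: z(2) d_def J)
    next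
      case False
      then have "\<not> \<alpha> (Suc 0) (\<iota> i) \<le> s" using i by (cases "b i") (auto simp: \<alpha>_def \<kappa>)
      then show ?thesis using z(1) i by (auto simp: z(2) d_def J space coord_mem)
    qed
    then show "x \<in> {z \<in> carrier (pm_space (P 0) s). e s z = \<zero>\<^bsub>pm_space (bars K I a b) s\<^esub>}"
      using d_mem[OF z(1)] z(2) by (auto simp: e_def bars_space[OF K] coord_simps intro!: restrict_ext)
  next
    fix x assume "x \<in> {z \<in> carrier (pm_space (P 0) s). e s z = \<zero>\<^bsub>pm_space (bars K I a b) s\<^esub>}"
    then have x: "x \<in> carrier (coord K (J 0) {j. \<alpha> 0 j \<le> s})"
      and ex: "e s x = (\<lambda>i\<in>I. \<zero>\<^bsub>K\<^esub>)" by (auto simp: space bars_space[OF K] coord_simps)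
    have x0: "x (\<iota> i) = \<zero>\<^bsub>K\<^esub>" if i: "i \<in> I" "ereal s < b i" for i
    proof (cases "a i \<le> s")
      case True
      then show ?thesis using fun_cong[OF ex, of i] i by (simp add: e_def)
    next
      case False
      then show ?thesis using x i by (auto simp: coord_mem J \<alpha>_def \<kappa>)
    qed
    define z where "z = (\<lambda>j\<in>J (Suc 0). x j)"
    have "z j = \<zero>\<^bsub>K\<^esub>" if j: "j \<in> J (Suc 0)" "\<not> \<alpha> (Suc 0) j \<le> s" for j
    proof -
      obtain i where i: "i \<in> I" "b i \<noteq> \<infinity>" "j = \<iota> i" using j J by auto
      then have "ereal s < b i" using j(2) nonempty[OF i(1)]
        by (cases "b i") (auto simp: \<alpha>_def \<kappa>)
      then show ?thesis using x0 i j(1) by (simp add: z_def)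
    qed
    then have "z \<in> carrier (pm_space (P (Suc 0)) s)"
      using x Jsub[of 0] by (auto simp: z_def space coord_mem)
    moreover have "d 0 s z = x"
    proof (rule coord_eqI[OF d_mem[OF calculation, unfolded space] x])
      fix j assume j: "j \<in> J 0"
      then obtain i where i: "i \<in> I" "j = \<iota> i" by (auto simp: J)
      show "d 0 s z j = x j"
        using x0[of i] i j by (auto simp: d_def z_def J)
    qed
    ultimately show "x \<in> d 0 s ` carrier (pm_space (P (Suc 0)) s)" by blast
  qed
  have exact: "d (Suc n) s ` carrier (pm_space (P (Suc (Suc n))) s) =
      {z \<in> carrier (pm_space (P (Suc n)) s). d n s z = \<zero>\<^bsub>pm_space (P n) s\<^esub>}" for n s
  proof -
    have 0: "\<zero>\<^bsub>pm_space (P (Suc n)) s\<^esub> \<in> carrier (pm_space (P (Suc n)) s)"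
      by (auto simp: space coord_simps coord_mem)
    \<comment> \<open>With no labels the only extensional function is undefined everywhere; it is
      the zero of these modules.\<close>
    have "carrier (pm_space (P (Suc (Suc n))) s) = {\<lambda>_. undefined}"
      by (auto simp: space J coord_mem extensional_def)
    moreover have "d (Suc n) s (\<lambda>_. undefined) = \<zero>\<^bsub>pm_space (P (Suc n)) s\<^esub>"
      by (auto simp: d_def J space coord_simps)
    moreover have "{z \<in> carrier (pm_space (P (Suc n)) s). d n s z = \<zero>\<^bsub>pm_space (P n) s\<^esub>}
        = {\<zero>\<^bsub>pm_space (P (Suc n)) s\<^esub>}"
    proof (intro equalityI subsetI)
      fix z assume "z \<in> {z \<in> carrier (pm_space (P (Suc n)) s). d n s z = \<zero>\<^bsub>pm_space (P n) s\<^esub>}"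
      then have z: "z \<in> carrier (pm_space (P (Suc n)) s)" and dz: "d n s z = \<zero>\<^bsub>pm_space (P n) s\<^esub>" by auto
      have "z j = \<zero>\<^bsub>K\<^esub>" if "j \<in> J (Suc n)" for j
        using fun_cong[OF dz, of j] that Jsub[of n] by (auto simp: d_def space coord_simps)
      then have "z = \<zero>\<^bsub>pm_space (P (Suc n)) s\<^esub>"
        using z 0 by (intro coord_eqI[of z K "J (Suc n)" "{j. \<alpha> (Suc n) j \<le> s}"]) (auto simp: space coord_simps)
      then show "z \<in> {\<zero>\<^bsub>pm_space (P (Suc n)) s\<^esub>}" by simp
    qed (use 0 in \<open>auto simp: d_def space coord_simps intro!: restrict_ext\<close>)
    ultimately show ?thesis by simp
  qed
  have "projective_resolution K (bars K I a b) P d e"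
    unfolding projective_resolution_def pm_epi_def pm_exact_at_def
    using projective_free[OF K Jfin] d e e_surj exact0 exact by (simp add: P_def)
  then show ?thesis by blast
qed

section \<open>The structure theorem\<close>

context field
begin

abbreviation filt :: "nat \<Rightarrow> (nat \<Rightarrow> real) \<Rightarrow> real \<Rightarrow> ('a, nat \<Rightarrow> 'a) module" where
  "filt n a s \<equiv> coord R {..<n} {i. a i \<le> s}"

text \<open>The automorphisms of a free module of finite rank, as linear maps of its colimit that
  restrict to every degree.\<close>

definition filt_aut :: "nat \<Rightarrow> (nat \<Rightarrow> real) \<Rightarrow> ((nat \<Rightarrow> 'a) \<Rightarrow> nat \<Rightarrow> 'a) \<Rightarrow> bool" where
  "filt_aut n a c \<longleftrightarrow> (\<forall>s. c \<in> module_hom R (filt n a s) (filt n a s) \<and>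
     bij_betw c (carrier (filt n a s)) (carrier (filt n a s)))"

lemma filt_aut_comp:
  assumes "filt_aut n a c" "filt_aut n a c'"
  shows "filt_aut n a (\<lambda>z. c' (c z))"
  unfolding filt_aut_def
proof (intro allI conjI)
  fix s
  show "(\<lambda>z. c' (c z)) \<in> module_hom R (filt n a s) (filt n a s)"
    by (rule module_hom_comp[where f=c' and g=c and V="filt n a s"]) (use assms in \<open>auto simp: filt_aut_def\<close>)
  show "bij_betw (\<lambda>z. c' (c z)) (carrier (filt n a s)) (carrier (filt n a s))"
    using assms bij_betw_trans[of c _ "carrier (filt n a s)" c'] by (simp add: filt_aut_def o_def)
qed

text \<open>An elementary operation that adds multiples of coordinate \<open>j\<close> to the
  others. It respects degrees because a vector of degree \<open>s\<close> with \<open>z j\<close>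
  non-zero has \<open>a j \<le> s\<close>, hence \<open>a i \<le> s\<close>. As
  \<open>\<mu> j = \<zero>\<close>, the inverse is the shear with the opposite coefficients.\<close>

lemma filt_aut_shear:
  assumes j: "j < n" and \<mu>j: "\<mu> j = \<zero>" and \<mu>: "\<And>i. i < n \<Longrightarrow> \<mu> i \<in> carrier R"
    and le: "\<And>i. i < n \<Longrightarrow> \<mu> i \<noteq> \<zero> \<Longrightarrow> a i \<le> a j"
  shows "filt_aut n a (\<lambda>z. \<lambda>i\<in>{..<n}. z i \<oplus> \<mu> i \<otimes> z j)"
proof -
  define T where "T \<mu> z = (\<lambda>i\<in>{..<n}. z i \<oplus> \<mu> i \<otimes> z j)" for \<mu> and z :: "nat \<Rightarrow> 'a"
  have mem: "T \<nu> z \<in> carrier (filt n a s)"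
    if z: "z \<in> carrier (filt n a s)" and \<nu>: "\<And>i. i < n \<Longrightarrow> \<nu> i \<in> carrier R"
      "\<And>i. i < n \<Longrightarrow> \<nu> i \<noteq> \<zero> \<Longrightarrow> a i \<le> a j" for \<nu> z s
  proof -
    have "\<nu> i \<otimes> z j = \<zero>" if "i < n" "\<not> a i \<le> s" for i
    proof (cases "\<nu> i = \<zero>")
      case False
      then have "\<not> a j \<le> s" using \<nu>(2) that by force
      then have "z j = \<zero>" using z j by (auto simp: coord_mem)
      then show ?thesis using \<nu>(1) that by simp
    qed (use z j in \<open>auto simp: coord_mem\<close>)
    then show ?thesis using z \<nu>(1) j by (auto simp: T_def coord_mem)
  qed
  have inverse: "T \<nu>' (T \<nu> z) = z"
    if z: "z \<in> carrier (filt n a s)" and \<nu>: "\<And>i. i < n \<Longrightarrow> \<nu> i \<in> carrier R"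
      "\<And>i. i < n \<Longrightarrow> \<nu>' i = \<ominus> \<nu> i" "\<nu> j = \<zero>" for \<nu> \<nu>' z s
  proof (rule extensionalityI[of _ "{..<n}"])
    fix i assume "i \<in> {..<n}"
    then have i: "i < n" by simp
    have K: "z i \<in> carrier R" "z j \<in> carrier R" "\<nu> i \<in> carrier R" using z i j \<nu> by (auto simp: coord_mem)
    then have "z i \<oplus> \<nu> i \<otimes> z j \<oplus> \<ominus> \<nu> i \<otimes> z j = z i"
      by (simp add: a_assoc l_minus r_neg)
    then show "T \<nu>' (T \<nu> z) i = z i" using i j K by (simp add: T_def \<nu>)
  qed (use z in \<open>auto simp: T_def coord_mem\<close>)
  have hom: "T \<mu> \<in> module_hom R (filt n a s) (filt n a s)" for s
    by (rule coord_hom[OF field_axioms mem])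
      (use \<mu> le j in \<open>auto simp: T_def coord_simps coord_mem r_distr a_ac m_lcomm\<close>)
  have \<mu>': "\<ominus> \<mu> i \<in> carrier R" "\<ominus> \<mu> i \<noteq> \<zero> \<Longrightarrow> a i \<le> a j" if "i < n" for i
    using \<mu> le that by force+
  have "bij_betw (T \<mu>) (carrier (filt n a s)) (carrier (filt n a s))" for s
  proof (rule bij_betw_byWitness[where f' = "T (\<lambda>i. \<ominus> \<mu> i)"])
    show "\<forall>z\<in>carrier (filt n a s). T (\<lambda>i. \<ominus> \<mu> i) (T \<mu> z) = z"
      using inverse[of _ s \<mu> "\<lambda>i. \<ominus> \<mu> i"] \<mu> \<mu>j by blast
    show "\<forall>z\<in>carrier (filt n a s). T \<mu> (T (\<lambda>i. \<ominus> \<mu> i) z) = z"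
      using inverse[of _ s "\<lambda>i. \<ominus> \<mu> i" \<mu>] \<mu> \<mu>j by simp
    show "T \<mu> ` carrier (filt n a s) \<subseteq> carrier (filt n a s)" using mem[of _ s \<mu>] \<mu> le by auto
    show "T (\<lambda>i. \<ominus> \<mu> i) ` carrier (filt n a s) \<subseteq> carrier (filt n a s)"
      using mem[of _ s "\<lambda>i. \<ominus> \<mu> i"] \<mu>' by auto
  qed
  then show ?thesis using hom by (simp add: filt_aut_def T_def[abs_def])
qed

text \<open>The standard persistence algorithm: the relations are adjoined by increasing degree.  When
  a relation involves generators that are still alive, the youngest of them is replaced by the
  relation, which ends its bar.\<close>

lemma presentation_reduction:
  assumes f: "\<And>s. f s \<in> module_hom R (filt m b s) (filt n a s)"
    and f_const: "\<And>s t w. s \<le> t \<Longrightarrow> w \<in> carrier (filt m b s) \<Longrightarrow> f t w = f s w"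
  shows "\<exists>c \<beta>. filt_aut n a c \<and> (\<forall>i<n. ereal (a i) \<le> \<beta> i) \<and>
    (\<forall>s. \<forall>y\<in>carrier (filt n a s). y \<in> f s ` carrier (filt m b s) \<longleftrightarrow>
      (\<forall>i<n. ereal s < \<beta> i \<longrightarrow> c y i = \<zero>))"
proof -
  let ?N = "\<lambda>J s. f s ` carrier (coord R {..<m} ({j. b j \<le> s} \<inter> J))"
  have F: "vectorspace R (filt n a s)" for s by (rule vectorspace_coord[OF field_axioms])
  have FM: "module R (filt n a s)" for s by (rule vectorspace_module[OF F])
  have GM: "module R (filt m b s)" for s by (rule vectorspace_module[OF vectorspace_coord[OF field_axioms]])
  have Nsub: "carrier (coord R {..<m} ({j. b j \<le> s} \<inter> J)) \<subseteq> carrier (filt m b s)" for J s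
    by (rule coord_mono) auto
  \<comment> \<open>The invariant for the relations in \<open>J\<close>, whose span in degree
    \<open>s\<close> is \<open>?N J s\<close>. Recording that every finite \<open>\<beta> i\<close>
    is the degree of a relation in \<open>J\<close> ensures that no bar ends after the degree of the
    next relation.\<close>
  have "J \<subseteq> {..<m} \<longrightarrow> (\<exists>c \<beta>. filt_aut n a c \<and> (\<forall>i<n. ereal (a i) \<le> \<beta> i) \<and>
      (\<forall>i<n. \<beta> i = \<infinity> \<or> (\<exists>j\<in>J. \<beta> i = ereal (b j))) \<and>
      (\<forall>s. \<forall>y\<in>carrier (filt n a s). y \<in> ?N J s \<longleftrightarrow> (\<forall>i<n. ereal s < \<beta> i \<longrightarrow> c y i = \<zero>)))"
    if "finite J" for J
    using that
  proof (induction J rule: finite_ranking_induct[where f = b])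
    case empty
    have "filt_aut n a (\<lambda>z. z)" by (auto simp: filt_aut_def module_hom_def bij_betw_def)
    moreover have "y \<in> ?N {} s \<longleftrightarrow> (\<forall>i<n. y i = \<zero>)" if y: "y \<in> carrier (filt n a s)" for s y
    proof -
      have "carrier (coord R {..<m} ({j. b j \<le> s} \<inter> {})) = {\<lambda>i\<in>{..<m}. \<zero>}"
        by (auto simp: coord_mem extensional_def fun_eq_iff)
      moreover have "f s (\<lambda>i\<in>{..<m}. \<zero>) = (\<lambda>i\<in>{..<n}. \<zero>)"
        using module_hom_zero[OF GM FM f[of s]] by (simp add: coord_simps)
      ultimately show ?thesis
        using y by (auto simp: coord_mem extensional_def fun_eq_iff)
    qed
    ultimately show ?case by (intro impI exI[of _ "\<lambda>z. z"] exI[of _ "\<lambda>_. \<infinity>"]) auto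
  next
    case (insert q J)
    show ?case
    proof (cases "q \<in> J")
      case True
      then show ?thesis using insert by (simp add: insert_absorb)
    next
      case qJ: False
      show ?thesis
      proof
        assume "insert q J \<subseteq> {..<m}"
        then have q: "q < m" and "J \<subseteq> {..<m}" by auto
        then obtain c \<beta> where c: "filt_aut n a c" and a\<beta>: "\<And>i. i < n \<Longrightarrow> ereal (a i) \<le> \<beta> i"
          and \<beta>: "\<And>i. i < n \<Longrightarrow> \<beta> i = \<infinity> \<or> (\<exists>j\<in>J. \<beta> i = ereal (b j))"
          and crit: "\<And>s y. y \<in> carrier (filt n a s) \<Longrightarrow>
            y \<in> ?N J s \<longleftrightarrow> (\<forall>i<n. ereal s < \<beta> i \<longrightarrow> c y i = \<zero>)"
          using insert.IH by blast
        have c_hom: "c \<in> module_hom R (filt n a s) (filt n a s)" for s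
          using c by (simp add: filt_aut_def)
        have c_add: "c (y \<oplus>\<^bsub>filt n a s\<^esub> y') i = c y i \<oplus> c y' i"
          if "y \<in> carrier (filt n a s)" "y' \<in> carrier (filt n a s)" "i < n" for s y y' i
          using module_hom_add[OF c_hom that(1,2)] that(3) by (simp add: coord_simps)
        have c_smult: "c (k \<odot>\<^bsub>filt n a s\<^esub> y) i = k \<otimes> c y i"
          if "k \<in> carrier R" "y \<in> carrier (filt n a s)" "i < n" for s k y i
          using module_hom_smult[OF c_hom that(1,2)] that(3) by (simp add: coord_simps)
        have c_mem: "c y \<in> carrier (filt n a s)" if "y \<in> carrier (filt n a s)" for s y
          by (rule module_hom_mem[OF c_hom that])
        have cK: "c y i \<in> carrier R" if "y \<in> carrier (filt n a s)" "i < n" for s y i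
          using c_mem[OF that(1)] that(2) by (simp add: coord_mem)
        \<comment> \<open>The ranking induction adds \<open>q\<close> last, so all finite ends are
          at most \<open>b q\<close>.\<close>
        have alive: "ereal s < \<beta> i \<longleftrightarrow> \<beta> i = \<infinity>" if "i < n" "b q \<le> s" for i s
          using \<beta>[OF that(1)] insert.hyps(2) that(2) by (force intro: order_trans)
        define \<delta> :: "nat \<Rightarrow> 'a" where "\<delta> = (\<lambda>i\<in>{..<m}. if i = q then \<one> else \<zero>)"
        have \<delta>: "\<delta> \<in> carrier (coord R {..<m} ({j. b j \<le> s} \<inter> insert q J))" if "b q \<le> s" for s
          using that by (auto simp: \<delta>_def coord_mem)
        then have \<delta>': "\<delta> \<in> carrier (filt m b s)" if "b q \<le> s" for s using that Nsub by blast
        \<comment> \<open>By \<open>f_const\<close> the new relation is one fixed vector in all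
          degrees from \<open>b q\<close> on; \<open>\<rho>\<close> is that vector in the
          coordinates reached so far.\<close>
        define r where "r = f (b q) \<delta>"
        have r: "r \<in> carrier (filt n a s)" "f s \<delta> = r" if "b q \<le> s" for s
          using module_hom_mem[OF f \<delta>'[OF that]] f_const[OF that \<delta>'[of "b q"]] by (auto simp: r_def)
        define \<rho> where "\<rho> = c r"
        have \<rho>K: "\<rho> i \<in> carrier R" if "i < n" for i
          unfolding \<rho>_def by (rule cK[OF r(1)[of "b q"] that]) simp
        have early: "?N (insert q J) s = ?N J s" if "s < b q" for s
        proof -
          have "{j. b j \<le> s} \<inter> insert q J = {j. b j \<le> s} \<inter> J" using that by auto
          then show ?thesis by simp
        qed
        \<comment> \<open>From \<open>b q\<close> on, membership means that \<open>y\<close> minus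
          some multiple of \<open>r\<close> lies in the span of the earlier relations, and by
          \<open>alive\<close> the latter is tested on infinite bars only.\<close>
        have late: "y \<in> ?N (insert q J) s \<longleftrightarrow>
            (\<exists>k\<in>carrier R. \<forall>i<n. \<beta> i = \<infinity> \<longrightarrow> c y i = k \<otimes> \<rho> i)"
          if s: "b q \<le> s" and y: "y \<in> carrier (filt n a s)" for s y
        proof
          assume "y \<in> ?N (insert q J) s"
          then obtain w where w: "w \<in> carrier (coord R {..<m} ({j. b j \<le> s} \<inter> insert q J))"
            "y = f s w" by auto
          define v where "v = (\<lambda>i\<in>{..<m}. if i = q then \<zero> else w i)"
          have v: "v \<in> carrier (coord R {..<m} ({j. b j \<le> s} \<inter> J))"
            using w(1) by (auto simp: v_def coord_mem)
          have wq: "w q \<in> carrier R" using w(1) q by (auto simp: coord_mem)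
          interpret F: vectorspace R "filt n a s" by (rule F)
          interpret G: module R "filt m b s" by (rule GM)
          have v': "v \<in> carrier (filt m b s)" using v Nsub by blast
          have "w = v \<oplus>\<^bsub>filt m b s\<^esub> w q \<odot>\<^bsub>filt m b s\<^esub> \<delta>"
            using w(1) wq by (auto simp: coord_simps v_def \<delta>_def coord_mem extensional_def fun_eq_iff)
          then have "y = f s v \<oplus>\<^bsub>filt n a s\<^esub> w q \<odot>\<^bsub>filt n a s\<^esub> r"
            using v' wq \<delta>'[OF s] r(2)[OF s] unfolding w(2)
            by (metis G.smult_closed module_hom_add[OF f] module_hom_smult[OF f])
          moreover have fv: "f s v \<in> carrier (filt n a s)" by (rule module_hom_mem[OF f v'])
          moreover have "c (f s v) i = \<zero>" if "i < n" "\<beta> i = \<infinity>" for i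
            using crit[OF fv] v that by auto
          ultimately have "c y i = w q \<otimes> \<rho> i" if "i < n" "\<beta> i = \<infinity>" for i
            using that wq r(1)[OF s] \<rho>K by (simp add: c_add c_smult \<rho>_def)
          then show "\<exists>k\<in>carrier R. \<forall>i<n. \<beta> i = \<infinity> \<longrightarrow> c y i = k \<otimes> \<rho> i" using wq by blast
        next
          assume "\<exists>k\<in>carrier R. \<forall>i<n. \<beta> i = \<infinity> \<longrightarrow> c y i = k \<otimes> \<rho> i"
          then obtain k where k: "k \<in> carrier R" "\<And>i. i < n \<Longrightarrow> \<beta> i = \<infinity> \<Longrightarrow> c y i = k \<otimes> \<rho> i" by blast
          interpret F: vectorspace R "filt n a s" by (rule F)
          interpret G: module R "filt m b s" by (rule GM)
          interpret N: module R "coord R {..<m} ({j. b j \<le> s} \<inter> insert q J)"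
            by (rule vectorspace_module[OF vectorspace_coord[OF field_axioms]])
          let ?u = "y \<oplus>\<^bsub>filt n a s\<^esub> (\<ominus> k) \<odot>\<^bsub>filt n a s\<^esub> r"
          have u: "?u \<in> carrier (filt n a s)" using y k r(1)[OF s] by auto
          have "c ?u i = \<zero>" if "i < n" "\<beta> i = \<infinity>" for i
            using that k y r(1)[OF s] \<rho>K[OF that(1)]
            by (simp add: c_add c_smult \<rho>_def[symmetric] l_minus r_neg)
          then have "?u \<in> ?N J s" using crit[OF u] alive s by blast
          then obtain v where v: "v \<in> carrier (coord R {..<m} ({j. b j \<le> s} \<inter> J))" "?u = f s v" by auto
          let ?w = "v \<oplus>\<^bsub>filt m b s\<^esub> k \<odot>\<^bsub>filt m b s\<^esub> \<delta>"
          have v': "v \<in> carrier (filt m b s)" using v(1) Nsub by blast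
          have "v \<in> carrier (coord R {..<m} ({j. b j \<le> s} \<inter> insert q J))"
            using v(1) coord_mono[of "{j. b j \<le> s} \<inter> J" "{j. b j \<le> s} \<inter> insert q J"] by blast
          then have w: "?w \<in> carrier (coord R {..<m} ({j. b j \<le> s} \<inter> insert q J))"
            using N.a_closed[OF _ N.smult_closed[OF k(1) \<delta>[OF s]]] by (simp add: coord_simps)
          have "f s ?w = ?u \<oplus>\<^bsub>filt n a s\<^esub> k \<odot>\<^bsub>filt n a s\<^esub> r"
            using v' k(1) \<delta>'[OF s] r(2)[OF s] v(2)
            by (simp add: module_hom_add[OF f] module_hom_smult[OF f])
          also have "\<dots> = y"
            using y k(1) r(1)[OF s]
            by (simp add: F.a_assoc F.smult_l_distr[symmetric] l_neg)
          finally show "y \<in> ?N (insert q J) s" using w by (metis image_eqI)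
        qed
        show "\<exists>c \<beta>. filt_aut n a c \<and> (\<forall>i<n. ereal (a i) \<le> \<beta> i) \<and>
          (\<forall>i<n. \<beta> i = \<infinity> \<or> (\<exists>j\<in>insert q J. \<beta> i = ereal (b j))) \<and>
          (\<forall>s. \<forall>y\<in>carrier (filt n a s). y \<in> ?N (insert q J) s \<longleftrightarrow>
            (\<forall>i<n. ereal s < \<beta> i \<longrightarrow> c y i = \<zero>))"
        proof (cases "\<exists>i<n. \<beta> i = \<infinity> \<and> \<rho> i \<noteq> \<zero>")
          \<comment> \<open>The new relation is already a combination of the earlier ones, so
            coordinates and ends stay as they are.\<close>
          case False
          have "y \<in> ?N (insert q J) s \<longleftrightarrow> (\<forall>i<n. ereal s < \<beta> i \<longrightarrow> c y i = \<zero>)"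
            if y: "y \<in> carrier (filt n a s)" for s y
          proof (cases "s < b q")
            case True
            then show ?thesis using crit[OF y] by (simp add: early)
          next
            case late_s: False
            then have s: "b q \<le> s" by simp
            have "k \<otimes> \<rho> i = \<zero>" if "k \<in> carrier R" "i < n" "\<beta> i = \<infinity>" for k i
              using False that by auto
            then show ?thesis
              unfolding late[OF s y] using alive[OF _ s] by (metis zero_closed)
          qed
          then show ?thesis using c a\<beta> \<beta> by (intro exI[of _ c] exI[of _ \<beta>]) blast
        next
          case True
          \<comment> \<open>The infinite bars that the relation involves. The pivot \<open>j\<close>
            needs the largest start, since clearing coordinate \<open>i\<close> by means of
            \<open>j\<close> is compatible with degrees only for
            \<open>a i \<le> a j\<close>.\<close>
          define A where "A = {i. i < n \<and> \<beta> i = \<infinity> \<and> \<rho> i \<noteq> \<zero>}"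
          have A: "finite A" "A \<noteq> {}" using True by (auto simp: A_def)
          then have "Max (a ` A) \<in> a ` A" by simp
          then obtain j where jA: "j \<in> A" and "a j = Max (a ` A)" by auto
          then have young: "a i \<le> a j" if "i \<in> A" for i using A that by simp
          have j: "j < n" "\<beta> j = \<infinity>" "\<rho> j \<noteq> \<zero>" using jA by (auto simp: A_def)
          define \<iota> where "\<iota> = inv (\<rho> j)"
          have \<iota>: "\<iota> \<in> carrier R" "\<rho> j \<otimes> \<iota> = \<one>"
            using j \<rho>K[OF j(1)] by (auto simp: \<iota>_def field_Units)
          define \<mu> where "\<mu> i = (if i \<noteq> j \<and> \<beta> i = \<infinity> then \<ominus> (\<rho> i \<otimes> \<iota>) else \<zero>)" for i
          define T where "T z = (\<lambda>i\<in>{..<n}. z i \<oplus> \<mu> i \<otimes> z j)" for z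
          have T: "filt_aut n a T"
            unfolding T_def
          proof (rule filt_aut_shear[OF j(1)])
            show "\<mu> j = \<zero>" by (simp add: \<mu>_def)
            show "\<mu> i \<in> carrier R" if "i < n" for i using \<rho>K[OF that] \<iota> by (simp add: \<mu>_def)
            show "a i \<le> a j" if "i < n" "\<mu> i \<noteq> \<zero>" for i
              using that \<iota> by (intro young) (auto simp: \<mu>_def A_def split: if_splits)
          qed
          define \<beta>' where "\<beta>' = \<beta>(j := ereal (b q))"
          have T_iff: "T z i = \<zero> \<longleftrightarrow> (if i \<noteq> j \<and> \<beta> i = \<infinity> then z i = \<rho> i \<otimes> (\<iota> \<otimes> z j) else z i = \<zero>)"
            if z: "\<And>i. i < n \<Longrightarrow> z i \<in> carrier R" and i: "i < n" for z i
          proof -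
            have "z i \<oplus> \<ominus> (\<rho> i \<otimes> \<iota>) \<otimes> z j = z i \<ominus> \<rho> i \<otimes> (\<iota> \<otimes> z j)"
              using z i j(1) \<rho>K[OF i] \<iota>(1) by (simp add: l_minus m_assoc a_minus_def)
            then show ?thesis using z i j(1) \<rho>K[OF i] \<iota>(1) by (auto simp: T_def \<mu>_def)
          qed
          \<comment> \<open>The relation lives in degree \<open>b q\<close> and involves generator
            \<open>j\<close>. Equality is possible, so the bar may be empty; such bars are discarded
            when \<open>M\<close> is identified.\<close>
          have "a j \<le> b q"
            using c_mem[OF r(1)[of "b q"]] j(1,3) by (force simp: \<rho>_def coord_mem)
          then have a\<beta>': "\<forall>i<n. ereal (a i) \<le> \<beta>' i" using a\<beta> by (simp add: \<beta>'_def)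
          have \<beta>': "\<forall>i<n. \<beta>' i = \<infinity> \<or> (\<exists>j\<in>insert q J. \<beta>' i = ereal (b j))"
            using \<beta> by (auto simp: \<beta>'_def)
          have "y \<in> ?N (insert q J) s \<longleftrightarrow> (\<forall>i<n. ereal s < \<beta>' i \<longrightarrow> T (c y) i = \<zero>)"
            if y: "y \<in> carrier (filt n a s)" for s y
          proof (cases "s < b q")
            case True
            have lt: "ereal s < \<beta>' i \<longleftrightarrow> ereal s < \<beta> i" for i using True j(2) by (simp add: \<beta>'_def)
            \<comment> \<open>Before \<open>b q\<close> the bar \<open>j\<close> is still alive, so
              both sides force coordinate \<open>j\<close> to vanish, and then the shear changes
              nothing.\<close>
            have "(\<forall>i<n. ereal s < \<beta> i \<longrightarrow> T (c y) i = \<zero>) \<longleftrightarrow> (\<forall>i<n. ereal s < \<beta> i \<longrightarrow> c y i = \<zero>)"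
            proof (cases "c y j = \<zero>")
              case True
              then have "T (c y) i = \<zero> \<longleftrightarrow> c y i = \<zero>" if "i < n" for i
                using T_iff[of "c y" i] cK[OF y] \<iota>(1) \<rho>K that by simp
              then show ?thesis by auto
            next
              case False
              then have "T (c y) j \<noteq> \<zero>" using T_iff[of "c y" j] cK[OF y] j(1) by simp
              then show ?thesis using False j(1,2) by force
            qed
            then show ?thesis unfolding lt early[OF True] crit[OF y] by simp
          next
            case False
            then have s: "b q \<le> s" by simp
            have lt: "ereal s < \<beta>' i \<longleftrightarrow> i \<noteq> j \<and> \<beta> i = \<infinity>" if "i < n" for i
              using alive[OF that s] False by (auto simp: \<beta>'_def)
            \<comment> \<open>The pivot coordinate forces \<open>k\<close> to be
              \<open>\<iota> \<otimes> c y j\<close>. The condition at \<open>j\<close> then holds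
              by itself, which is why \<open>j\<close> is no longer tested and its bar ends at
              \<open>b q\<close>.\<close>
            have "(\<exists>k\<in>carrier R. \<forall>i<n. \<beta> i = \<infinity> \<longrightarrow> c y i = k \<otimes> \<rho> i) \<longleftrightarrow>
                (\<forall>i<n. i \<noteq> j \<and> \<beta> i = \<infinity> \<longrightarrow> c y i = \<rho> i \<otimes> (\<iota> \<otimes> c y j))" (is "?l \<longleftrightarrow> ?r")
            proof
              assume ?l
              then obtain k where k: "k \<in> carrier R" "\<And>i. i < n \<Longrightarrow> \<beta> i = \<infinity> \<Longrightarrow> c y i = k \<otimes> \<rho> i" by blast
              have "\<iota> \<otimes> c y j = k \<otimes> (\<rho> j \<otimes> \<iota>)"
                using k(1) \<iota>(1) \<rho>K[OF j(1)] k(2)[OF j(1,2)] by (simp add: m_ac)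
              then show ?r using k \<rho>K \<iota>(2) by (simp add: m_comm)
            next
              assume ?r
              moreover have "c y j = (\<iota> \<otimes> c y j) \<otimes> \<rho> j"
                using \<iota> \<rho>K[OF j(1)] cK[OF y j(1)] by (metis m_assoc m_comm l_one)
              ultimately show ?l
                using cK[OF y] \<rho>K \<iota>(1) j(1)
                by (intro bexI[of _ "\<iota> \<otimes> c y j"]) (auto simp: m_comm[of "\<iota> \<otimes> c y j"])
            qed
            then show ?thesis
              unfolding late[OF s y] using lt T_iff[of "c y"] cK[OF y] by auto
          qed
          then show ?thesis
            using filt_aut_comp[OF c T] a\<beta>' \<beta>' by (intro exI[of _ "\<lambda>y. T (c y)"] exI[of _ \<beta>']) blast
        qed
      qed
    qed
  qed
  from this[of "{..<m}"] obtain c \<beta> where "filt_aut n a c" "\<forall>i<n. ereal (a i) \<le> \<beta> i"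
    "\<forall>s. \<forall>y\<in>carrier (filt n a s). y \<in> ?N {..<m} s \<longleftrightarrow> (\<forall>i<n. ereal s < \<beta> i \<longrightarrow> c y i = \<zero>)"
    by blast
  moreover have "coord R {..<m} ({j. b j \<le> s} \<inter> {..<m}) = filt m b s" for s
    by (auto simp: coord_def)
  ultimately show ?thesis by auto
qed

text \<open>In the coordinates \<open>c\<close>, membership in the relations is a condition on each
  coordinate separately. Reading the coordinates of the bars alive at \<open>s\<close> is thus an
  epimorphism onto a sum of bars with the same kernel as the presentation of
  \<open>M\<close>.\<close>

lemma finitely_presented_iso_bars:
  assumes "finitely_presented_pm R M"
  shows "\<exists>n (a :: nat \<Rightarrow> real) b. (\<forall>i<n. ereal (a i) < b i) \<and> pm_iso R M (bars R {..<n} a b)"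
proof -
  have M: "persistence_module R M" using assms by (simp add: finitely_presented_pm_def)
  obtain m n b a f p where f: "f \<in> pm_hom R (free_pm R m b) (free_pm R n a)"
    and p: "p \<in> pm_epi R (free_pm R n a) M"
    and ex: "pm_exact_at (free_pm R m b) (free_pm R n a) M f p"
    using assms by (auto simp: finitely_presented_pm_def)
  have free: "free_pm R k g = bars R {..<k} g (\<lambda>_. \<infinity>)" for k g
    by (simp add: free_pm_def bars_def)
  let ?F = "free_pm R n a"
  have F: "persistence_module R ?F"
    unfolding free by (rule persistence_module_bars[OF field_axioms])
  have space: "pm_space (free_pm R k g) s = filt k g s" for k g s
    by (simp add: free bars_space[OF field_axioms])
  have map: "pm_map (free_pm R k g) s t z = z" if "z \<in> carrier (filt k g s)" for k g s t z
    using that by (auto simp: free bars_map coord_mem extensional_def fun_eq_iff)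
  obtain c \<beta> where c: "filt_aut n a c" and "\<forall>i<n. ereal (a i) \<le> \<beta> i"
    and crit: "\<And>s y. y \<in> carrier (filt n a s) \<Longrightarrow>
      y \<in> f s ` carrier (filt m b s) \<longleftrightarrow> (\<forall>i<n. ereal s < \<beta> i \<longrightarrow> c y i = \<zero>)"
  proof -
    have "f s \<in> module_hom R (filt m b s) (filt n a s)" for s
      using pm_homD(1)[OF f, of s] by (simp add: space)
    moreover have "f t w = f s w" if "s \<le> t" "w \<in> carrier (filt m b s)" for s t w
      using pm_homD(3)[OF f that(1), of w] that(2) pm_homD(2)[OF f, of w s] by (simp add: space map)
    ultimately show ?thesis using presentation_reduction[of f m b n a] that by blast
  qed
  have c_hom: "c \<in> module_hom R (filt n a s) (filt n a s)"
    and c_bij: "c ` carrier (filt n a s) = carrier (filt n a s)" for s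
    using c by (auto simp: filt_aut_def bij_betw_def)
  have c_mem: "c y \<in> carrier (filt n a s)" if "y \<in> carrier (filt n a s)" for s y
    by (rule module_hom_mem[OF c_hom that])
  \<comment> \<open>Generators cancelled in their own degree give empty bars and are dropped;
    \<open>h\<close> renumbers the others.\<close>
  define A where "A = {i. i < n \<and> ereal (a i) < \<beta> i}"
  have "finite A" by (simp add: A_def)
  then obtain h where h: "bij_betw h {0..<card A} A" using ex_bij_betw_nat_finite by blast
  define l where "l = card A"
  have hA: "h k < n" "ereal (a (h k)) < \<beta> (h k)" if "k < l" for k
    using h that by (auto simp: bij_betw_def l_def A_def)
  define S where "S = bars R {..<l} (\<lambda>k. a (h k)) (\<lambda>k. \<beta> (h k))"
  have S: "persistence_module R S" unfolding S_def by (rule persistence_module_bars[OF field_axioms])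
  have space_S: "pm_space S s = coord R {..<l} {k. a (h k) \<le> s \<and> ereal s < \<beta> (h k)}" for s
    by (simp add: S_def bars_space[OF field_axioms])
  define q where "q s y = (\<lambda>k\<in>{..<l}. if a (h k) \<le> s \<and> ereal s < \<beta> (h k) then c y (h k) else \<zero>)" for s y
  have q: "q \<in> pm_hom R ?F S"
    unfolding pm_hom_def
  proof (intro CollectI conjI allI impI ballI)
    show "q s \<in> module_hom R (pm_space ?F s) (pm_space S s)" for s
      unfolding space space_S
    proof (rule coord_hom[OF field_axioms])
      show "q s z \<in> carrier (coord R {..<l} {k. a (h k) \<le> s \<and> ereal s < \<beta> (h k)})"
        if "z \<in> carrier (filt n a s)" for z
        using c_mem[OF that] hA by (auto simp: q_def coord_mem)
      show "q s (x \<oplus>\<^bsub>filt n a s\<^esub> y) i = q s x i \<oplus> q s y i"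
        if "x \<in> carrier (filt n a s)" "y \<in> carrier (filt n a s)" "i \<in> {..<l}" for x y i
        using that hA module_hom_add[OF c_hom that(1,2)] by (simp add: q_def coord_simps)
      show "q s (k \<odot>\<^bsub>filt n a s\<^esub> x) i = k \<otimes> q s x i"
        if "k \<in> carrier R" "x \<in> carrier (filt n a s)" "i \<in> {..<l}" for k x i
        using that hA module_hom_smult[OF c_hom that(1,2)] by (simp add: q_def coord_simps)
    qed
    fix s t :: real and y assume "s \<le> t" and y: "y \<in> carrier (pm_space ?F s)"
    have y: "y \<in> carrier (filt n a s)" using y by (simp add: space)
    have "c y (h k) = \<zero>" if "k < l" "\<not> a (h k) \<le> s" for k
      using c_mem[OF y] hA that by (auto simp: coord_mem)
    then show "q t (pm_map ?F s t y) = pm_map S s t (q s y)"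
      using y \<open>s \<le> t\<close> by (auto simp: map q_def S_def bars_map intro!: restrict_ext intro: ereal_le_less)
  qed
  have "q s ` carrier (pm_space ?F s) = carrier (pm_space S s)" for s
  proof (intro equalityI subsetI)
    fix w assume w: "w \<in> carrier (pm_space S s)"
    define z where "z = (\<lambda>i\<in>{..<n}. if i \<in> A then w (inv_into {0..<l} h i) else \<zero>)"
    have inv: "inv_into {0..<l} h i < l" "h (inv_into {0..<l} h i) = i" if "i \<in> A" for i
      using bij_betw_imp_surj_on[OF h] that inv_into_into[of i h "{0..<l}"] f_inv_into_f[of i h "{0..<l}"]
      by (auto simp: l_def)
    have inv': "inv_into {0..<l} h (h k) = k" if "k < l" for k
      using h that by (auto simp: bij_betw_def l_def inv_into_f_f)
    have "z \<in> carrier (filt n a s)"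
      using w inv by (auto simp: z_def space_S coord_mem)
    then have "z \<in> c ` carrier (filt n a s)" by (simp add: c_bij)
    then obtain y where y: "y \<in> carrier (filt n a s)" "c y = z" by blast
    have "q s y = w"
    proof (rule coord_eqI[of _ R "{..<l}" "{k. a (h k) \<le> s \<and> ereal s < \<beta> (h k)}"])
      show "q s y \<in> carrier (coord R {..<l} {k. a (h k) \<le> s \<and> ereal s < \<beta> (h k)})"
        using pm_homD(2)[OF q, of y s] y(1) by (simp add: space space_S)
      show "w \<in> carrier (coord R {..<l} {k. a (h k) \<le> s \<and> ereal s < \<beta> (h k)})"
        using w by (simp add: space_S)
      fix k assume "k \<in> {..<l}"
      then show "q s y k = w k"
        using w hA[of k] inv'[of k] by (auto simp: q_def y(2) z_def A_def space_S coord_mem)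
    qed
    then show "w \<in> q s ` carrier (pm_space ?F s)" using y(1) by (auto simp: space)
  qed (use pm_homD(2)[OF q] in blast)
  then have q_epi: "q \<in> pm_epi R ?F S" using q by (simp add: pm_epi_def)
  have "pm_iso R M S"
  proof (rule pm_iso_of_epis[OF F M S p q_epi])
    fix s x assume "x \<in> carrier (pm_space ?F s)"
    then have x: "x \<in> carrier (filt n a s)" by (simp add: space)
    have "p s x = \<zero>\<^bsub>pm_space M s\<^esub> \<longleftrightarrow> x \<in> f s ` carrier (filt m b s)"
      using ex x by (auto simp: pm_exact_at_def space)
    also have "\<dots> \<longleftrightarrow> (\<forall>i<n. ereal s < \<beta> i \<longrightarrow> c x i = \<zero>)" by (rule crit[OF x])
    \<comment> \<open>Generators that start after \<open>s\<close> have coordinate zero anyway, and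
      one with \<open>a i \<le> s\<close> and \<open>s < \<beta> i\<close> belongs to
      \<open>A\<close>.\<close>
    also have "\<dots> \<longleftrightarrow> (\<forall>i\<in>A. a i \<le> s \<and> ereal s < \<beta> i \<longrightarrow> c x i = \<zero>)"
    proof (intro iffI ballI allI impI)
      fix i assume "\<forall>i\<in>A. a i \<le> s \<and> ereal s < \<beta> i \<longrightarrow> c x i = \<zero>" "i < n" "ereal s < \<beta> i"
      then show "c x i = \<zero>"
        using c_mem[OF x] ereal_le_less[of "a i" s "\<beta> i"] by (cases "a i \<le> s") (auto simp: A_def coord_mem)
    qed (auto simp: A_def)
    also have "A = h ` {..<l}"
      using bij_betw_imp_surj_on[OF h] by (simp add: l_def atLeast0LessThan)
    also have "(\<forall>i\<in>h ` {..<l}. a i \<le> s \<and> ereal s < \<beta> i \<longrightarrow> c x i = \<zero>) \<longleftrightarrow> q s x = \<zero>\<^bsub>pm_space S s\<^esub>"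
      by (auto simp: q_def space_S coord_simps fun_eq_iff restrict_def)
    finally show "p s x = \<zero>\<^bsub>pm_space M s\<^esub> \<longleftrightarrow> q s x = \<zero>\<^bsub>pm_space S s\<^esub>" .
  qed
  then show ?thesis
    using hA(2) unfolding S_def
    by (intro exI[of _ l] exI[of _ "\<lambda>k. a (h k)"] exI[of _ "\<lambda>k. \<beta> (h k)"]) auto
qed

section \<open>Invariance of dimension\<close>

text \<open>Gaussian elimination, by induction on the target coordinates. If coordinate
  \<open>p\<close> of \<open>g\<close> is not identically zero, a vector \<open>u\<close> on which
  it does not vanish is used to clear it, at the price of one source coordinate \<open>j\<close>
  with \<open>u j\<close> non-zero.\<close>

lemma coord_inj_card_le:
  fixes I :: "'i set" and I' :: "'j set"
  assumes "finite J'" "J' \<subseteq> I'" "finite J" "J \<subseteq> I"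
    and "g \<in> module_hom R (coord R I J) (coord R I' J')" "inj_on g (carrier (coord R I J))"
  shows "card J \<le> card J'"
  using assms
proof (induction J' arbitrary: J g)
  case (empty J g)
  interpret V: vectorspace R "coord R I J" by (rule vectorspace_coord[OF field_axioms])
  have False if j: "j \<in> J" for j
  proof -
    let ?u = "unit_coord R I j"
    have u: "?u \<in> carrier (coord R I J)" by (rule unit_coord_mem[OF field_axioms j])
    have "g x = (\<lambda>i\<in>I'. \<zero>)" if "x \<in> carrier (coord R I J)" for x
      using module_hom_mem[OF empty.prems(4) that] by (auto simp: coord_mem extensional_def fun_eq_iff)
    then have "?u = \<zero>\<^bsub>coord R I J\<^esub>" using inj_onD[OF empty.prems(5) _ u V.zero_closed] u by simp
    from fun_cong[OF this, of j] show False
      using j empty.prems(3) by (auto simp: unit_coord_def coord_simps)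
  qed
  then have "J = {}" by blast
  then show ?case by simp
next
  case (insert p J' J g)
  let ?V = "coord R I J" and ?W = "coord R I' (insert p J')"
  interpret V: vectorspace R ?V by (rule vectorspace_coord[OF field_axioms])
  interpret W: vectorspace R ?W by (rule vectorspace_coord[OF field_axioms])
  note g = insert.prems(4) and inj = insert.prems(5)
  have p: "p \<in> I'" and J': "J' \<subseteq> I'" using insert.prems(1) by auto
  have gK: "g z i \<in> carrier R" if "z \<in> carrier ?V" "i \<in> I'" for z i
    using module_hom_mem[OF g that(1)] that(2) by (simp add: coord_mem)
  have g_add: "g (x \<oplus>\<^bsub>?V\<^esub> y) i = g x i \<oplus> g y i" if "x \<in> carrier ?V" "y \<in> carrier ?V" "i \<in> I'" for x y i
    unfolding module_hom_add[OF g that(1,2)] using that(3) by (simp add: coord_simps)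
  have g_smult: "g (k \<odot>\<^bsub>?V\<^esub> x) i = k \<otimes> g x i" if "k \<in> carrier R" "x \<in> carrier ?V" "i \<in> I'" for k x i
    unfolding module_hom_smult[OF g that(1,2)] using that(3) by (simp add: coord_simps)
  show ?case
  proof (cases "\<forall>z\<in>carrier ?V. g z p = \<zero>")
    case True
    have "g \<in> module_hom R ?V (coord R I' J')"
    proof (rule coord_hom[OF field_axioms])
      show "g z \<in> carrier (coord R I' J')" if "z \<in> carrier ?V" for z
        using module_hom_mem[OF g that] True that by (auto simp: coord_mem)
    qed (simp_all add: g_add g_smult)
    then have "card J \<le> card J'" using insert.IH J' insert.prems inj by blast
    then show ?thesis using insert.hyps by simp
  next
    case False
    then obtain u where u: "u \<in> carrier ?V" "g u p \<noteq> \<zero>" by blast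
    have u0: "u \<noteq> \<zero>\<^bsub>?V\<^esub>"
    proof
      assume "u = \<zero>\<^bsub>?V\<^esub>"
      then have "g u = \<zero>\<^bsub>?W\<^esub>" using module_hom_zero[OF V.module_axioms W.module_axioms g] by simp
      then show False using u(2) p by (simp add: coord_simps)
    qed
    have "\<exists>j\<in>J. u j \<noteq> \<zero>"
    proof (rule ccontr)
      assume no: "\<not> ?thesis"
      have "u = \<zero>\<^bsub>?V\<^esub>"
        by (rule coord_eqI[OF u(1) V.zero_closed]) (use u(1) no in \<open>auto simp: coord_mem coord_simps\<close>)
      then show False using u0 by simp
    qed
    then obtain j where j: "j \<in> J" "u j \<noteq> \<zero>" by blast
    then have jI: "j \<in> I" using insert.prems(3) by auto
    have uj: "u j \<in> carrier R" using u(1) jI by (simp add: coord_mem)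
    define \<tau> where "\<tau> = inv (g u p)"
    have \<tau>: "\<tau> \<in> carrier R" "\<tau> \<otimes> g u p = \<one>" using u gK[OF u(1) p] by (auto simp: \<tau>_def field_Units)
    define k where "k z = \<ominus> (g z p \<otimes> \<tau>)" for z
    \<comment> \<open>Projection along \<open>u\<close> onto the kernel of coordinate
      \<open>p\<close> of \<open>g\<close>.\<close>
    define s where "s z = z \<oplus>\<^bsub>?V\<^esub> k z \<odot>\<^bsub>?V\<^esub> u" for z
    let ?V' = "coord R I (J - {j})"
    interpret V': vectorspace R ?V' by (rule vectorspace_coord[OF field_axioms])
    have sub: "z \<in> carrier ?V" if "z \<in> carrier ?V'" for z using that by (auto simp: coord_mem)
    have k: "k z \<in> carrier R" if "z \<in> carrier ?V" for z using gK[OF that p] \<tau> by (simp add: k_def)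
    have s: "s z \<in> carrier ?V" if "z \<in> carrier ?V" for z using that k u by (simp add: s_def)
    have gs: "g (s z) i = g z i \<oplus> k z \<otimes> g u i" if "z \<in> carrier ?V" "i \<in> I'" for z i
      using that k u by (simp add: s_def g_add g_smult)
    have gsp: "g (s z) p = \<zero>" if "z \<in> carrier ?V" for z
    proof -
      have "k z \<otimes> g u p = \<ominus> (g z p)"
        using gK[OF that p] gK[OF u(1) p] \<tau> by (simp add: k_def l_minus m_assoc)
      then show ?thesis using gs[OF that p] gK[OF that p] by (simp add: r_neg)
    qed
    have "(\<lambda>z. g (s z)) \<in> module_hom R ?V' (coord R I' J')"
    proof (rule coord_hom[OF field_axioms])
      show "g (s z) \<in> carrier (coord R I' J')" if "z \<in> carrier ?V'" for z
        using module_hom_mem[OF g s[OF sub[OF that]]] gsp[OF sub[OF that]] by (auto simp: coord_mem)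
      show "g (s (x \<oplus>\<^bsub>?V'\<^esub> y)) i = g (s x) i \<oplus> g (s y) i"
        if "x \<in> carrier ?V'" "y \<in> carrier ?V'" "i \<in> I'" for x y i
      proof -
        have xy: "x \<in> carrier ?V" "y \<in> carrier ?V" using that sub by auto
        have "x \<oplus>\<^bsub>?V'\<^esub> y = x \<oplus>\<^bsub>?V\<^esub> y" by (simp add: coord_simps)
        moreover have "k (x \<oplus>\<^bsub>?V\<^esub> y) = k x \<oplus> k y"
          using xy gK[OF xy(1) p] gK[OF xy(2) p] \<tau> p by (simp add: k_def g_add l_distr minus_add)
        ultimately show ?thesis
          using xy that(3) k gK[OF xy(1) that(3)] gK[OF xy(2) that(3)] gK[OF u(1) that(3)]
          by (simp add: gs g_add l_distr a_ac)
      qed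
      show "g (s (t \<odot>\<^bsub>?V'\<^esub> x)) i = t \<otimes> g (s x) i"
        if "t \<in> carrier R" "x \<in> carrier ?V'" "i \<in> I'" for t x i
      proof -
        have x: "x \<in> carrier ?V" using that sub by auto
        have "t \<odot>\<^bsub>?V'\<^esub> x = t \<odot>\<^bsub>?V\<^esub> x" by (simp add: coord_simps)
        moreover have "k (t \<odot>\<^bsub>?V\<^esub> x) = t \<otimes> k x"
          using x that(1) gK[OF x p] \<tau> p by (simp add: k_def g_smult r_minus m_assoc)
        ultimately show ?thesis
          using x that(1,3) k gK[OF x that(3)] gK[OF u(1) that(3)]
          by (simp add: gs g_smult r_distr m_assoc)
      qed
    qed
    \<comment> \<open>If \<open>s z\<close> vanishes, then \<open>z\<close> is a multiple of
      \<open>u\<close>; since coordinate \<open>j\<close> is zero in \<open>z\<close> but not in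
      \<open>u\<close>, the multiple is zero.\<close>
    moreover have "inj_on (\<lambda>z. g (s z)) (carrier ?V')"
    proof (rule module_hom_injI[OF V'.module_axioms _ calculation])
      show "module R (coord R I' J')" by (rule vectorspace_module[OF vectorspace_coord[OF field_axioms]])
      fix z assume z: "z \<in> carrier ?V'" and "g (s z) = \<zero>\<^bsub>coord R I' J'\<^esub>"
      moreover have "\<zero>\<^bsub>coord R I' J'\<^esub> = \<zero>\<^bsub>?W\<^esub>" by (simp add: coord_simps)
      ultimately have "g (s z) = g \<zero>\<^bsub>?V\<^esub>"
        using module_hom_zero[OF V.module_axioms W.module_axioms g] by simp
      then have sz0: "s z = \<zero>\<^bsub>?V\<^esub>" using inj_onD[OF inj _ s[OF sub[OF z]] V.zero_closed] by simp
      have sz: "z i \<oplus> k z \<otimes> u i = \<zero>" if "i \<in> I" for i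
        using fun_cong[OF sz0, of i] that by (simp add: s_def coord_simps)
      have "z j = \<zero>" using z jI by (simp add: coord_mem)
      then have "k z = \<zero>"
        using sz[OF jI] j(2) uj k[OF sub[OF z]] by (simp add: integral_iff)
      then have "z i = \<zero>" if "i \<in> I" for i
        using sz[OF that] z u(1) that by (simp add: coord_mem)
      then show "z = \<zero>\<^bsub>?V'\<^esub>"
        by (intro coord_eqI[OF z V'.zero_closed]) (simp add: coord_simps)
    qed
    moreover have "finite (J - {j})" "J - {j} \<subseteq> I" using insert.prems by auto
    ultimately have "card (J - {j}) \<le> card J'" using insert.IH[OF J'] by blast
    then show ?thesis using insert.hyps insert.prems(2) j(1) by simp
  qed
qed

end

lemma coord_restrict: "coord K I J = coord K I (I \<inter> J)"
  by (auto simp: coord_def)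

lemma coord_iso_card:
  assumes K: "field K" and fin: "finite I" "finite I'"
    and g: "g \<in> module_hom K (coord K I J) (coord K I' J')"
    and bij: "bij_betw g (carrier (coord K I J)) (carrier (coord K I' J'))"
  shows "card (I \<inter> J) = card (I' \<inter> J')"
proof (rule antisym)
  show "card (I \<inter> J) \<le> card (I' \<inter> J')"
    using g bij fin
    by (intro field.coord_inj_card_le[OF K, of _ I' _ I g])
      (auto simp: bij_betw_def coord_restrict[symmetric])
  have "inv_into (carrier (coord K I J)) g \<in> module_hom K (coord K I' J') (coord K I J)"
    by (rule module_hom_inv[OF g bij vectorspace_module[OF vectorspace_coord[OF K]]])
  then show "card (I' \<inter> J') \<le> card (I \<inter> J)"
    using bij_betw_inv_into[OF bij] fin
    by (intro field.coord_inj_card_le[OF K, of _ I _ I' "inv_into (carrier (coord K I J)) g"])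
      (auto simp: bij_betw_def coord_restrict[symmetric])
qed

section \<open>Magnitudes\<close>

lemma graded_sum_point_eq_coord:
  assumes "field K"
  shows "graded_sum I (\<lambda>i. graded_point K (a i)) s = coord K I {i. a i = s}"
  unfolding graded_sum_def graded_point_def vs_sum_eq_coord[OF assms] by (auto intro: arg_cong)

text \<open>Uniqueness for the \<open>THE\<close> in the definition: the number of generators in
  degree \<open>s\<close> is the dimension of \<open>G s\<close>, and the sum depends only on these
  multiplicities.\<close>

lemma graded_magnitude_eq:
  fixes a :: "nat \<Rightarrow> real"
  assumes K: "field K" and G: "\<And>s. vectorspace K (G s)"
    and iso: "graded_iso K G (graded_sum {..<n} (\<lambda>i. graded_point K (a i)))"
  shows "graded_magnitude K G = (\<Sum>i<n. exp (- a i))"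
  unfolding graded_magnitude_def
proof (rule the_equality)
  show "\<exists>n' (a' :: nat \<Rightarrow> real). graded_iso K G (graded_sum {..<n'} (\<lambda>i. graded_point K (a' i))) \<and>
      (\<Sum>i<n. exp (- a i)) = (\<Sum>i<n'. exp (- a' i))"
    using iso by blast
next
  fix r assume "\<exists>n' (a' :: nat \<Rightarrow> real). graded_iso K G (graded_sum {..<n'} (\<lambda>i. graded_point K (a' i))) \<and>
      r = (\<Sum>i<n'. exp (- a' i))"
  then obtain n' :: nat and a' where iso': "graded_iso K G (graded_sum {..<n'} (\<lambda>i. graded_point K (a' i)))"
    and r: "r = (\<Sum>i<n'. exp (- a' i))" by blast
  have card: "card {i. i < n \<and> a i = s} = card {i. i < n' \<and> a' i = s}" for s
  proof -
    let ?A = "coord K {..<n} {i. a i = s}" and ?B = "coord K {..<n'} {i. a' i = s}"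
    obtain f where f: "f \<in> module_hom K (G s) ?A" "bij_betw f (carrier (G s)) (carrier ?A)"
      using iso by (auto simp: graded_iso_def graded_sum_point_eq_coord[OF K])
    obtain g where g: "g \<in> module_hom K (G s) ?B" "bij_betw g (carrier (G s)) (carrier ?B)"
      using iso' by (auto simp: graded_iso_def graded_sum_point_eq_coord[OF K])
    let ?h = "\<lambda>x. g (inv_into (carrier (G s)) f x)"
    have "?h \<in> module_hom K ?A ?B"
      by (rule module_hom_comp[OF g(1) module_hom_inv[OF f vectorspace_module[OF G]]])
    moreover have "bij_betw ?h (carrier ?A) (carrier ?B)"
      using bij_betw_trans[OF bij_betw_inv_into[OF f(2)] g(2)] by (simp add: o_def)
    ultimately have "card ({..<n} \<inter> {i. a i = s}) = card ({..<n'} \<inter> {i. a' i = s})"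
      by (intro coord_iso_card[OF K]) auto
    then show ?thesis by (simp add: Int_def)
  qed
  let ?T = "a ` {..<n} \<union> a' ` {..<n'}"
  have "(\<Sum>i<k. exp (- c i)) = (\<Sum>s\<in>?T. real (card {i. i < k \<and> c i = s}) * exp (- s))"
    if "c ` {..<k} \<subseteq> ?T" for k and c :: "nat \<Rightarrow> real"
  proof -
    have "(\<Sum>s\<in>?T. \<Sum>i\<in>{i\<in>{..<k}. c i = s}. exp (- c i)) = (\<Sum>i<k. exp (- c i))"
      by (rule sum.group) (use that in auto)
    moreover have "(\<Sum>i\<in>{i\<in>{..<k}. c i = s}. exp (- c i)) = real (card {i. i < k \<and> c i = s}) * exp (- s)" for s
      by simp
    ultimately show ?thesis by simp
  qed
  from this[of a n] this[of a' n'] show "r = (\<Sum>i<n. exp (- a i))" by (simp add: r card)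
qed

text \<open>Once some resolution is known to exist over the prescribed type, the chosen one is a
  resolution of \<open>M\<close>. Composed with the isomorphism it resolves the bars, where the
  homology has been computed.\<close>

lemma Gr_derived_of_bars:
  fixes K :: "('k, 'm) ring_scheme" and M :: "('k, 'v) pmod" and a :: "nat \<Rightarrow> real"
  assumes K: "field K" and M: "persistence_module K M"
    and ab: "\<And>i. i < n \<Longrightarrow> ereal (a i) < b i" and iso: "pm_iso K M (bars K {..<n} a b)"
  shows "vectorspace K (Gr_derived K 0 M s)" "vectorspace K (Gr_derived K 1 M s)"
    and "graded_iso K (Gr_derived K 0 M) (graded_sum {..<n} (\<lambda>i. graded_point K (a i)))"
    and "\<exists>(l :: nat) (\<beta> :: nat \<Rightarrow> real). graded_iso K (Gr_derived K 1 M) (graded_sum {..<l} (\<lambda>i. graded_point K (\<beta> i))) \<and>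
      (\<Sum>k<l. exp (- \<beta> k)) = (\<Sum>i<n. exp_neg (b i))"
proof -
  let ?S = "bars K {..<n} a b"
  have S: "persistence_module K ?S" by (rule persistence_module_bars[OF K])
  obtain P d where chosen: "chosen_resolution K M = (P, d)" by (cases "chosen_resolution K M")
  have "\<exists>(P :: nat \<Rightarrow> ('k, real \<times> 'v \<Rightarrow> 'k) pmod) d e. projective_resolution K M P d e"
  proof -
    \<comment> \<open>The labels must come from \<open>real \<times> 'v\<close>; the real component
      alone provides enough of them, however small \<open>'v\<close> is.\<close>
    have "inj_on (\<lambda>i. (real i, undefined :: 'v)) {..<n}" by (auto simp: inj_on_def)
    then obtain P :: "nat \<Rightarrow> ('k, real \<times> 'v \<Rightarrow> 'k) pmod" and d e
      where res: "projective_resolution K ?S P d e"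
      using bars_resolution_exists[OF K, of "{..<n}" "\<lambda>i. (real i, undefined)" a b] ab by auto
    obtain f where "f \<in> pm_hom K ?S M"
      "\<And>s. bij_betw (f s) (carrier (pm_space ?S s)) (carrier (pm_space M s))"
      using pm_iso_sym[OF M S iso] by (auto simp: pm_iso_def)
    from projective_resolution_iso[OF S M res this] show ?thesis by blast
  qed
  then have "\<exists>x :: (nat \<Rightarrow> ('k, real \<times> 'v \<Rightarrow> 'k) pmod) \<times> _. case x of (P, d) \<Rightarrow> \<exists>e. projective_resolution K M P d e"
    by auto
  from someI_ex[OF this] obtain e where res: "projective_resolution K M P d e"
    using chosen by (auto simp: chosen_resolution_def)
  obtain f where "f \<in> pm_hom K M ?S"
    "\<And>s. bij_betw (f s) (carrier (pm_space M s)) (carrier (pm_space ?S s))"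
    using iso by (auto simp: pm_iso_def)
  note res' = projective_resolution_iso[OF M S res this]
  interpret bars_resolution K "{..<n}" a b P d "\<lambda>s x. f s (e s x)" ?S
    by (intro bars_resolution.intro bars_resolution_axioms.intro) (use K ab res' in auto)
  have Gr: "Gr_derived K i M = graded_homology (\<lambda>n. Gr K (P n)) (\<lambda>n. Gr_map K (P n) (d n)) i" for i
    by (simp add: Gr_derived_def chosen)
  show "vectorspace K (Gr_derived K 0 M s)" unfolding Gr by (rule homology0(1))
  show "graded_iso K (Gr_derived K 0 M) (graded_sum {..<n} (\<lambda>i. graded_point K (a i)))"
    unfolding Gr graded_iso_def graded_sum_point_eq_coord[OF K]
    by (intro choice allI) (rule homology0(2)[unfolded Bex_def])
  let ?B = "{i \<in> {..<n}. b i \<noteq> \<infinity>}"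
  obtain h where "bij_betw h {0..<card ?B} ?B" using ex_bij_betw_nat_finite[of ?B] by auto
  then have h: "bij_betw h {..<card ?B} ?B" by (simp add: atLeast0LessThan)
  show "vectorspace K (Gr_derived K 1 M s)" unfolding Gr by (rule homology1(1)[OF h])
  have "(\<Sum>k<card ?B. exp (- real_of_ereal (b (h k)))) = (\<Sum>i\<in>?B. exp (- real_of_ereal (b i)))"
    by (rule sum.reindex_bij_betw[OF h])
  \<comment> \<open>Infinite bars give no generator of \<open>Gr_1\<close>, in accordance with the
    value zero of \<open>exp_neg\<close> at \<open>\<infinity>\<close>.\<close>
  also have "\<dots> = (\<Sum>i<n. exp_neg (b i))"
    by (rule sum.mono_neutral_cong_left) (auto simp: exp_neg_def)
  finally have "(\<Sum>k<card ?B. exp (- real_of_ereal (b (h k)))) = (\<Sum>i<n. exp_neg (b i))" .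
  moreover have "graded_iso K (Gr_derived K 1 M)
      (graded_sum {..<card ?B} (\<lambda>k. graded_point K (real_of_ereal (b (h k)))))"
    unfolding Gr graded_iso_def graded_sum_point_eq_coord[OF K]
    by (intro choice allI) (rule homology1(2)[OF h, unfolded Bex_def])
  ultimately show "\<exists>(l :: nat) (\<beta> :: nat \<Rightarrow> real). graded_iso K (Gr_derived K 1 M) (graded_sum {..<l} (\<lambda>i. graded_point K (\<beta> i))) \<and>
      (\<Sum>k<l. exp (- \<beta> k)) = (\<Sum>i<n. exp_neg (b i))"
    by (intro exI[of _ "card ?B"] exI[of _ "\<lambda>k. real_of_ereal (b (h k))"]) simp
qed

theorem lemma5p18:
  fixes K :: "('k, 'm) ring_scheme"
    and M :: "('k, 'v) pmod"
  assumes "field K"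
    and "finitely_presented_pm K M"
  shows "finitely_presented_graded K (Gr_derived K 0 M) \<and>
         finitely_presented_graded K (Gr_derived K 1 M) \<and>
         persistent_magnitude K M =
           graded_magnitude K (Gr_derived K 0 M) - graded_magnitude K (Gr_derived K 1 M)"
proof -
  have M: "persistence_module K M" using assms(2) by (simp add: finitely_presented_pm_def)
  let ?m = "graded_magnitude K (Gr_derived K 0 M) - graded_magnitude K (Gr_derived K 1 M)"
  \<comment> \<open>Proved for every decomposition, not just one: the right-hand side does not refer
    to it, which gives the uniqueness needed for \<open>persistent_magnitude\<close>.\<close>
  have mag: "(\<Sum>i<n. exp (- a i) - exp_neg (b i)) = ?m"
    if ab: "\<And>i. i < n \<Longrightarrow> ereal (a i) < b i" and iso: "pm_iso K M (bars K {..<n} a b)"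
    for n and a :: "nat \<Rightarrow> real" and b
  proof -
    note Gr = Gr_derived_of_bars[OF assms(1) M ab iso]
    obtain l \<beta> where l: "graded_iso K (Gr_derived K 1 M) (graded_sum {..<l :: nat} (\<lambda>i. graded_point K (\<beta> i)))"
      "(\<Sum>k<l. exp (- \<beta> k)) = (\<Sum>i<n. exp_neg (b i))" using Gr(4) by blast
    have "graded_magnitude K (Gr_derived K 0 M) = (\<Sum>i<n. exp (- a i))"
      by (rule graded_magnitude_eq[OF assms(1) Gr(1) Gr(3)])
    moreover have "graded_magnitude K (Gr_derived K 1 M) = (\<Sum>k<l. exp (- \<beta> k))"
      by (rule graded_magnitude_eq[OF assms(1) Gr(2) l(1)])
    ultimately show ?thesis by (simp add: l(2) sum_subtractf)
  qed
  obtain n and a :: "nat \<Rightarrow> real" and b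
    where ab: "\<And>i. i < n \<Longrightarrow> ereal (a i) < b i" and iso: "pm_iso K M (bars K {..<n} a b)"
    using field.finitely_presented_iso_bars[OF assms] by blast
  note Gr = Gr_derived_of_bars[OF assms(1) M ab iso]
  have "persistent_magnitude K M = ?m"
    unfolding persistent_magnitude_def bars_def[symmetric]
    by (rule the_equality) (use mag ab iso in \<open>auto intro!: exI[of _ n] exI[of _ a] exI[of _ b]\<close>)
  then show ?thesis
    using Gr by (auto simp: finitely_presented_graded_def)
qed

end
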